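(* Let $1<p<\infty$ and $Q_1,Q_2\ge1$ be given. Then there are a positive integer $n$, nonempty open sets $\Omega_1\subset\Omega_2\subset\mathbf{R}^n$ and functions $u_1$, $u_2$ such that $u_j$ is a $Q_j$-quasiminimizer in $\Omega_j$, $j=1,2$, and $$u=\begin{cases} u_2, & \text{in } \Omega_2\setminus\Omega_1,\\ \min\{u_1,u_2\}, & \text{in } \Omega_1,\end{cases}$$ is a quasisuperminimizer in $\Omega_2$ with the optimal quasisuperminimizer constant $Q_1Q_2$.
   Context: Let $1<p<\infty$, let $\Omega\subset\mathbf{R}^n$ be a nonempty open set and $Q\ge1$. A function $u\in W^{1,p}_{\rm loc}(\Omega)$ is a $Q$-quasiminimizer in $\Omega$ if $$\int_{\varphi\ne0}|\nabla u|^p\,dx\le Q\int_{\varphi\ne0}|\nabla(u+\varphi)|^p\,dx$$ for all $\varphi\in W^{1,p}_0(\Omega)$, where the integrals are over $\{x\in\Omega:\varphi(x)\ne0\}$. It is a $Q$-quasisuperminimizer in $\Omega$ if this inequality holds for all nonnegative $\varphi\in W^{1,p}_0(\Omega)$, and a quasisuperminimizer if it is a $Q$-quasisuperminimizer for some $Q\ge1$. The optimal quasisuperminimizer constant of $u$ in $\Omega$ is the smallest $Q\ge1$ for which $u$ is a $Q$-quasisuperminimizer in $\Omega$. *)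

theory Defs
  imports "HOL-Analysis.Analysis"
begin

text \<open>
  The dimension is bound by a quantifier in the theorem, so it is a natural number and not a type.
  The space \<open>\<real>\<^sup>n\<close> is the set of extensional functions on \<open>{..<n}\<close>, which is the carrier of both the
  product topology and the product measure.
\<close>

abbreviation Rn :: "nat \<Rightarrow> (nat \<Rightarrow> real) topology" where
  "Rn n \<equiv> powertop_real {..<n}"

definition lebesgue_Rn :: "nat \<Rightarrow> (nat \<Rightarrow> real) measure" where
  "lebesgue_Rn n = completion (\<Pi>\<^sub>M i\<in>{..<n}. lborel)"

definition partial_deriv :: "nat \<Rightarrow> ((nat \<Rightarrow> real) \<Rightarrow> real) \<Rightarrow> (nat \<Rightarrow> real) \<Rightarrow> real" where
  "partial_deriv i f x = deriv (\<lambda>t. f (x(i := t))) (x i)"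

text \<open>All iterated partial derivatives, in any order, exist and are continuous.\<close>

definition smooth_Rn :: "nat \<Rightarrow> ((nat \<Rightarrow> real) \<Rightarrow> real) \<Rightarrow> bool" where
  "smooth_Rn n f \<longleftrightarrow>
    (\<forall>js. set js \<subseteq> {..<n} \<longrightarrow>
      continuous_map (Rn n) euclideanreal (foldr partial_deriv js f) \<and>
      (\<forall>i<n. \<forall>x\<in>topspace (Rn n).
        (\<lambda>t. foldr partial_deriv js f (x(i := t))) differentiable (at (x i))))"

definition test_functions :: "nat \<Rightarrow> (nat \<Rightarrow> real) set \<Rightarrow> ((nat \<Rightarrow> real) \<Rightarrow> real) set" where
  "test_functions n \<Omega> =
    {\<phi>. smooth_Rn n \<phi> \<and>
        compactin (Rn n) (Rn n closure_of {x \<in> topspace (Rn n). \<phi> x \<noteq> 0}) \<and>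
        Rn n closure_of {x \<in> topspace (Rn n). \<phi> x \<noteq> 0} \<subseteq> \<Omega>}"

text \<open>
  Elements of the function spaces below are functions, not equivalence classes; only their values on
  the set in question matter.
\<close>

definition Lp :: "nat \<Rightarrow> real \<Rightarrow> (nat \<Rightarrow> real) set \<Rightarrow> ((nat \<Rightarrow> real) \<Rightarrow> real) set" where
  "Lp n p S =
    {f. f \<in> borel_measurable (restrict_space (lebesgue_Rn n) S) \<and>
        (\<integral>\<^sup>+x\<in>S. ennreal (\<bar>f x\<bar> powr p) \<partial>lebesgue_Rn n) < \<infinity>}"

definition Lp_loc :: "nat \<Rightarrow> real \<Rightarrow> (nat \<Rightarrow> real) set \<Rightarrow> ((nat \<Rightarrow> real) \<Rightarrow> real) set" where
  "Lp_loc n p \<Omega> = {f. \<forall>K. compactin (Rn n) K \<and> K \<subseteq> \<Omega> \<longrightarrow> f \<in> Lp n p K}"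

definition has_weak_gradient ::
  "nat \<Rightarrow> (nat \<Rightarrow> real) set \<Rightarrow> ((nat \<Rightarrow> real) \<Rightarrow> real) \<Rightarrow> ((nat \<Rightarrow> real) \<Rightarrow> nat \<Rightarrow> real) \<Rightarrow> bool" where
  "has_weak_gradient n \<Omega> u g \<longleftrightarrow>
    u \<in> Lp_loc n 1 \<Omega> \<and>
    (\<forall>i<n. (\<lambda>x. g x i) \<in> Lp_loc n 1 \<Omega> \<and>
      (\<forall>\<phi>\<in>test_functions n \<Omega>.
        (LINT x:\<Omega>|lebesgue_Rn n. u x * partial_deriv i \<phi> x) =
        - (LINT x:\<Omega>|lebesgue_Rn n. g x i * \<phi> x)))"

text \<open>Weak gradients are unique up to null sets, so the choice is immaterial under integrals.\<close>

definition weak_gradient ::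
  "nat \<Rightarrow> (nat \<Rightarrow> real) set \<Rightarrow> ((nat \<Rightarrow> real) \<Rightarrow> real) \<Rightarrow> (nat \<Rightarrow> real) \<Rightarrow> nat \<Rightarrow> real" where
  "weak_gradient n \<Omega> u = (SOME g. has_weak_gradient n \<Omega> u g)"

definition W1p :: "nat \<Rightarrow> real \<Rightarrow> (nat \<Rightarrow> real) set \<Rightarrow> ((nat \<Rightarrow> real) \<Rightarrow> real) set" where
  "W1p n p \<Omega> =
    {u \<in> Lp n p \<Omega>. \<exists>g. has_weak_gradient n \<Omega> u g \<and> (\<forall>i<n. (\<lambda>x. g x i) \<in> Lp n p \<Omega>)}"

definition W1p_loc :: "nat \<Rightarrow> real \<Rightarrow> (nat \<Rightarrow> real) set \<Rightarrow> ((nat \<Rightarrow> real) \<Rightarrow> real) set" where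
  "W1p_loc n p \<Omega> =
    {u \<in> Lp_loc n p \<Omega>. \<exists>g. has_weak_gradient n \<Omega> u g \<and> (\<forall>i<n. (\<lambda>x. g x i) \<in> Lp_loc n p \<Omega>)}"

text \<open>
  The integral of \<open>\<bar>\<nabla>u\<bar>\<^sup>p\<close> over \<open>A \<subseteq> \<Omega>\<close>, possibly infinite: \<open>u\<close> will only be locally in the Sobolev
  space.
\<close>

definition p_energy ::
  "nat \<Rightarrow> real \<Rightarrow> (nat \<Rightarrow> real) set \<Rightarrow> ((nat \<Rightarrow> real) \<Rightarrow> real) \<Rightarrow> (nat \<Rightarrow> real) set \<Rightarrow> ennreal" where
  "p_energy n p \<Omega> u A =
    (\<integral>\<^sup>+x\<in>A. ennreal (L2_set (weak_gradient n \<Omega> u x) {..<n} powr p) \<partial>lebesgue_Rn n)"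

text \<open>
  Closure of the test functions in the Sobolev norm; convergence is expressed with the \<open>p\<close>-th power
  of the norm.
\<close>

definition W1p_0 :: "nat \<Rightarrow> real \<Rightarrow> (nat \<Rightarrow> real) set \<Rightarrow> ((nat \<Rightarrow> real) \<Rightarrow> real) set" where
  "W1p_0 n p \<Omega> =
    {u \<in> W1p n p \<Omega>. \<exists>\<phi>. (\<forall>k::nat. \<phi> k \<in> test_functions n \<Omega>) \<and>
      (\<lambda>k. (\<integral>\<^sup>+x\<in>\<Omega>. ennreal (\<bar>\<phi> k x - u x\<bar> powr p) \<partial>lebesgue_Rn n) +
            p_energy n p \<Omega> (\<lambda>x. \<phi> k x - u x) \<Omega>) \<longlonglongrightarrow> 0}"

definition Q_quasiminimizer ::
  "nat \<Rightarrow> real \<Rightarrow> real \<Rightarrow> (nat \<Rightarrow> real) set \<Rightarrow> ((nat \<Rightarrow> real) \<Rightarrow> real) \<Rightarrow> bool" where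
  "Q_quasiminimizer n p Q \<Omega> u \<longleftrightarrow>
    u \<in> W1p_loc n p \<Omega> \<and>
    (\<forall>\<phi>\<in>W1p_0 n p \<Omega>.
      p_energy n p \<Omega> u {x \<in> \<Omega>. \<phi> x \<noteq> 0} \<le>
      ennreal Q * p_energy n p \<Omega> (\<lambda>x. u x + \<phi> x) {x \<in> \<Omega>. \<phi> x \<noteq> 0})"

definition Q_quasisuperminimizer ::
  "nat \<Rightarrow> real \<Rightarrow> real \<Rightarrow> (nat \<Rightarrow> real) set \<Rightarrow> ((nat \<Rightarrow> real) \<Rightarrow> real) \<Rightarrow> bool" where
  "Q_quasisuperminimizer n p Q \<Omega> u \<longleftrightarrow>
    u \<in> W1p_loc n p \<Omega> \<and>
    (\<forall>\<phi>\<in>W1p_0 n p \<Omega>. (AE x in lebesgue_Rn n. x \<in> \<Omega> \<longrightarrow> 0 \<le> \<phi> x) \<longrightarrow>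
      p_energy n p \<Omega> u {x \<in> \<Omega>. \<phi> x \<noteq> 0} \<le>
      ennreal Q * p_energy n p \<Omega> (\<lambda>x. u x + \<phi> x) {x \<in> \<Omega>. \<phi> x \<noteq> 0})"

definition quasisuperminimizer ::
  "nat \<Rightarrow> real \<Rightarrow> (nat \<Rightarrow> real) set \<Rightarrow> ((nat \<Rightarrow> real) \<Rightarrow> real) \<Rightarrow> bool" where
  "quasisuperminimizer n p \<Omega> u \<longleftrightarrow> (\<exists>Q\<ge>1. Q_quasisuperminimizer n p Q \<Omega> u)"

definition optimal_quasisuperminimizer_constant ::
  "nat \<Rightarrow> real \<Rightarrow> (nat \<Rightarrow> real) set \<Rightarrow> ((nat \<Rightarrow> real) \<Rightarrow> real) \<Rightarrow> real \<Rightarrow> bool" where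
  "optimal_quasisuperminimizer_constant n p \<Omega> u Q \<longleftrightarrow>
    1 \<le> Q \<and> Q_quasisuperminimizer n p Q \<Omega> u \<and>
    (\<forall>Q'\<ge>1. Q_quasisuperminimizer n p Q' \<Omega> u \<longrightarrow> Q \<le> Q')"

end

theory Submission imports Defs "HOL-Computational_Algebra.Polynomial"
begin

text \<open>
  The example lives in dimension one, where it consists of piecewise linear functions. The larger
  domain is the unit interval and the smaller one is the unit interval without a point \<open>m\<close>.

  A function in \<open>W1p_0\<close> has a continuous representative \<open>\<phi>\<close> with zero boundary values
  (\<open>W1p_0_primitive\<close>). So the set where it is nonzero is a countable union of intervals, at whose end
  points \<open>u\<close> and \<open>u + \<phi>\<close> agree, and energies need to be compared on one interval at a time
  (\<open>p_energy_le_from_intervals\<close>). On an interval the chord has the least energy by Jensen's inequality,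
  hence a function is a \<open>Q\<close>-quasiminimizer once its energy on each interval is at most \<open>Q\<close> times that of
  its chord there. For a convex function with two slopes this is an inequality in the ratio of the
  slopes and the position of the kink. The ratio can be chosen such that \<open>Q\<close> is the best constant and is
  attained on the whole interval if the kink has the right position (\<open>kink_parameters\<close>).

  The function \<open>u\<^sub>2\<close> is such a kinked function for the constant \<open>Q\<^sub>2\<close>, with its kink at \<open>m\<close>. The function
  \<open>u\<^sub>1\<close> arises from it by replacing each of the two linear pieces by a kinked function for the constant
  \<open>Q\<^sub>1\<close> with the same end values. It is a \<open>Q\<^sub>1\<close>-quasiminimizer away from \<open>m\<close>, and by convexity of the
  pieces \<open>u\<^sub>1 \<le> u\<^sub>2\<close>, so the glued function \<open>u\<close> is just \<open>u\<^sub>1\<close>. Each replacement multiplies the energy by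
  \<open>Q\<^sub>1\<close>, whence \<open>u\<close> has \<open>Q\<^sub>1 * Q\<^sub>2\<close> times the energy of its chord over the unit interval. The chord lies
  above \<open>u\<close> and so is an admissible competitor, which shows that no smaller constant is possible
  (\<open>optimal\<close>).

  That \<open>Q\<^sub>1 * Q\<^sub>2\<close> suffices is clear on intervals without \<open>m\<close>. On an interval around \<open>m\<close>, a factor \<open>Q\<^sub>1\<close>
  pays for passing from \<open>u\<close> to its chords on either side of \<open>m\<close>. If these form a concave corner, they
  minimize the energy among the functions above them, and this is where \<open>\<phi> \<ge> 0\<close> enters. If they form
  a convex corner, it is no sharper than that of \<open>u\<^sub>2\<close>, and a factor \<open>Q\<^sub>2\<close> pays for passing to the
  chord over the whole interval (\<open>energy_bound_across_m\<close>).

  Since the weak gradient in the energy is an arbitrary choice, computing energies requires the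
  uniqueness of weak gradients (\<open>weak_gradient_unique\<close>), hence a supply of smooth functions with compact
  support. These are built from \<open>exp (- 1 / x)\<close> and also serve as competitors in the lower bound.
\<close>

section \<open>Convexity inequalities for kinks\<close>

text \<open>
  A function with slope \<open>\<tau>\<close> on the first part of an interval and slope \<open>1\<close> on the last part, the
  latter of relative length \<open>b\<close>, has \<open>p\<close>-energy \<open>(\<tau> powr p * (1 - b) + b) / (\<tau> * (1 - b) + b) powr p\<close> times
  that of its chord. Here \<open>\<tau>\<close> is taken such that the largest of these ratios over all \<open>b\<close> is exactly
  \<open>Q\<close>, and \<open>\<beta>\<close> is a place where it is attained. The bound for flatter kinks, with \<open>\<tau> \<le> \<sigma> \<le> 1\<close>, comes
  for free since \<open>\<tau>\<close> is chosen as the largest slope for which the ratio reaches \<open>Q\<close>; it is needed for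
  the part of the energy estimate in which the kink is replaced by a milder one.
\<close>

lemma kink_parameters:
  fixes p Q :: real
  assumes p: "1 < p" and Q: "1 \<le> Q"
  obtains \<tau> \<beta> where "0 < \<tau>" "\<tau> \<le> 1" "0 < \<beta>" "\<beta> < 1"
    "\<tau> powr p * (1 - \<beta>) + \<beta> = Q * (\<tau> * (1 - \<beta>) + \<beta>) powr p"
    "\<And>\<sigma> b. \<lbrakk>\<tau> \<le> \<sigma>; \<sigma> \<le> 1; 0 \<le> b; b \<le> 1\<rbrakk>
      \<Longrightarrow> \<sigma> powr p * (1 - b) + b \<le> Q * (\<sigma> * (1 - b) + b) powr p"
proof (cases "Q = 1")
  case True
  show ?thesis
    by (rule that[of 1 "1/2"]) (use True in auto)
next
  case False
  with Q have Q1: "1 < Q" by simp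
  define G where "G = (\<lambda>z::real\<times>real. Q * (fst z * (1 - snd z) + snd z) powr p
    - (fst z powr p * (1 - snd z) + snd z))"
  define D where "D = ({0..1} \<times> {0..1} :: (real\<times>real) set)"
  have contG: "continuous_on D G"
    unfolding G_def D_def using p
    by (intro continuous_intros continuous_on_powr')
      (auto simp: add_nonneg_eq_0_iff intro!: add_nonneg_nonneg mult_nonneg_nonneg)
  \<comment> \<open>The slopes and proportions whose energy ratio is at least \<open>Q\<close>; the largest slope among them is
    the one to take.\<close>
  define S where "S = D \<inter> G -` {..0}"
  have "compact D" unfolding D_def by (intro compact_Times) auto
  moreover have "closed S" unfolding S_def
    by (rule continuous_closed_preimage[OF contG]) (auto simp: \<open>compact D\<close> compact_imp_closed)
  ultimately have compS: "compact S"
    by (metis S_def compact_Int_closed inf.orderE inf_le1 inf_commute)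
  \<comment> \<open>A point of \<open>S\<close> with positive slope, so that the maximal slope is positive: \<open>b0\<close> solves
    \<open>Q * (2 * b0) powr p = b0\<close>, and the mean slope at \<open>(b0, b0)\<close> is at most \<open>2 * b0\<close>.\<close>
  define b0 where "b0 = (1 / (Q * 2 powr p)) powr (1 / (p - 1))"
  have b0: "0 < b0" "b0 \<le> 1"
  proof -
    show "0 < b0" using Q1 by (simp add: b0_def)
    have "1 \<le> (2::real) powr p" using p by (simp add: ge_one_powr_ge_zero)
    then have "1 \<le> Q * 2 powr p" using Q1 by (smt (verit, best) mult_le_cancel_left1)
    then have "1 / (Q * 2 powr p) \<le> 1" by simp
    then show "b0 \<le> 1" unfolding b0_def using p Q1 by (intro powr_le1) auto
  qed
  have b0S: "(b0, b0) \<in> S"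
  proof -
    have "b0 powr (p - 1) = 1 / (Q * 2 powr p)"
      unfolding b0_def using p Q1 by (simp add: powr_powr)
    moreover have "b0 powr p = b0 * b0 powr (p - 1)"
      using b0 by (simp add: powr_diff)
    ultimately have *: "Q * (2 * b0) powr p = b0"
      using b0 Q1 by (simp add: powr_mult)
    have "b0 * b0 \<le> b0 * 1" using b0 by (intro mult_left_mono) auto
    then have "(b0 * (1 - b0) + b0) powr p \<le> (2 * b0) powr p"
      using p b0 by (intro powr_mono2) (auto simp: algebra_simps)
    then have "Q * (b0 * (1 - b0) + b0) powr p \<le> b0"
      using * Q1 by (smt (verit) mult_left_mono)
    moreover have "0 \<le> b0 powr p * (1 - b0)" using b0 by simp
    ultimately have "G (b0, b0) \<le> 0" unfolding G_def fst_conv snd_conv by linarith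
    then show ?thesis using b0 by (simp add: S_def D_def)
  qed
  have "continuous_on S fst" by (intro continuous_intros)
  then obtain z where z: "z \<in> S" "\<And>y. y \<in> S \<Longrightarrow> fst y \<le> fst z"
    using continuous_attains_sup[OF compS _ \<open>continuous_on S fst\<close>] b0S by blast
  obtain \<tau> \<beta> where zeq: "z = (\<tau>, \<beta>)" by fastforce
  have \<tau>: "0 < \<tau>" "\<tau> \<le> 1" "0 \<le> \<beta>" "\<beta> \<le> 1" "G (\<tau>, \<beta>) \<le> 0"
    using z(1) z(2)[OF b0S] b0 zeq by (auto simp: S_def D_def)
  have above: "0 < G (\<sigma>, b)" if "\<tau> < \<sigma>" "\<sigma> \<le> 1" "0 \<le> b" "b \<le> 1" for \<sigma> b
    using z(2)[of "(\<sigma>, b)"] that \<tau> zeq by (force simp: S_def D_def)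
  have "\<tau> \<noteq> 1"
    using \<tau>(5) Q1 by (auto simp: G_def)
  with \<tau> have \<tau>1: "\<tau> < 1" by simp
  have at: "0 \<le> G (\<tau>, b)" if b: "0 \<le> b" "b \<le> 1" for b
  proof -
    have "isCont (\<lambda>\<sigma>. G (\<sigma>, b)) \<tau>"
      unfolding G_def using \<tau> p b
      by (intro continuous_intros) (auto simp: add_nonneg_eq_0_iff intro!: add_nonneg_nonneg)
    then have "((\<lambda>\<sigma>. G (\<sigma>, b)) \<longlongrightarrow> G (\<tau>, b)) (at_right \<tau>)"
      by (simp add: isCont_def filterlim_at_split)
    moreover have "\<forall>\<^sub>F \<sigma> in at_right \<tau>. 0 \<le> G (\<sigma>, b)"
      using eventually_at_right_less[of \<tau>] eventually_at_right_real[OF \<tau>1]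
      by eventually_elim (use above b in \<open>auto intro: less_imp_le\<close>)
    ultimately show ?thesis
      by (intro tendsto_lowerbound) auto
  qed
  have "G (\<tau>, \<beta>) = 0" using at[of \<beta>] \<tau> by simp
  moreover have "\<beta> \<noteq> 0"
  proof
    assume "\<beta> = 0"
    with \<open>G (\<tau>, \<beta>) = 0\<close> have "(Q - 1) * \<tau> powr p = 0" by (simp add: G_def algebra_simps)
    then show False using Q1 \<tau> by simp
  qed
  moreover have "\<beta> \<noteq> 1"
    using \<open>G (\<tau>, \<beta>) = 0\<close> Q1 by (auto simp: G_def)
  ultimately show ?thesis
    using \<tau> at above by (intro that[of \<tau> \<beta>]) (force simp: G_def le_less)+
qed

text \<open>
  The normalized inequality in the proportion \<open>b\<close> rescaled to pieces of lengths \<open>\<alpha>\<close> and \<open>\<gamma>\<close> with slopes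
  \<open>k * \<sigma>\<close> and \<open>k\<close>.
\<close>

lemma kink_inequality:
  fixes p Q :: real
  assumes hyp: "\<And>b. \<lbrakk>0 \<le> b; b \<le> 1\<rbrakk> \<Longrightarrow> \<sigma> powr p * (1 - b) + b \<le> Q * (\<sigma> * (1 - b) + b) powr p"
    and "0 \<le> \<alpha>" "0 \<le> \<gamma>" "0 < \<alpha> + \<gamma>" "0 \<le> k" "0 \<le> \<sigma>"
  shows "k powr p * (\<sigma> powr p * \<alpha> + \<gamma>) \<le> Q * ((\<alpha> + \<gamma>) * (k * (\<sigma> * \<alpha> + \<gamma>) / (\<alpha> + \<gamma>)) powr p)"
proof -
  define b where "b = \<gamma> / (\<alpha> + \<gamma>)"
  have b: "0 \<le> b" "b \<le> 1" "1 - b = \<alpha> / (\<alpha> + \<gamma>)"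
    using assms by (auto simp: b_def field_simps)
  have e1: "\<sigma> powr p * \<alpha> + \<gamma> = (\<alpha> + \<gamma>) * (\<sigma> powr p * (1 - b) + b)"
    unfolding b(3) using assms(4) by (simp add: b_def distrib_left)
  have e2: "k * (\<sigma> * \<alpha> + \<gamma>) / (\<alpha> + \<gamma>) = k * (\<sigma> * (1 - b) + b)"
    unfolding b(3) using assms(4) by (simp add: b_def add_divide_distrib distrib_left)
  have "(k * (\<sigma> * (1 - b) + b)) powr p = k powr p * (\<sigma> * (1 - b) + b) powr p"
    using assms b by (intro powr_mult)
  then show ?thesis
    unfolding e1 e2 using mult_left_mono[OF hyp[OF b(1,2)], of "k powr p * (\<alpha> + \<gamma>)"] assms
    by (simp add: mult_ac)
qed

lemma powr_above_tangent:
  fixes p c t :: real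
  assumes p: "1 < p" and c: "0 \<le> c"
  shows "c powr p + p * c powr (p - 1) * (t - c) \<le> \<bar>t\<bar> powr p"
proof (cases "c = 0")
  case True then show ?thesis by simp
next
  case False
  with c have c: "0 < c" by simp
  show ?thesis
  proof (cases "0 < t")
    case True
    have "convex_on {0<..} (\<lambda>x. x powr p)"
    proof (rule f''_ge0_imp_convex)
      show "((\<lambda>x. x powr p) has_real_derivative p * x powr (p - 1)) (at x)" if "x \<in> {0<..}" for x
        using that by (auto intro!: derivative_eq_intros)
      show "((\<lambda>x. p * x powr (p - 1)) has_real_derivative p * ((p - 1) * x powr (p - 2))) (at x)"
        if "x \<in> {0<..}" for x
        using that by (auto intro!: derivative_eq_intros simp: algebra_simps)
    qed (use p in auto)
    then have "t powr p - c powr p \<ge> p * c powr (p - 1) * (t - c)"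
      by (rule convex_on_imp_above_tangent)
        (use c True in \<open>auto intro!: derivative_eq_intros simp: interior_open\<close>)
    then show ?thesis using True by simp
  next
    case False
    have "p * c powr (p - 1) * (t - c) \<le> p * c powr (p - 1) * (- c)"
      using False p by (intro mult_left_mono) auto
    also have "\<dots> = - (p * c powr p)" using c by (simp add: powr_diff)
    also have "\<dots> \<le> - (c powr p)" using p by (simp add: mult_le_cancel_right1)
    finally have "c powr p + p * c powr (p - 1) * (t - c) \<le> 0" by simp
    then show ?thesis by (smt (verit) powr_ge_zero)
  qed
qed

text \<open>The \<open>p\<close>-energy of a function with derivative \<open>g\<close>.\<close>

abbreviation energy_on :: "real \<Rightarrow> real set \<Rightarrow> (real \<Rightarrow> real) \<Rightarrow> ennreal" where
  "energy_on p S g \<equiv> (\<integral>\<^sup>+t\<in>S. ennreal (\<bar>g t\<bar> powr p) \<partial>lebesgue)"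

text \<open>
  Linear functions minimize the \<open>p\<close>-energy for given boundary values. The tangent to \<open>\<lambda>t. \<bar>t\<bar> powr p\<close> at
  the modulus of the mean is integrated.
\<close>

lemma Jensen_powr_Ioo:
  fixes w :: "real \<Rightarrow> real"
  assumes p: "1 < p" and lr: "l < r" and w: "set_integrable lebesgue {l<..<r} w"
  shows "ennreal ((r - l) * \<bar>(LINT t:{l<..<r}|lebesgue. w t) / (r - l)\<bar> powr p)
    \<le> energy_on p {l<..<r} w"
proof (cases "energy_on p {l<..<r} w = \<infinity>")
  case True then show ?thesis by simp
next
  case False
  define W where "W = (\<lambda>t. indicator {l<..<r} t * w t)"
  have W: "integrable lebesgue W"
    using w by (simp add: W_def set_integrable_def)
  then have [measurable]: "W \<in> borel_measurable lebesgue" by simp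
  have eq: "energy_on p {l<..<r} w = (\<integral>\<^sup>+t. ennreal (\<bar>W t\<bar> powr p) \<partial>lebesgue)"
    by (intro nn_integral_cong) (auto simp: W_def indicator_def)
  have Wp: "integrable lebesgue (\<lambda>t. \<bar>W t\<bar> powr p)"
    using False eq by (intro integrableI_nonneg) (auto simp: less_top[symmetric])
  define c where "c = \<bar>LINT t|lebesgue. W t\<bar> / (r - l)"
  have c: "0 \<le> c" using lr by (simp add: c_def)
  have ind: "integrable lebesgue (indicator {l<..<r} :: real \<Rightarrow> real)"
    using lr by (simp add: integrable_indicator_iff)
  have "c * (r - l) \<le> (LINT t|lebesgue. \<bar>W t\<bar>)"
    using lr by (simp add: c_def)
  then have "(c powr p - p * c powr (p - 1) * c) * (r - l) + p * c powr (p - 1) * (c * (r - l))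
    \<le> (c powr p - p * c powr (p - 1) * c) * (r - l) + p * c powr (p - 1) * (LINT t|lebesgue. \<bar>W t\<bar>)"
    using p c by (intro add_left_mono mult_left_mono) auto
  also have "\<dots> = (LINT t|lebesgue. (c powr p - p * c powr (p - 1) * c) * indicator {l<..<r} t
      + p * c powr (p - 1) * \<bar>W t\<bar>)"
    using W ind lr by (subst Bochner_Integration.integral_add) auto
  also have "\<dots> \<le> (LINT t|lebesgue. \<bar>W t\<bar> powr p)"
  proof (rule integral_mono)
    fix t
    show "(c powr p - p * c powr (p - 1) * c) * indicator {l<..<r} t + p * c powr (p - 1) * \<bar>W t\<bar>
      \<le> \<bar>W t\<bar> powr p"
      using powr_above_tangent[OF p c, of "\<bar>W t\<bar>"]
      by (auto simp: algebra_simps W_def split: split_indicator)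
  qed (use W ind Wp in auto)
  finally have "c powr p * (r - l) \<le> (LINT t|lebesgue. \<bar>W t\<bar> powr p)"
    by (simp add: algebra_simps)
  then have "ennreal (c powr p * (r - l)) \<le> ennreal (LINT t|lebesgue. \<bar>W t\<bar> powr p)"
    by (rule ennreal_leI)
  also have "\<dots> = (\<integral>\<^sup>+t. ennreal (\<bar>W t\<bar> powr p) \<partial>lebesgue)"
    using Wp by (subst nn_integral_eq_integral) auto
  finally show ?thesis
    unfolding eq using lr by (simp add: c_def W_def set_lebesgue_integral_def mult.commute)
qed

text \<open>
  A broken line with slopes \<open>A \<ge> B\<close> is concave, hence a minimizer among functions above it. So lifting
  its corner by \<open>s \<ge> 0\<close> cannot decrease its energy: to first order the energy changes by
  \<open>p * s * (A powr (p - 1) - B powr (p - 1))\<close>, and convexity does the rest.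
\<close>

lemma concave_corner_powr:
  fixes A B s :: real
  assumes p: "1 < p" and "0 \<le> B" "B \<le> A" "0 \<le> s" "0 < x" "0 < y"
  shows "x * A powr p + y * B powr p \<le> x * \<bar>A + s / x\<bar> powr p + y * \<bar>B - s / y\<bar> powr p"
proof -
  have "x * (A powr p + p * A powr (p - 1) * (s / x)) \<le> x * \<bar>A + s / x\<bar> powr p"
    using powr_above_tangent[OF p, of A "A + s / x"] assms by (intro mult_left_mono) auto
  then have 1: "x * A powr p + p * A powr (p - 1) * s \<le> x * \<bar>A + s / x\<bar> powr p"
    using assms by (simp add: distrib_left)
  have "y * (B powr p + p * B powr (p - 1) * (- (s / y))) \<le> y * \<bar>B - s / y\<bar> powr p"
    using powr_above_tangent[OF p, of B "B - s / y"] assms by (intro mult_left_mono) auto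
  then have 2: "y * B powr p - p * B powr (p - 1) * s \<le> y * \<bar>B - s / y\<bar> powr p"
    using assms by (simp add: right_diff_distrib)
  have "B powr (p - 1) \<le> A powr (p - 1)"
    using assms by (intro powr_mono2) auto
  then have "p * B powr (p - 1) * s \<le> p * A powr (p - 1) * s"
    using assms by (intro mult_right_mono mult_left_mono) auto
  then show ?thesis using 1 2 by linarith
qed

section \<open>The line as coordinate space of dimension one\<close>

text \<open>The dimension \<open>1\<close> has to stay recognizable for the rules below.\<close>

declare One_nat_def [simp del]



definition pt :: "real \<Rightarrow> nat \<Rightarrow> real" where
  "pt t = (\<lambda>i\<in>{..<1}. t)"

lemma pt_0 [simp]: "pt t 0 = t"
  by (simp add: pt_def)

lemma pt_upd [simp]: "(pt t)(0 := s) = pt s"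
  by (auto simp: pt_def fun_eq_iff)

lemma inj_pt: "inj pt"
  by (metis injI pt_0)

lemma pt_mem_image_iff [simp]: "pt t \<in> pt ` S \<longleftrightarrow> t \<in> S"
  by (meson inj_image_mem_iff inj_pt)

lemma topspace_R1: "topspace (Rn 1) = range pt"
proof -
  have "x \<in> range pt" if "x \<in> {..<1::nat} \<rightarrow>\<^sub>E (UNIV :: real set)" for x
  proof -
    have "x = pt (x 0)"
    proof
      fix i show "x i = pt (x 0) i"
        using PiE_arb[OF that, of i] by (cases "i = 0") (simp_all add: pt_def)
    qed
    then show ?thesis by blast
  qed
  moreover have "pt t \<in> {..<1::nat} \<rightarrow>\<^sub>E (UNIV :: real set)" for t
    unfolding pt_def by (rule restrict_PiE_iff[THEN iffD2]) simp
  ultimately have "({..<1::nat} \<rightarrow>\<^sub>E (UNIV :: real set)) = range pt"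
    by (intro equalityI subsetI) auto
  then show ?thesis
    unfolding topspace_product_topology topspace_euclidean .
qed

lemma continuous_map_pt: "continuous_map euclideanreal (Rn 1) pt"
  unfolding continuous_map_componentwise
  by (auto simp: pt_def fun_eq_iff extensional_def)

lemma continuous_map_coord: "continuous_map (Rn 1) euclideanreal (\<lambda>x. x 0)"
  by (rule continuous_map_product_projection) auto

lemma openin_pt_image: "open S \<Longrightarrow> openin (Rn 1) (pt ` S)"
proof -
  assume "open S"
  then have "openin (Rn 1) {x \<in> topspace (Rn 1). x 0 \<in> S}"
    using openin_continuous_map_preimage[OF continuous_map_coord] by simp
  moreover have "{x \<in> topspace (Rn 1). x 0 \<in> S} = pt ` S"
    unfolding topspace_R1 by auto
  ultimately show ?thesis by simp
qed

lemma compactin_pt_image: "compact S \<Longrightarrow> compactin (Rn 1) (pt ` S)"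
  using image_compactin[OF _ continuous_map_pt] by simp

lemma compactin_R1E:
  assumes "compactin (Rn 1) K"
  obtains S where "compact S" "K = pt ` S"
proof
  have "compactin euclideanreal ((\<lambda>x. x 0) ` K)"
    using image_compactin[OF assms continuous_map_coord] .
  then show "compact ((\<lambda>x. x 0) ` K)" by simp
  have "K \<subseteq> range pt" using compactin_subset_topspace[OF assms] topspace_R1 by simp
  then show "K = pt ` (\<lambda>x. x 0) ` K" by (force simp: image_iff)
qed

abbreviation leb1 :: "(nat \<Rightarrow> real) measure" where "leb1 \<equiv> lebesgue_Rn 1"

abbreviation PM :: "(nat \<Rightarrow> real) measure" where
  "PM \<equiv> \<Pi>\<^sub>M i\<in>{..<1}. lborel"

lemma distr_coord_PiM: "distr PM lborel (\<lambda>x. x 0) = lborel"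
proof -
  interpret product_sigma_finite "\<lambda>_::nat. lborel :: real measure" ..
  show ?thesis using distr_singleton[of 0] by (simp add: One_nat_def lessThan_Suc)
qed

lemma coord_measurable_PiM [measurable]: "(\<lambda>x. x 0) \<in> PM \<rightarrow>\<^sub>M (lborel :: real measure)"
  by (rule measurable_component_singleton) auto

lemma pt_measurable_PiM [measurable]: "pt \<in> lborel \<rightarrow>\<^sub>M PM"
  unfolding pt_def by (rule measurable_restrict) auto

lemma space_PiM_pt: "space PM = range pt"
  using topspace_R1 unfolding space_PiM topspace_product_topology by simp

lemma pt_coord: "x \<in> space PM \<Longrightarrow> pt (x 0) = x"
  unfolding space_PiM_pt by auto

lemma distr_pt_PiM: "distr lborel PM pt = PM"
proof -
  have "distr lborel PM pt
    = distr (distr PM lborel (\<lambda>x. x 0)) PM pt"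
    by (simp only: distr_coord_PiM)
  also have "\<dots> = distr PM PM (\<lambda>x. pt (x 0))"
    by (subst distr_distr[OF pt_measurable_PiM coord_measurable_PiM]) (simp add: comp_def)
  also have "\<dots> = distr PM PM (\<lambda>x. x)"
    by (intro distr_cong refl pt_coord)
  finally show ?thesis by simp
qed

text \<open>
  Measurability for the completed measures needs that null sets pull back to null sets, which
  measure preservation gives.
\<close>

lemma measurable_completion_completion:
  assumes f: "f \<in> M \<rightarrow>\<^sub>M N" and d: "distr M N f = N"
  shows "f \<in> completion M \<rightarrow>\<^sub>M completion N"
proof (rule measurableI)
  show "f x \<in> space (completion N)" if "x \<in> space (completion M)" for x
    using measurable_space[OF f] that by simp
  fix A assume "A \<in> sets (completion N)"
  then obtain S N1 N2 where A: "A = S \<union> N1" "N1 \<subseteq> N2" "N2 \<in> null_sets N" "S \<in> sets N"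
    by (rule sets_completionE)
  have "f -` N2 \<inter> space M \<in> null_sets M"
    using A(3) d null_sets_distr_iff[OF f, of N2] by simp
  moreover have "f -` S \<inter> space M \<in> sets M"
    using measurable_sets[OF f A(4)] .
  ultimately show "f -` A \<inter> space (completion M) \<in> sets (completion M)"
    using A(1,2)
    by (intro sets_completionI[of _ "f -` S \<inter> space M" "f -` N1 \<inter> space M"]) auto
qed

lemma pt_measurable [measurable]: "pt \<in> lebesgue \<rightarrow>\<^sub>M leb1"
  unfolding lebesgue_Rn_def by (rule measurable_completion_completion[OF pt_measurable_PiM distr_pt_PiM])

lemma coord_measurable [measurable]: "(\<lambda>x. x 0) \<in> leb1 \<rightarrow>\<^sub>M (lebesgue :: real measure)"
  unfolding lebesgue_Rn_def by (rule measurable_completion_completion[OF coord_measurable_PiM distr_coord_PiM])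

lemma space_leb1: "space leb1 = range pt"
  unfolding lebesgue_Rn_def by (simp only: space_completion space_PiM_pt)

lemma AE_leb1_iff: "(AE x in leb1. P x) \<longleftrightarrow> (AE t in lebesgue. P (pt t))"
proof
  assume "AE x in leb1. P x"
  then have "AE x in distr lborel PM pt. P x"
    unfolding lebesgue_Rn_def AE_completion_iff distr_pt_PiM .
  then have "AE t in lborel. P (pt t)" by (rule AE_distrD[OF pt_measurable_PiM])
  then show "AE t in lebesgue. P (pt t)" by (simp add: AE_completion_iff)
next
  assume "AE t in lebesgue. P (pt t)"
  then have "AE t in distr PM lborel (\<lambda>x. x 0). P (pt t)"
    unfolding AE_completion_iff distr_coord_PiM .
  then have "AE x in PM. P (pt (x 0))"
    by (rule AE_distrD[OF coord_measurable_PiM])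
  then have "AE x in PM. P x"
    by (rule AE_mp) (auto simp: pt_coord)
  then show "AE x in leb1. P x" unfolding lebesgue_Rn_def AE_completion_iff .
qed

lemma borel_measurable_leb1_iff:
  "f \<in> borel_measurable leb1 \<longleftrightarrow> (\<lambda>t. f (pt t)) \<in> borel_measurable lebesgue"
proof
  assume "f \<in> borel_measurable leb1"
  then show "(\<lambda>t. f (pt t)) \<in> borel_measurable lebesgue"
    using measurable_compose[OF pt_measurable] by blast
next
  assume "(\<lambda>t. f (pt t)) \<in> borel_measurable lebesgue"
  from measurable_compose[OF coord_measurable this]
  have "(\<lambda>x. f (pt (x 0))) \<in> borel_measurable leb1" .
  then show "f \<in> borel_measurable leb1"
    by (rule measurable_cong[THEN iffD1, rotated]) (auto simp: space_leb1)
qed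

text \<open>
  The coordinate map identifies completed Lebesgue measure in dimension one with Lebesgue measure on
  the line. This is first known for the product measure; an indicator of a completed set is
  therefore replaced by an almost everywhere equal function that is measurable before completion.
\<close>

lemma distr_pt_leb1: "distr lebesgue leb1 pt = leb1"
proof (rule measure_eqI)
  fix A assume "A \<in> sets (distr lebesgue leb1 pt)"
  then have A: "A \<in> sets leb1" by simp
  have 1: "emeasure (distr lebesgue leb1 pt) A = (\<integral>\<^sup>+t. indicator A (pt t) \<partial>lebesgue)"
    using A nn_integral_distr[OF pt_measurable, of "indicator A"]
    by (subst nn_integral_indicator[symmetric]) simp_all
  obtain g where g: "g \<in> borel_measurable PM"
    "AE x in PM. indicator A x = (g x :: ennreal)"
    using completion_ex_borel_measurable[of "indicator A" "PM"] A
    unfolding lebesgue_Rn_def by auto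
  have "AE x in leb1. indicator A x = g x"
    using g(2) unfolding lebesgue_Rn_def AE_completion_iff .
  then have "AE t in lebesgue. indicator A (pt t) = g (pt t)"
    unfolding AE_leb1_iff .
  then have "(\<integral>\<^sup>+t. indicator A (pt t) \<partial>lebesgue) = (\<integral>\<^sup>+t. g (pt t) \<partial>lebesgue)"
    by (rule nn_integral_cong_AE)
  also have "\<dots> = integral\<^sup>N (distr lborel PM pt) g"
    using g(1) by (subst nn_integral_distr[OF pt_measurable_PiM]) (simp_all add: nn_integral_completion)
  also have "\<dots> = (\<integral>\<^sup>+x. indicator A x \<partial>leb1)"
    unfolding lebesgue_Rn_def nn_integral_completion distr_pt_PiM
    using g(2) by (intro nn_integral_cong_AE) auto
  finally show "emeasure (distr lebesgue leb1 pt) A = emeasure leb1 A"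
    using 1 A by simp
qed simp

lemma nn_integral_leb1:
  assumes "(\<lambda>t. f (pt t)) \<in> borel_measurable lebesgue"
  shows "integral\<^sup>N leb1 f = (\<integral>\<^sup>+t. f (pt t) \<partial>lebesgue)"
  using assms borel_measurable_leb1_iff[of f] nn_integral_distr[OF pt_measurable, of f] distr_pt_leb1
  by simp

lemma integral_leb1:
  fixes f :: "(nat \<Rightarrow> real) \<Rightarrow> real"
  shows "integral\<^sup>L leb1 f = (LINT t|lebesgue. f (pt t))"
proof (cases "f \<in> borel_measurable leb1")
  case True
  then show ?thesis using integral_distr[OF pt_measurable, of f] distr_pt_leb1 by simp
next
  case False
  then have "\<not> integrable leb1 f" "\<not> integrable lebesgue (\<lambda>t. f (pt t))"
    using borel_measurable_leb1_iff[of f] by (auto dest: borel_measurable_integrable)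
  then show ?thesis by (simp add: not_integrable_integral_eq)
qed

lemma set_integral_leb1:
  fixes f :: "(nat \<Rightarrow> real) \<Rightarrow> real"
  shows "(LINT x:pt ` I|leb1. f x) = (LINT t:I|lebesgue. f (pt t))"
  unfolding set_lebesgue_integral_def integral_leb1 by (simp add: indicator_def)

section \<open>Smooth functions on the line\<close>

text \<open>
  \<open>times_diff k f\<close> is \<open>k\<close>-fold differentiability on the whole line. The recursion on the derivative makes
  closure under sums, products and exponentials a plain induction on \<open>k\<close>.
\<close>

fun times_diff :: "nat \<Rightarrow> (real \<Rightarrow> real) \<Rightarrow> bool" where
  "times_diff 0 f = True"
| "times_diff (Suc k) f = (\<exists>f'. (\<forall>x. (f has_real_derivative f' x) (at x)) \<and> times_diff k f')"

lemma times_diff_SucI: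
  "(\<And>x. (f has_real_derivative f' x) (at x)) \<Longrightarrow> times_diff k f' \<Longrightarrow> times_diff (Suc k) f"
  by auto

lemma times_diff_Suc_D: "times_diff (Suc k) f \<Longrightarrow> times_diff k f"
  by (induction k arbitrary: f) auto

lemma times_diff_const: "times_diff k (\<lambda>x. c)"
proof (induction k arbitrary: c)
  case (Suc k)
  show ?case
    by (rule times_diff_SucI[OF _ Suc[of 0]]) simp
qed simp

lemma times_diff_add: "times_diff k f \<Longrightarrow> times_diff k g \<Longrightarrow> times_diff k (\<lambda>x. f x + g x)"
proof (induction k arbitrary: f g)
  case (Suc k)
  then obtain f' g' where "\<And>x. (f has_real_derivative f' x) (at x)" "times_diff k f'"
    "\<And>x. (g has_real_derivative g' x) (at x)" "times_diff k g'" by auto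
  with Suc.IH show ?case
    by (intro times_diff_SucI[where f' = "\<lambda>x. f' x + g' x"]) (auto intro: DERIV_add)
qed simp

lemma times_diff_mult: "times_diff k f \<Longrightarrow> times_diff k g \<Longrightarrow> times_diff k (\<lambda>x. f x * g x)"
proof (induction k arbitrary: f g)
  case (Suc k)
  then obtain f' g' where *: "\<And>x. (f has_real_derivative f' x) (at x)" "times_diff k f'"
    "\<And>x. (g has_real_derivative g' x) (at x)" "times_diff k g'" by auto
  show ?case
  proof (rule times_diff_SucI[where f' = "\<lambda>x. f' x * g x + g' x * f x"])
    show "times_diff k (\<lambda>x. f' x * g x + g' x * f x)"
      using * Suc.prems[THEN times_diff_Suc_D] Suc.IH by (intro times_diff_add) blast+
  qed (use * in \<open>auto intro!: derivative_eq_intros\<close>)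
qed simp

lemma times_diff_exp: "times_diff k f \<Longrightarrow> times_diff k (\<lambda>x. exp (f x))"
proof (induction k arbitrary: f)
  case (Suc k)
  then obtain f' where *: "\<And>x. (f has_real_derivative f' x) (at x)" "times_diff k f'" by auto
  show ?case
  proof (rule times_diff_SucI[where f' = "\<lambda>x. exp (f x) * f' x"])
    show "times_diff k (\<lambda>x. exp (f x) * f' x)"
      using * Suc.prems[THEN times_diff_Suc_D] Suc.IH by (intro times_diff_mult) blast+
  qed (use * in \<open>auto intro!: derivative_eq_intros\<close>)
qed simp

lemma times_diff_affine: "times_diff k f \<Longrightarrow> times_diff k (\<lambda>x. f (a * x + b))"
proof (induction k arbitrary: f)
  case (Suc k)
  then obtain f' where *: "\<And>x. (f has_real_derivative f' x) (at x)" "times_diff k f'" by auto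
  show ?case
  proof (rule times_diff_SucI[where f' = "\<lambda>x. a * f' (a * x + b)"])
    show "times_diff k (\<lambda>x. a * f' (a * x + b))"
      using * Suc.IH by (intro times_diff_mult times_diff_const) auto
    show "((\<lambda>x. f (a * x + b)) has_real_derivative a * f' (a * x + b)) (at x)" for x
    proof -
      have "((\<lambda>x. a * x + b) has_real_derivative a) (at x)"
        by (auto intro!: derivative_eq_intros)
      from DERIV_chain2[OF *(1) this] show ?thesis by (simp add: mult.commute)
    qed
  qed
qed simp

text \<open>
  The functions \<open>P (1 / x) * exp (- 1 / x)\<close> for \<open>x > 0\<close>, continued by zero. Polynomials \<open>P\<close> are allowed so
  that the family is closed under differentiation.
\<close>

definition flat_exp :: "real poly \<Rightarrow> real \<Rightarrow> real" where
  "flat_exp P x = (if 0 < x then poly P (inverse x) * exp (- inverse x) else 0)"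

lemma poly_exp_tendsto_0: "((\<lambda>y::real. poly P y * exp (- y)) \<longlongrightarrow> 0) at_top"
proof -
  have "((\<lambda>y::real. \<Sum>i\<le>degree P. coeff P i * (y ^ i / exp y)) \<longlongrightarrow> (\<Sum>i\<le>degree P. coeff P i * 0)) at_top"
    by (intro tendsto_intros tendsto_power_div_exp_0)
  then show ?thesis
    by (simp add: poly_altdef sum_distrib_right exp_minus divide_inverse mult.assoc)
qed

lemma flat_exp_DERIV:
  "(flat_exp P has_real_derivative flat_exp ([:0, 0, 1:] * (P - pderiv P)) x) (at x)"
proof -
  consider "x < 0" | "x = 0" | "0 < x" by linarith
  then show ?thesis
  proof cases
    case 1
    have "((\<lambda>_. 0) has_real_derivative 0) (at x)" by simp
    then have "(flat_exp P has_real_derivative 0) (at x)"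
      by (rule has_field_derivative_transform_within_open[where S = "{..<0}"])
        (use 1 in \<open>auto simp: flat_exp_def\<close>)
    then show ?thesis using 1 by (simp add: flat_exp_def)
  next
    case 3
    have "((\<lambda>x. poly P (inverse x) * exp (- inverse x)) has_real_derivative
       flat_exp ([:0, 0, 1:] * (P - pderiv P)) x) (at x)"
      using 3 by (auto intro!: derivative_eq_intros simp: flat_exp_def field_simps power2_eq_square)
    then show ?thesis
      by (rule has_field_derivative_transform_within_open[where S = "{0<..}"])
        (use 3 in \<open>auto simp: flat_exp_def\<close>)
  next
    case 2
    have "((\<lambda>h. flat_exp P h / h) \<longlongrightarrow> 0) (at_right 0)"
    proof (rule Lim_transform_eventually)
      show "((\<lambda>h. poly ([:0, 1:] * P) (inverse h) * exp (- inverse h)) \<longlongrightarrow> 0) (at_right (0::real))"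
        by (rule filterlim_compose[OF poly_exp_tendsto_0 filterlim_inverse_at_top_right])
      show "\<forall>\<^sub>F h in at_right 0. poly ([:0, 1:] * P) (inverse h) * exp (- inverse h) = flat_exp P h / h"
        by (auto simp: eventually_at_filter flat_exp_def divide_inverse)
    qed
    moreover have "((\<lambda>h. flat_exp P h / h) \<longlongrightarrow> 0) (at_left 0)"
      by (rule tendsto_eventually) (auto simp: eventually_at_filter flat_exp_def)
    ultimately have "((\<lambda>h. flat_exp P h / h) \<longlongrightarrow> 0) (at 0)"
      by (simp add: filterlim_at_split)
    then show ?thesis
      using 2 by (simp add: DERIV_def flat_exp_def)
  qed
qed

lemma times_diff_flat_exp: "times_diff k (flat_exp P)"
  by (induction k arbitrary: P) (auto intro!: flat_exp_DERIV)

text \<open>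
  Smooth functions with values in \<open>[0, 1]\<close> that converge to the indicator of the interval between \<open>x\<close> and
  \<open>y\<close>. The margin \<open>1 / Suc n\<close> keeps their supports inside the open interval, so that they are test
  functions there; the factor \<open>n\<close> in the exponent drives the values to \<open>1\<close>.
\<close>

definition plateau :: "real \<Rightarrow> real \<Rightarrow> nat \<Rightarrow> real \<Rightarrow> real" where
  "plateau x y n t =
    1 - exp (- (real n * (flat_exp 1 (t - (x + 1 / Suc n)) * flat_exp 1 ((y - 1 / Suc n) - t))))"

lemma flat_exp_1_nonneg: "0 \<le> flat_exp 1 t"
  and flat_exp_1_pos: "0 < t \<Longrightarrow> 0 < flat_exp 1 t"
  and flat_exp_1_zero: "t \<le> 0 \<Longrightarrow> flat_exp 1 t = 0"
  by (auto simp: flat_exp_def)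

lemma times_diff_plateau: "times_diff k (plateau x y n)"
proof -
  have "times_diff k (\<lambda>t. 1 + (- 1) * exp (- real n * (flat_exp 1 (1 * t + - (x + 1 / Suc n))
      * flat_exp 1 ((- 1) * t + (y - 1 / Suc n)))))"
    by (intro times_diff_add times_diff_mult times_diff_exp times_diff_const times_diff_affine
        times_diff_flat_exp)
  then show ?thesis by (simp add: plateau_def[abs_def] algebra_simps)
qed

lemma times_diff_imp_continuous_on:
  assumes "times_diff (Suc 0) f"
  shows "continuous_on S f"
proof -
  obtain f' where "\<And>x. (f has_real_derivative f' x) (at x)"
    using assms by auto
  then show ?thesis
    by (intro continuous_at_imp_continuous_on ballI) (blast intro: DERIV_isCont)
qed

lemma continuous_plateau: "continuous_on S (plateau x y n)"
  by (intro times_diff_imp_continuous_on times_diff_plateau)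

lemma plateau_bounds: "0 \<le> plateau x y n t" "plateau x y n t \<le> 1"
  using flat_exp_1_nonneg by (auto simp: plateau_def)

lemma plateau_zero: "t \<le> x + 1 / Suc n \<or> y - 1 / Suc n \<le> t \<Longrightarrow> plateau x y n t = 0"
  by (auto simp: plateau_def flat_exp_1_zero)

lemma plateau_zero': "t \<le> x \<or> y \<le> t \<Longrightarrow> plateau x y n t = 0"
  by (rule plateau_zero) (smt (verit) of_nat_0_less_iff zero_less_Suc zero_less_divide_1_iff)

lemma plateau_tendsto: "(\<lambda>n. plateau x y n t) \<longlonglongrightarrow> indicator {x<..<y} t"
proof (cases "x < t \<and> t < y")
  case True
  have L: "(\<lambda>n. 1 / real (Suc n)) \<longlonglongrightarrow> 0"
    using LIMSEQ_inverse_real_of_nat by (simp add: divide_inverse)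
  have cont: "isCont (flat_exp 1) z" for z
    by (rule DERIV_isCont[OF flat_exp_DERIV])
  have "(\<lambda>n. flat_exp 1 (t - (x + 1 / Suc n)) * flat_exp 1 ((y - 1 / Suc n) - t))
    \<longlonglongrightarrow> flat_exp 1 (t - (x + 0)) * flat_exp 1 ((y - 0) - t)"
    by (intro tendsto_mult isCont_tendsto_compose[OF cont] tendsto_diff tendsto_add tendsto_const L)
  moreover have "0 < flat_exp 1 (t - (x + 0)) * flat_exp 1 ((y - 0) - t)"
    using True by (intro mult_pos_pos flat_exp_1_pos) auto
  ultimately have "filterlim (\<lambda>n. (flat_exp 1 (t - (x + 1 / Suc n)) * flat_exp 1 ((y - 1 / Suc n) - t)) * real n)
      at_top sequentially"
    by (rule filterlim_tendsto_pos_mult_at_top[OF _ _ filterlim_real_sequentially])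
  then have "(\<lambda>n. 1 - exp (- ((flat_exp 1 (t - (x + 1 / Suc n)) * flat_exp 1 ((y - 1 / Suc n) - t)) * real n)))
      \<longlonglongrightarrow> 1 - 0"
    by (intro tendsto_diff tendsto_const filterlim_compose[OF exp_at_bot] filterlim_compose[OF filterlim_uminus_at_bot_at_top])
  then show ?thesis using True by (simp add: plateau_def mult.commute)
next
  case False
  then have "plateau x y n t = 0" for n by (intro plateau_zero') auto
  with False show ?thesis by simp
qed

lemma antiderivative_real:
  fixes g :: "real \<Rightarrow> real"
  assumes "continuous_on UNIV g"
  obtains F where "\<And>t. (F has_real_derivative g t) (at t)"
proof
  fix t :: real
  define a b where "a = min (t - 1) (- 1)" and "b = max (t + 1) 1"
  have "((\<lambda>u. LBINT y=0..u. g y) has_vector_derivative g t) (at t within {a..b})"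
    using interval_integral_FTC2[of a 0 b g t] continuous_on_subset[OF assms, of "{a..b}"]
    by (simp add: a_def b_def zero_ereal_def)
  moreover have "t \<in> interior {a..b}" by (auto simp: a_def b_def)
  ultimately show "((\<lambda>u. LBINT y=0..u. g y) has_real_derivative g t) (at t)"
    unfolding has_real_derivative_iff_has_vector_derivative
    by (metis at_within_interior)
qed

text \<open>
  Smooth steps from \<open>0\<close> to \<open>1\<close> whose derivatives tend boundedly to the constant slope \<open>1 / (y - x)\<close> on the
  interval: antiderivatives of the plateau functions, divided by their total increase. That increase
  tends to \<open>y - x\<close>, so an initial segment of the sequence is dropped to keep it away from zero.
\<close>

lemma smooth_steps:
  fixes x y :: real
  assumes xy: "x < y"
  obtains R r :: "nat \<Rightarrow> real \<Rightarrow> real" and \<delta> :: "nat \<Rightarrow> real" and B :: real where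
    "\<And>n k. times_diff k (R n)"
    "\<And>n t. (R n has_real_derivative r n t) (at t)"
    "\<And>n t. 0 \<le> r n t" "\<And>n t. r n t \<le> B"
    "\<And>n. 0 < \<delta> n"
    "\<And>n t. t \<le> x + \<delta> n \<Longrightarrow> R n t = 0" "\<And>n t. y - \<delta> n \<le> t \<Longrightarrow> R n t = 1"
    "\<And>t. (\<lambda>n. r n t) \<longlonglongrightarrow> indicator {x<..<y} t / (y - x)"
    "\<And>t. \<lbrakk>x \<le> t; t \<le> y\<rbrakk> \<Longrightarrow> (\<lambda>n. R n t) \<longlonglongrightarrow> (t - x) / (y - x)"
proof -
  have "\<forall>n. \<exists>F. \<forall>t. (F has_real_derivative plateau x y n t) (at t)"
    using antiderivative_real[OF continuous_plateau] by metis
  then obtain F where F: "\<And>n t. (F n has_real_derivative plateau x y n t) (at t)"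
    by metis
  have incr: "(\<lambda>n. F n t - F n x) \<longlonglongrightarrow> t - x" if t: "x \<le> t" "t \<le> y" for t
  proof -
    have e: "(LINT s|lborel. indicator {x..t} s *\<^sub>R plateau x y n s) = F n t - F n x" for n
      using t(1) F by (intro integral_FTC_atLeastAtMost)
        (auto intro: continuous_plateau has_field_derivative_at_within
          simp: has_real_derivative_iff_has_vector_derivative[symmetric])
    have e2: "(LINT s|lborel. indicator {x..t} s *\<^sub>R indicat_real {x<..<y} s) = t - x"
    proof -
      have "(LINT s|lborel. indicator {x..t} s *\<^sub>R indicat_real {x<..<y} s)
        = (LINT s|lborel. indicat_real ({x..t} \<inter> {x<..<y}) s)"
        by (simp add: indicator_inter_arith)
      also have "\<dots> = (LINT s|lborel. indicat_real {x..t} s)"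
        by (intro integral_cong_AE)
          (use AE_lborel_singleton[of x] AE_lborel_singleton[of y] t in
            \<open>auto split: split_indicator\<close>)
      also have "\<dots> = t - x" using t by simp
      finally show ?thesis .
    qed
    have "(\<lambda>n. LINT s|lborel. indicator {x..t} s *\<^sub>R plateau x y n s)
      \<longlonglongrightarrow> (LINT s|lborel. indicator {x..t} s *\<^sub>R indicat_real {x<..<y} s)"
    proof (rule integral_dominated_convergence[where w = "indicator {x..t}"])
      show "(\<lambda>s. indicator {x..t} s *\<^sub>R plateau x y n s) \<in> borel_measurable lborel" for n
        using borel_measurable_continuous_onI[OF continuous_plateau, of x y n] by measurable
      show "AE s in lborel. (\<lambda>n. indicator {x..t} s *\<^sub>R plateau x y n s)
          \<longlonglongrightarrow> indicator {x..t} s *\<^sub>R (indicator {x<..<y} s :: real)"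
        by (intro AE_I2 tendsto_intros plateau_tendsto)
      show "AE s in lborel. norm (indicator {x..t} s *\<^sub>R plateau x y n s) \<le> indicator {x..t} s" for n
        using plateau_bounds by (auto split: split_indicator)
      show "integrable lborel (indicat_real {x..t})" using t by (simp add: integrable_indicator_iff)
    qed simp
    then show ?thesis unfolding e e2 .
  qed
  have "\<forall>\<^sub>F n in sequentially. (y - x) / 2 < F n y - F n x"
    using incr[of y] xy by (intro order_tendstoD) auto
  then obtain N where N: "\<And>n. N \<le> n \<Longrightarrow> (y - x) / 2 < F n y - F n x"
    by (auto simp: eventually_sequentially)
  have same: "F n a = F n b" if "a \<le> b" "\<And>z. a \<le> z \<Longrightarrow> z \<le> b \<Longrightarrow> plateau x y n z = 0" for n a b
  proof (cases "a = b")
    case False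
    with that(1) have "a < b" by simp
    from MVT2[OF this, of "F n" "plateau x y n"] F obtain z
      where "a < z" "z < b" "F n b - F n a = (b - a) * plateau x y n z" by blast
    with that(2)[of z] show ?thesis by simp
  qed simp
  define D where "D = (\<lambda>n. F (n + N) y - F (n + N) x)"
  have D: "(y - x) / 2 < D n" for n using N[of "n + N"] by (simp add: D_def)
  then have Dpos: "0 < D n" for n using xy by (smt (verit) divide_pos_pos)
  have Dlim: "D \<longlonglongrightarrow> y - x" unfolding D_def using LIMSEQ_ignore_initial_segment[OF incr[of y]] xy by simp
  define R where "R = (\<lambda>n t. (F (n + N) t - F (n + N) x) / D n)"
  define r where "r = (\<lambda>n t. plateau x y (n + N) t / D n)"
  define \<delta> where "\<delta> = (\<lambda>n. min (1 / Suc (n + N)) ((y - x) / 2))"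
  have dR: "(R n has_real_derivative r n t) (at t)" for n t
    unfolding R_def r_def using F Dpos[of n] by (auto intro!: derivative_eq_intros)
  show ?thesis
  proof
    show "(R n has_real_derivative r n t) (at t)" for n t by (rule dR)
    have "times_diff k (r n)" for k n
    proof -
      have "times_diff k (\<lambda>t. inverse (D n) * plateau x y (n + N) t)"
        by (intro times_diff_mult times_diff_const times_diff_plateau)
      then show ?thesis by (simp add: r_def divide_inverse mult.commute)
    qed
    then show "times_diff k (R n)" for k n
      using times_diff_Suc_D[OF times_diff_SucI[OF dR]] by blast
    show "0 \<le> r n t" for n t
      using plateau_bounds Dpos by (simp add: r_def less_imp_le)
    show "r n t \<le> 2 / (y - x)" for n t
    proof -
      have "r n t \<le> 1 / D n" unfolding r_def using plateau_bounds Dpos by (intro divide_right_mono) (auto intro: less_imp_le)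
      also have "\<dots> \<le> 1 / ((y - x) / 2)" using D xy by (intro divide_left_mono) (auto intro: less_imp_le simp: Dpos)
      finally show ?thesis by simp
    qed
    show "0 < \<delta> n" for n using xy by (simp add: \<delta>_def)
    show "R n t = 0" if "t \<le> x + \<delta> n" for n t
    proof -
      have "F (n + N) t = F (n + N) x"
      proof (cases "t \<le> x")
        case True
        then show ?thesis by (intro same) (auto intro: plateau_zero')
      next
        case False
        then have "F (n + N) x = F (n + N) t"
          using that by (intro same) (auto simp: \<delta>_def intro!: plateau_zero)
        then show ?thesis by simp
      qed
      then show ?thesis by (simp add: R_def)
    qed
    show "R n t = 1" if "y - \<delta> n \<le> t" for n t
    proof -
      have "F (n + N) t = F (n + N) y"
      proof (cases "t \<le> y")
        case True
        then show ?thesis using that by (intro same) (auto simp: \<delta>_def intro!: plateau_zero)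
      next
        case False
        then have "F (n + N) y = F (n + N) t"
          by (intro same) (auto intro: plateau_zero')
        then show ?thesis by simp
      qed
      then show ?thesis using Dpos[of n] by (simp add: R_def D_def)
    qed
    show "(\<lambda>n. r n t) \<longlonglongrightarrow> indicator {x<..<y} t / (y - x)" for t
      unfolding r_def using xy
      by (intro tendsto_divide Dlim LIMSEQ_ignore_initial_segment[OF plateau_tendsto]) auto
    show "(\<lambda>n. R n t) \<longlonglongrightarrow> (t - x) / (y - x)" if "x \<le> t" "t \<le> y" for t
      unfolding R_def using xy that
      by (intro tendsto_divide Dlim LIMSEQ_ignore_initial_segment[OF incr]) auto
  qed
qed

section \<open>Test functions and Lebesgue spaces in dimension one\<close>

lemma partial_deriv_coord: "partial_deriv 0 (\<lambda>x. f (x 0)) = (\<lambda>x. deriv f (x 0))"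
  by (rule ext) (simp add: partial_deriv_def)

lemma foldr_partial_deriv_coord:
  "set js \<subseteq> {..<1} \<Longrightarrow> foldr partial_deriv js (\<lambda>x. f (x 0)) = (\<lambda>x. (deriv ^^ length js) f (x 0))"
  by (induction js) (auto simp: partial_deriv_coord)

lemma times_diff_deriv:
  assumes "\<And>k. times_diff k f"
  shows "(f has_real_derivative deriv f x) (at x)" "times_diff k (deriv f)"
proof -
  obtain f' where f': "\<And>x. (f has_real_derivative f' x) (at x)" "times_diff k f'"
    using assms[of "Suc k"] by auto
  then have "deriv f = f'" using DERIV_imp_deriv by blast
  with f' show "(f has_real_derivative deriv f x) (at x)" "times_diff k (deriv f)" by simp_all
qed

lemma smooth_Rn_coord:
  assumes "\<And>k. times_diff k f"
  shows "smooth_Rn 1 (\<lambda>x. f (x 0))"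
  unfolding smooth_Rn_def
proof (intro allI impI conjI ballI)
  fix js :: "nat list" assume js: "set js \<subseteq> {..<1}"
  have sm: "times_diff k ((deriv ^^ m) f)" for k m
    by (induction m arbitrary: k) (use assms times_diff_deriv(2) in auto)
  have d: "((deriv ^^ m) f has_real_derivative deriv ((deriv ^^ m) f) x) (at x)" for m x
    by (rule times_diff_deriv(1)) (rule sm)
  have "continuous_map euclideanreal euclideanreal ((deriv ^^ length js) f)"
    using times_diff_imp_continuous_on[OF sm] by simp
  from continuous_map_compose[OF continuous_map_coord this]
  show "continuous_map (Rn 1) euclideanreal (foldr partial_deriv js (\<lambda>x. f (x 0)))"
    unfolding foldr_partial_deriv_coord[OF js] comp_def .
  fix i :: nat and x assume "i < 1"
  then show "(\<lambda>t. foldr partial_deriv js (\<lambda>x. f (x 0)) (x(i := t))) differentiable at (x i)"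
    unfolding foldr_partial_deriv_coord[OF js]
    using d[of "length js" "x i"] by (auto simp: real_differentiable_def)
qed

lemma test_function_coord:
  assumes f: "\<And>k. times_diff k f" and z: "\<And>t. t \<notin> {a..b} \<Longrightarrow> f t = 0" and ab: "{a..b} \<subseteq> I"
  shows "(\<lambda>x. f (x 0)) \<in> test_functions 1 (pt ` I)"
proof -
  let ?S = "{x \<in> topspace (Rn 1). f (x 0) \<noteq> 0}"
  have c: "compactin (Rn 1) (pt ` {a..b})" by (rule compactin_pt_image) simp
  have "Hausdorff_space (Rn 1)" by (simp add: Hausdorff_space_product_topology)
  then have cl: "closedin (Rn 1) (pt ` {a..b})" using c by (rule compactin_imp_closedin)
  have "?S \<subseteq> pt ` {a..b}"
    unfolding topspace_R1 using z by force
  then have sub: "Rn 1 closure_of ?S \<subseteq> pt ` {a..b}"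
    by (rule closure_of_minimal[OF _ cl])
  then have "compactin (Rn 1) (Rn 1 closure_of ?S)"
    using closed_compactin[OF c sub closedin_closure_of] by simp
  then show ?thesis
    unfolding test_functions_def using smooth_Rn_coord[OF f] sub ab by blast
qed

text \<open>
  All that is used of a test function in dimension one: it is continuously differentiable, and both
  the function and its derivative vanish off a compact subset of the domain.
\<close>

lemma test_functionE:
  assumes "\<phi> \<in> test_functions 1 (pt ` I)"
  obtains K where "compact K" "K \<subseteq> I" "\<And>t. t \<notin> K \<Longrightarrow> \<phi> (pt t) = 0"
    "\<And>t. t \<notin> K \<Longrightarrow> partial_deriv 0 \<phi> (pt t) = 0"
    "\<And>t. ((\<lambda>t. \<phi> (pt t)) has_real_derivative partial_deriv 0 \<phi> (pt t)) (at t)"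
    "continuous_on UNIV (\<lambda>t. partial_deriv 0 \<phi> (pt t))"
proof -
  let ?S = "{x \<in> topspace (Rn 1). \<phi> x \<noteq> 0}"
  have sm: "smooth_Rn 1 \<phi>" and c: "compactin (Rn 1) (Rn 1 closure_of ?S)"
    and sub: "Rn 1 closure_of ?S \<subseteq> pt ` I"
    using assms by (auto simp: test_functions_def)
  obtain K where K: "compact K" "Rn 1 closure_of ?S = pt ` K"
    using compactin_R1E[OF c] by blast
  have KI: "K \<subseteq> I" using sub K(2) by (metis inj_image_subset_iff inj_pt)
  have z: "\<phi> (pt t) = 0" if "t \<notin> K" for t
  proof (rule ccontr)
    assume "\<phi> (pt t) \<noteq> 0"
    then have "pt t \<in> ?S" unfolding topspace_R1 by simp
    then have "pt t \<in> pt ` K" using closure_of_subset[of ?S "Rn 1"] K(2) by blast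
    with that show False by simp
  qed
  have pd: "partial_deriv 0 \<phi> (pt t) = deriv (\<lambda>s. \<phi> (pt s)) t" for t
    by (simp add: partial_deriv_def)
  have "(\<lambda>s. \<phi> ((pt t)(0 := s))) differentiable at (pt t 0)" for t
    using sm[unfolded smooth_Rn_def, rule_format, of "[]"] unfolding topspace_R1 by force
  then have D: "((\<lambda>t. \<phi> (pt t)) has_real_derivative partial_deriv 0 \<phi> (pt t)) (at t)" for t
    unfolding pd by (simp add: DERIV_deriv_iff_real_differentiable)
  have "continuous_map (Rn 1) euclideanreal (partial_deriv 0 \<phi>)"
    using sm[unfolded smooth_Rn_def, rule_format, of "[0]"] by simp
  from continuous_map_compose[OF continuous_map_pt this]
  have C: "continuous_on UNIV (\<lambda>t. partial_deriv 0 \<phi> (pt t))" by (simp add: comp_def)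
  have z': "partial_deriv 0 \<phi> (pt t) = 0" if "t \<notin> K" for t
  proof -
    have "((\<lambda>_. 0) has_real_derivative 0) (at t)" by simp
    then have "((\<lambda>t. \<phi> (pt t)) has_real_derivative 0) (at t)"
      by (rule has_field_derivative_transform_within_open[where S = "- K"])
        (use that z K(1) in \<open>auto simp: compact_imp_closed open_Compl\<close>)
    then show ?thesis unfolding pd by (rule DERIV_imp_deriv)
  qed
  show ?thesis by (rule that[OF K(1) KI z z' D C])
qed

lemma sets_pt_image: "K \<in> sets lebesgue \<Longrightarrow> pt ` K \<in> sets leb1"
proof -
  assume "K \<in> sets lebesgue"
  from measurable_sets[OF coord_measurable this]
  have "(\<lambda>x. x 0) -` K \<inter> space leb1 \<in> sets leb1" .
  moreover have "(\<lambda>x. x 0) -` K \<inter> space leb1 = pt ` K"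
    unfolding space_leb1 by auto
  ultimately show ?thesis by simp
qed

lemma set_nn_integral_pt:
  assumes K: "K \<in> sets lebesgue" and f: "set_borel_measurable lebesgue K (\<lambda>t. f (pt t))"
  shows "(\<integral>\<^sup>+x\<in>pt ` K. ennreal (\<bar>f x\<bar> powr p) \<partial>leb1) = energy_on p K (\<lambda>t. f (pt t))"
proof -
  have "(\<lambda>t. ennreal (\<bar>indicator K t *\<^sub>R f (pt t)\<bar> powr p) * indicator K t) \<in> borel_measurable lebesgue"
    using f K unfolding set_borel_measurable_def by measurable
  moreover have "(\<lambda>t. ennreal (\<bar>indicator K t *\<^sub>R f (pt t)\<bar> powr p) * indicator K t)
    = (\<lambda>t. ennreal (\<bar>f (pt t)\<bar> powr p) * indicator (pt ` K) (pt t))"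
    by (auto simp: indicator_def fun_eq_iff)
  ultimately show ?thesis
    by (subst nn_integral_leb1) (auto simp: indicator_def)
qed

lemma Lp_pt_iff:
  assumes K: "K \<in> sets lebesgue"
  shows "f \<in> Lp 1 p (pt ` K) \<longleftrightarrow> set_borel_measurable lebesgue K (\<lambda>t. f (pt t)) \<and>
    energy_on p K (\<lambda>t. f (pt t)) < \<infinity>"
proof -
  have "f \<in> borel_measurable (restrict_space leb1 (pt ` K))
    \<longleftrightarrow> (\<lambda>x. indicator (pt ` K) x *\<^sub>R f x) \<in> borel_measurable leb1"
    using sets_pt_image[OF K] by (intro borel_measurable_restrict_space_iff) auto
  also have "\<dots> \<longleftrightarrow> set_borel_measurable lebesgue K (\<lambda>t. f (pt t))"
    unfolding borel_measurable_leb1_iff set_borel_measurable_def by (simp add: indicator_def)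
  finally have 1: "f \<in> borel_measurable (restrict_space leb1 (pt ` K))
    \<longleftrightarrow> set_borel_measurable lebesgue K (\<lambda>t. f (pt t))" .
  show ?thesis unfolding Lp_def using 1 set_nn_integral_pt[OF K, of f p] by auto
qed

lemma Lp_1_pt_iff:
  assumes K: "K \<in> sets lebesgue"
  shows "f \<in> Lp 1 1 (pt ` K) \<longleftrightarrow> set_integrable lebesgue K (\<lambda>t. f (pt t))"
proof -
  have "(\<integral>\<^sup>+t\<in>K. ennreal (\<bar>f (pt t)\<bar> powr 1) \<partial>lebesgue)
    = (\<integral>\<^sup>+t. ennreal (norm (indicator K t *\<^sub>R f (pt t))) \<partial>lebesgue)"
    by (intro nn_integral_cong) (auto simp: indicator_def)
  then show ?thesis
    unfolding Lp_pt_iff[OF K] set_integrable_def set_borel_measurable_def integrable_iff_bounded by simp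
qed

lemma Lp_pt_mono: "\<lbrakk>f \<in> Lp 1 p (pt ` K); L \<subseteq> K; K \<in> sets lebesgue; L \<in> sets lebesgue\<rbrakk> \<Longrightarrow> f \<in> Lp 1 p (pt ` L)"
  unfolding Lp_pt_iff
  by (auto intro: set_borel_measurable_subset elim!: le_less_trans[rotated] intro!: nn_integral_mono
    split: split_indicator)

lemma Lp_imp_Lp_loc:
  assumes "f \<in> Lp 1 p (pt ` I)" "I \<in> sets lebesgue"
  shows "f \<in> Lp_loc 1 p (pt ` I)"
  unfolding Lp_loc_def
proof (intro CollectI allI impI; elim conjE)
  fix K assume "compactin (Rn 1) K" "K \<subseteq> pt ` I"
  moreover obtain S where S: "compact S" "K = pt ` S"
    using compactin_R1E[OF \<open>compactin (Rn 1) K\<close>] by blast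
  ultimately have "S \<subseteq> I" by (metis inj_image_subset_iff inj_pt)
  then show "f \<in> Lp 1 p K"
    unfolding S(2) using Lp_pt_mono[OF assms(1) _ assms(2)] S(1) by (simp add: lmeasurable_compact fmeasurableD)
qed

text \<open>
  On a set of finite measure, \<open>\<bar>z\<bar> \<le> 1 + \<bar>z\<bar> powr p\<close> replaces Hoelder's inequality.
\<close>

lemma Lp_imp_integrable:
  assumes f: "f \<in> Lp 1 p (pt ` I)" and I: "I \<in> lmeasurable" and p: "1 < p"
  shows "set_integrable lebesgue I (\<lambda>t. f (pt t))"
proof -
  have I': "I \<in> sets lebesgue" using I by (rule fmeasurableD)
  have m: "set_borel_measurable lebesgue I (\<lambda>t. f (pt t))"
    and fin: "energy_on p I (\<lambda>t. f (pt t)) < \<infinity>"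
    using f unfolding Lp_pt_iff[OF I'] by auto
  have le: "\<bar>z\<bar> \<le> 1 + \<bar>z\<bar> powr p" for z :: real
  proof (cases "\<bar>z\<bar> \<le> 1")
    case False
    then have "\<bar>z\<bar> powr 1 \<le> \<bar>z\<bar> powr p" using p by (intro powr_mono) auto
    then show ?thesis using False by simp
  qed (smt (verit) powr_ge_zero)
  have "(\<integral>\<^sup>+t. ennreal (norm (indicator I t *\<^sub>R f (pt t))) \<partial>lebesgue)
    \<le> (\<integral>\<^sup>+t. indicator I t + ennreal (\<bar>indicator I t *\<^sub>R f (pt t)\<bar> powr p) * indicator I t \<partial>lebesgue)"
  proof (rule nn_integral_mono)
    fix t
    show "ennreal (norm (indicator I t *\<^sub>R f (pt t))) 
        \<le> indicator I t + ennreal (\<bar>indicator I t *\<^sub>R f (pt t)\<bar> powr p) * indicator I t"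
    proof (cases "t \<in> I")
      case True
      have "ennreal \<bar>f (pt t)\<bar> \<le> ennreal (1 + \<bar>f (pt t)\<bar> powr p)"
        by (rule ennreal_leI[OF le])
      also have "\<dots> = 1 + ennreal (\<bar>f (pt t)\<bar> powr p)"
        by (subst ennreal_plus) simp_all
      finally show ?thesis using True by simp
    qed simp
  qed
  also have "\<dots> = emeasure lebesgue I + (\<integral>\<^sup>+t. ennreal (\<bar>indicator I t *\<^sub>R f (pt t)\<bar> powr p) * indicator I t \<partial>lebesgue)"
    using m I' unfolding set_borel_measurable_def
    by (subst nn_integral_add) auto
  also have "(\<integral>\<^sup>+t. ennreal (\<bar>indicator I t *\<^sub>R f (pt t)\<bar> powr p) * indicator I t \<partial>lebesgue)
    = energy_on p I (\<lambda>t. f (pt t))"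
    by (intro nn_integral_cong) (auto simp: indicator_def)
  also have "emeasure lebesgue I + \<dots> < \<infinity>"
    using fin I by (auto simp: fmeasurable_def)
  finally show ?thesis
    using m unfolding set_integrable_def set_borel_measurable_def integrable_iff_bounded by simp
qed

section \<open>Weak gradients on a punctured interval\<close>

text \<open>
  Both domains of the construction have this form, with \<open>F\<close> empty for the larger one and a single
  point for the smaller one. Removing finitely many points changes no integral; it only forces the
  test functions to vanish at these points.
\<close>

abbreviation punctured :: "real set \<Rightarrow> real set" where
  "punctured F \<equiv> {0<..<1} - F"

lemma open_punctured: "finite F \<Longrightarrow> open (punctured F)"
  by (intro open_Diff finite_imp_closed) auto

lemma lmeasurable_punctured: "finite F \<Longrightarrow> punctured F \<in> lmeasurable"
  by (intro fmeasurable.Diff) (auto intro: negligible_imp_measurable negligible_finite)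

lemma sets_punctured: "finite F \<Longrightarrow> punctured F \<in> sets lebesgue"
  by (intro fmeasurableD lmeasurable_punctured)

lemma AE_not_in_finite: "finite F \<Longrightarrow> AE t in lebesgue. (t :: real) \<notin> F"
  by (metis AE_not_in negligible_finite negligible_iff_null_sets)

lemma set_integral_punctured:
  fixes f :: "real \<Rightarrow> real"
  assumes "finite F"
  shows "(LINT t:punctured F|lebesgue. f t) = (LINT t:{0..1}|lebesgue. f t)"
    and "set_integrable lebesgue (punctured F) f \<longleftrightarrow> set_integrable lebesgue {0..1} f"
proof -
  have N: "negligible X" if "X \<subseteq> F \<union> {0, 1}" for X
    by (rule negligible_subset[OF negligible_finite that]) (use assms in auto)
  show 2: "set_integrable lebesgue (punctured F) f \<longleftrightarrow> set_integrable lebesgue {0..1} f"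
    by (intro absolutely_integrable_spike_set_eq N) auto
  show "(LINT t:punctured F|lebesgue. f t) = (LINT t:{0..1}|lebesgue. f t)"
  proof (cases "set_integrable lebesgue {0..1} f")
    case True
    have "integral (punctured F) f = integral {0..1} f"
      by (rule integral_spike_set) (auto intro: N)
    then show ?thesis using True 2 by (simp add: set_lebesgue_integral_eq_integral)
  next
    case False
    then show ?thesis using 2
      unfolding set_integrable_def set_lebesgue_integral_def by (simp add: not_integrable_integral_eq)
  qed
qed

lemma continuous_imp_lebesgue_measurable:
  fixes f :: "real \<Rightarrow> real"
  shows "continuous_on UNIV f \<Longrightarrow> f \<in> borel_measurable lebesgue"
  by (rule measurable_completion) (simp add: borel_measurable_continuous_onI)

lemma set_integrable_bounded_mult:
  fixes U f :: "real \<Rightarrow> real"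
  assumes U: "set_integrable lebesgue I U" and f: "continuous_on UNIV f"
    and K: "compact K" "\<And>t. t \<notin> K \<Longrightarrow> f t = 0"
  shows "set_integrable lebesgue I (\<lambda>t. U t * f t)"
proof -
  obtain B where B: "\<And>t. t \<in> K \<Longrightarrow> norm (f t) \<le> B"
    using compact_imp_bounded[OF compact_continuous_image[OF continuous_on_subset[OF f] K(1)]]
    by (auto simp: bounded_iff)
  then have B: "norm (f t) \<le> \<bar>B\<bar>" for t
    using K(2)[of t] by (cases "t \<in> K") (force, simp)
  have [measurable]: "f \<in> borel_measurable lebesgue"
    using f by (rule continuous_imp_lebesgue_measurable)
  have [measurable]: "(\<lambda>t. indicator I t *\<^sub>R U t) \<in> borel_measurable lebesgue"
    using U unfolding set_integrable_def by (rule borel_measurable_integrable)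
  show ?thesis
    unfolding set_integrable_def
  proof (rule Bochner_Integration.integrable_bound)
    show "integrable lebesgue (\<lambda>t. \<bar>B\<bar> * (indicator I t *\<^sub>R U t))"
      using U unfolding set_integrable_def by (rule integrable_mult_right)
    have "(\<lambda>t. (indicator I t *\<^sub>R U t) * f t) \<in> borel_measurable lebesgue" by measurable
    then show "(\<lambda>t. indicator I t *\<^sub>R (U t * f t)) \<in> borel_measurable lebesgue" 
      by (simp add: mult.assoc)
    show "AE t in lebesgue. norm (indicator I t *\<^sub>R (U t * f t)) \<le> norm (\<bar>B\<bar> * (indicator I t *\<^sub>R U t))"
    proof (rule AE_I2)
      fix t
      have "\<bar>U t\<bar> * \<bar>f t\<bar> \<le> \<bar>U t\<bar> * \<bar>B\<bar>" using B[of t] by (intro mult_left_mono) auto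
      then show "norm (indicator I t *\<^sub>R (U t * f t)) \<le> norm (\<bar>B\<bar> * (indicator I t *\<^sub>R U t))"
        by (auto simp: abs_mult mult.commute split: split_indicator)
    qed
  qed
qed

lemma has_weak_gradient_iff:
  assumes F: "finite F"
    and u: "set_integrable lebesgue (punctured F) (\<lambda>t. u (pt t))"
    and g: "set_integrable lebesgue (punctured F) (\<lambda>t. g (pt t) 0)"
  shows "has_weak_gradient 1 (pt ` punctured F) u g \<longleftrightarrow>
    (\<forall>\<phi>\<in>test_functions 1 (pt ` punctured F).
      (LINT t:punctured F|lebesgue. u (pt t) * partial_deriv 0 \<phi> (pt t)) =
      - (LINT t:punctured F|lebesgue. g (pt t) 0 * \<phi> (pt t)))"
proof -
  have "u \<in> Lp_loc 1 1 (pt ` punctured F)" "(\<lambda>x. g x 0) \<in> Lp_loc 1 1 (pt ` punctured F)"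
    using u g sets_punctured[OF F] by (auto intro!: Lp_imp_Lp_loc simp: Lp_1_pt_iff)
  then show ?thesis
    unfolding has_weak_gradient_def set_integral_leb1 by (auto simp: less_one)
qed

lemma has_weak_gradient_lincomb:
  assumes F: "finite F"
    and u: "set_integrable lebesgue (punctured F) (\<lambda>t. u (pt t))"
    and g: "set_integrable lebesgue (punctured F) (\<lambda>t. g (pt t) 0)"
    and v: "set_integrable lebesgue (punctured F) (\<lambda>t. v (pt t))"
    and h: "set_integrable lebesgue (punctured F) (\<lambda>t. h (pt t) 0)"
    and ug: "has_weak_gradient 1 (pt ` punctured F) u g"
    and vh: "has_weak_gradient 1 (pt ` punctured F) v h"
  shows "has_weak_gradient 1 (pt ` punctured F) (\<lambda>x. u x + c * v x) (\<lambda>x i. g x i + c * h x i)"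
proof (subst has_weak_gradient_iff[OF F])
  show "set_integrable lebesgue (punctured F) (\<lambda>t. u (pt t) + c * v (pt t))"
    "set_integrable lebesgue (punctured F) (\<lambda>t. g (pt t) 0 + c * h (pt t) 0)"
    using u v g h by auto
  show "\<forall>\<phi>\<in>test_functions 1 (pt ` punctured F).
      (LINT t:punctured F|lebesgue. (u (pt t) + c * v (pt t)) * partial_deriv 0 \<phi> (pt t)) =
      - (LINT t:punctured F|lebesgue. (g (pt t) 0 + c * h (pt t) 0) * \<phi> (pt t))"
  proof
    fix \<phi> assume \<phi>: "\<phi> \<in> test_functions 1 (pt ` punctured F)"
    obtain K where K: "compact K" "\<And>t. t \<notin> K \<Longrightarrow> \<phi> (pt t) = 0"
      "\<And>t. t \<notin> K \<Longrightarrow> partial_deriv 0 \<phi> (pt t) = 0"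
      "\<And>t. ((\<lambda>t. \<phi> (pt t)) has_real_derivative partial_deriv 0 \<phi> (pt t)) (at t)"
      "continuous_on UNIV (\<lambda>t. partial_deriv 0 \<phi> (pt t))"
      using test_functionE[OF \<phi>] by metis
    have c\<phi>: "continuous_on UNIV (\<lambda>t. \<phi> (pt t))"
      using K(4) by (intro continuous_at_imp_continuous_on ballI) (blast intro: DERIV_isCont)
    note m = set_integrable_bounded_mult[OF _ K(5) K(1) K(3)] set_integrable_bounded_mult[OF _ c\<phi> K(1) K(2)]
    have "(LINT t:punctured F|lebesgue. (u (pt t) + c * v (pt t)) * partial_deriv 0 \<phi> (pt t))
      = (LINT t:punctured F|lebesgue. u (pt t) * partial_deriv 0 \<phi> (pt t))
        + c * (LINT t:punctured F|lebesgue. v (pt t) * partial_deriv 0 \<phi> (pt t))"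
      using m(1)[OF u] m(1)[OF v] by (simp add: distrib_right mult.assoc)
    moreover have "(LINT t:punctured F|lebesgue. (g (pt t) 0 + c * h (pt t) 0) * \<phi> (pt t))
      = (LINT t:punctured F|lebesgue. g (pt t) 0 * \<phi> (pt t))
        + c * (LINT t:punctured F|lebesgue. h (pt t) 0 * \<phi> (pt t))"
      using m(2)[OF g] m(2)[OF h] by (simp add: distrib_right mult.assoc)
    ultimately show "(LINT t:punctured F|lebesgue. (u (pt t) + c * v (pt t)) * partial_deriv 0 \<phi> (pt t)) =
      - (LINT t:punctured F|lebesgue. (g (pt t) 0 + c * h (pt t) 0) * \<phi> (pt t))"
      using ug vh \<phi> unfolding has_weak_gradient_iff[where u = u and g = g, OF F u g]
        has_weak_gradient_iff[where u = v and g = h, OF F v h]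
      by simp
  qed
qed

text \<open>
  The positive and the negative part of \<open>G\<close> are densities of finite measures that agree on all
  half-lines, so these measures are equal and the two parts agree almost everywhere. A Borel
  representative is used because the uniqueness of measures is about the Borel sets.
\<close>

lemma zero_if_tail_integrals_zero:
  fixes G :: "real \<Rightarrow> real"
  assumes G: "integrable lebesgue G"
    and tails: "\<And>x. (LINT t|lebesgue. indicat_real {x<..} t * G t) = 0"
  shows "AE t in lebesgue. G t = 0"
proof -
  obtain H where H [measurable]: "H \<in> borel_measurable lborel" and GH: "AE t in lborel. G t = H t"
    using completion_ex_borel_measurable_real[of G lborel] G by auto
  have GH': "AE t in lebesgue. G t = H t" using GH by (simp add: AE_completion_iff)
  have "integrable lebesgue H"
    using G GH' H by (subst integrable_cong_AE[OF _ _ AE_symmetric[OF GH']]) (auto simp: measurable_completion)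
  then have HI: "integrable lborel H" using integrable_completion[OF H] by blast
  define P where "P = (\<lambda>t. max 0 (H t))"
  define N where "N = (\<lambda>t. max 0 (- H t))"
  have [measurable]: "P \<in> borel_measurable lborel" "N \<in> borel_measurable lborel"
    unfolding P_def N_def by measurable
  have PI: "integrable lborel P" "integrable lborel N"
    using HI by (auto simp: P_def N_def)
  have tailsH: "(LINT t|lborel. indicat_real {x<..} t * H t) = 0" for x
  proof -
    have "(LINT t|lborel. indicat_real {x<..} t * H t) = (LINT t|lebesgue. indicat_real {x<..} t * H t)"
      by (rule integral_completion[symmetric]) measurable
    also have "\<dots> = (LINT t|lebesgue. indicat_real {x<..} t * G t)"
    proof (rule integral_cong_AE)
      show "(\<lambda>t. indicat_real {x<..} t * H t) \<in> borel_measurable lebesgue"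
        using H by (intro borel_measurable_times borel_measurable_indicator measurable_completion) auto
      show "(\<lambda>t. indicat_real {x<..} t * G t) \<in> borel_measurable lebesgue"
        using G by (intro borel_measurable_times borel_measurable_indicator) auto
    qed (use GH' in auto)
    finally show ?thesis using tails by simp
  qed
  have e: "emeasure (density lborel (\<lambda>t. ennreal (f t))) {x<..} = ennreal (LINT t|lborel. indicat_real {x<..} t * f t)"
    if "integrable lborel f" "\<And>t. 0 \<le> f t" for f :: "real \<Rightarrow> real" and x
  proof -
    have [measurable]: "f \<in> borel_measurable lborel" using that by auto
    have "emeasure (density lborel (\<lambda>t. ennreal (f t))) {x<..}
      = (\<integral>\<^sup>+t. ennreal (f t) * indicator {x<..} t \<partial>lborel)"
      by (rule emeasure_density) measurable
    also have "\<dots> = (\<integral>\<^sup>+t. ennreal (indicat_real {x<..} t * f t) \<partial>lborel)"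
      by (intro nn_integral_cong) (simp split: split_indicator)
    also have "\<dots> = ennreal (LINT t|lborel. indicat_real {x<..} t * f t)"
      using that by (intro nn_integral_eq_integral)
        (auto intro!: integrable_real_mult_indicator simp: mult.commute)
    finally show ?thesis .
  qed
  have "density lborel (\<lambda>t. ennreal (P t)) = density lborel (\<lambda>t. ennreal (N t))"
  proof (rule measure_eqI_lessThan)
    fix x
    have ePN: "P t - N t = H t" for t by (auto simp: P_def N_def)
    have "(LINT t|lborel. indicat_real {x<..} t * P t) - (LINT t|lborel. indicat_real {x<..} t * N t)
      = (LINT t|lborel. indicat_real {x<..} t * P t - indicat_real {x<..} t * N t)"
      using PI by (intro Bochner_Integration.integral_diff[symmetric])
        (auto intro!: integrable_real_mult_indicator simp: mult.commute)
    also have "\<dots> = 0" using tailsH[of x] ePN by (simp add: right_diff_distrib[symmetric])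
    finally show "emeasure (density lborel (\<lambda>t. ennreal (P t))) {x<..} = emeasure (density lborel (\<lambda>t. ennreal (N t))) {x<..}"
      using PI by (simp add: e P_def N_def)
    show "emeasure (density lborel (\<lambda>t. ennreal (P t))) {x<..} < \<infinity>"
      using PI by (simp add: e P_def)
  qed auto
  then have "AE t in lborel. ennreal (P t) = ennreal (N t)"
    by (subst (asm) sigma_finite_measure.density_unique_iff[OF sigma_finite_lborel]) measurable
  then have "AE t in lborel. H t = 0"
    by eventually_elim (auto simp: P_def N_def max_def split: if_splits)
  then have "AE t in lborel. G t = 0" using GH by eventually_elim simp
  then show ?thesis by (simp add: AE_completion_iff)
qed

text \<open>
  Tested against plateau functions, two weak gradients of the same function have the same integral
  over every interval. The argument is carried out on compact intervals in the domain, where weak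
  gradients are integrable; countably many of these cover the domain.
\<close>

lemma weak_gradient_unique:
  assumes F: "finite F"
    and g: "has_weak_gradient 1 (pt ` punctured F) u g"
    and g': "has_weak_gradient 1 (pt ` punctured F) u g'"
  shows "AE t in lebesgue. t \<in> punctured F \<longrightarrow> g (pt t) 0 = g' (pt t) 0"
proof -
  let ?I = "punctured F"
  have loc: "AE t in lebesgue. t \<in> {c..d} \<longrightarrow> g (pt t) 0 = g' (pt t) 0" if cd: "c < d" "{c..d} \<subseteq> ?I" for c d
  proof -
    have K: "compactin (Rn 1) (pt ` {c..d})" by (rule compactin_pt_image) simp
    have L: "set_integrable lebesgue {c..d} (\<lambda>t. k (pt t) 0)" if "has_weak_gradient 1 (pt ` ?I) u k" for k
    proof -
      have "(\<lambda>x. k x 0) \<in> Lp_loc 1 1 (pt ` ?I)"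
        using that by (simp add: has_weak_gradient_def)
      then have "(\<lambda>x. k x 0) \<in> Lp 1 1 (pt ` {c..d})"
        using K cd(2) unfolding Lp_loc_def by blast
      then show ?thesis by (simp add: Lp_1_pt_iff)
    qed
    define G where "G = (\<lambda>t. indicat_real {c..d} t * (g (pt t) 0 - g' (pt t) 0))"
    have "set_integrable lebesgue {c..d} (\<lambda>t. g (pt t) 0 - g' (pt t) 0)"
      using L[OF g] L[OF g'] by (rule set_integral_diff(1))
    then have G: "integrable lebesgue G" by (simp add: G_def set_integrable_def)
    \<comment> \<open>The plateau functions between \<open>x\<close> and \<open>d\<close> are test functions supported in \<open>{c..d}\<close>, where \<open>G\<close> is the
      difference of the two gradients.\<close>
    have pl: "(LINT t|lebesgue. plateau x d n t * G t) = 0" if x: "c \<le> x" for x n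
    proof -
      have \<phi>: "(\<lambda>z. plateau x d n (z 0)) \<in> test_functions 1 (pt ` ?I)"
        by (rule test_function_coord[where a = c and b = d])
          (use cd x in \<open>auto intro!: times_diff_plateau plateau_zero'\<close>)
      have e: "(LINT t:?I|lebesgue. k (pt t) 0 * plateau x d n t)
        = (LINT t|lebesgue. indicat_real {c..d} t * k (pt t) 0 * plateau x d n t)" for k
        unfolding set_lebesgue_integral_def
        using cd x plateau_zero'[of _ x d n]
        by (intro Bochner_Integration.integral_cong) (auto split: split_indicator)
      have i: "integrable lebesgue (\<lambda>t. indicat_real {c..d} t * k (pt t) 0 * plateau x d n t)"
        if "has_weak_gradient 1 (pt ` ?I) u k" for k
      proof (rule Bochner_Integration.integrable_bound)
        show "integrable lebesgue (\<lambda>t. indicat_real {c..d} t * k (pt t) 0)"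
          using L[OF that] by (simp add: set_integrable_def)
        then show "(\<lambda>t. indicat_real {c..d} t * k (pt t) 0 * plateau x d n t) \<in> borel_measurable lebesgue"
          by (intro borel_measurable_times continuous_imp_lebesgue_measurable continuous_plateau
              borel_measurable_integrable)
        show "AE t in lebesgue. norm (indicat_real {c..d} t * k (pt t) 0 * plateau x d n t)
          \<le> norm (indicat_real {c..d} t * k (pt t) 0)"
          using plateau_bounds[of x d n] by (intro AE_I2) (auto simp: abs_mult intro!: mult_right_le_one_le)
      qed
      have "(LINT t:?I|lebesgue. g (pt t) 0 * plateau x d n t) = (LINT t:?I|lebesgue. g' (pt t) 0 * plateau x d n t)"
        using g g' \<phi> unfolding has_weak_gradient_def set_integral_leb1 by fastforce
      then have "0 = (LINT t|lebesgue. indicat_real {c..d} t * g (pt t) 0 * plateau x d n t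
          - indicat_real {c..d} t * g' (pt t) 0 * plateau x d n t)"
        unfolding e using i[OF g] i[OF g'] by simp
      also have "\<dots> = (LINT t|lebesgue. plateau x d n t * G t)"
        by (intro Bochner_Integration.integral_cong) (auto simp: G_def algebra_simps)
      finally show ?thesis by simp
    qed
    have "(LINT t|lebesgue. indicat_real {x<..<d} t * G t) = 0" if x: "c \<le> x" for x
    proof -
      have "(\<lambda>n. LINT t|lebesgue. plateau x d n t * G t) \<longlonglongrightarrow> (LINT t|lebesgue. indicat_real {x<..<d} t * G t)"
      proof (rule integral_dominated_convergence[where w = "\<lambda>t. norm (G t)"])
        show "(\<lambda>t. plateau x d n t * G t) \<in> borel_measurable lebesgue" for n
          using G by (intro borel_measurable_times continuous_imp_lebesgue_measurable continuous_plateau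
              borel_measurable_integrable)
        show "AE t in lebesgue. norm (plateau x d n t * G t) \<le> norm (G t)" for n
          using plateau_bounds[of x d n] by (intro AE_I2) (auto simp: abs_mult intro!: mult_left_le_one_le)
        show "(\<lambda>t. indicat_real {x<..<d} t * G t) \<in> borel_measurable lebesgue"
          using G by (intro borel_measurable_times borel_measurable_indicator) auto
      qed (use G in \<open>auto intro!: tendsto_intros plateau_tendsto\<close>)
      then show ?thesis using pl[OF x] LIMSEQ_unique by (simp add: LIMSEQ_const_iff)
    qed
    moreover have "(LINT t|lebesgue. indicat_real {x<..} t * G t)
      = (LINT t|lebesgue. indicat_real {max c x<..<d} t * G t)" for x
    proof (rule integral_cong_AE)
      have "(\<lambda>t. indicat_real A t * G t) \<in> borel_measurable lebesgue" if "A \<in> sets lebesgue" for A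
        using G that by (intro borel_measurable_times borel_measurable_indicator) auto
      then show "(\<lambda>t. indicat_real {x<..} t * G t) \<in> borel_measurable lebesgue"
        "(\<lambda>t. indicat_real {max c x<..<d} t * G t) \<in> borel_measurable lebesgue" by auto
      show "AE t in lebesgue. indicat_real {x<..} t * G t = indicat_real {max c x<..<d} t * G t"
        using AE_not_in_finite[of "{c,d}"] by (auto simp: G_def split: split_indicator)
    qed
    ultimately have "AE t in lebesgue. G t = 0"
      by (intro zero_if_tail_integrals_zero[OF G]) simp
    then show ?thesis by eventually_elim (auto simp: G_def)
  qed
  \<comment> \<open>The compact intervals with rational end points in the domain cover it.\<close>
  let ?R = "{(a, b) \<in> \<rat> \<times> \<rat>. a < b \<and> {a..b} \<subseteq> ?I} :: (real \<times> real) set"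
  have "countable ?R"
    by (rule countable_subset[of _ "\<rat> \<times> \<rat>"]) (auto simp: countable_rat)
  then have "AE t in lebesgue. \<forall>z\<in>?R. t \<in> {fst z..snd z} \<longrightarrow> g (pt t) 0 = g' (pt t) 0"
    by (subst AE_ball_countable) (auto intro!: loc simp del: atLeastAtMost_iff)
  moreover have "\<exists>z\<in>?R. t \<in> {fst z..snd z}" if "t \<in> ?I" for t
  proof -
    obtain e where e: "0 < e" "ball t e \<subseteq> ?I"
      by (rule openE[OF open_punctured[OF F] \<open>t \<in> ?I\<close>])
    obtain a where a: "a \<in> \<rat>" "t - e < a" "a < t" using Rats_dense_in_real[of "t - e" t] e(1) by auto
    obtain b where b: "b \<in> \<rat>" "t < b" "b < t + e" using Rats_dense_in_real[of t "t + e"] e(1) by auto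
    have "{a..b} \<subseteq> ball t e" using a(2) b(3) by (auto simp: dist_real_def)
    with e(2) have "{a..b} \<subseteq> ?I" by (rule order_trans[rotated])
    then have "(a, b) \<in> ?R" using a b by simp
    moreover have "t \<in> {fst (a, b)..snd (a, b)}" using a b by simp
    ultimately show ?thesis by blast
  qed
  ultimately show ?thesis
    by (elim eventually_mono) blast
qed

lemma weak_gradient_AE:
  assumes "finite F" and "has_weak_gradient 1 (pt ` punctured F) u g"
  shows "AE t in lebesgue. t \<in> punctured F \<longrightarrow> weak_gradient 1 (pt ` punctured F) u (pt t) 0 = g (pt t) 0"
  using assms(2) unfolding weak_gradient_def
  by (intro weak_gradient_unique[OF assms(1), of u _ g] someI[of "has_weak_gradient 1 (pt ` punctured F) u"])

text \<open>
  By uniqueness any known weak gradient may replace the chosen one in the energy, and the integral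
  becomes one over the line.
\<close>

lemma p_energy_pt:
  assumes F: "finite F" and wg: "has_weak_gradient 1 (pt ` punctured F) u (\<lambda>x i. G (x 0))"
    and A: "A \<subseteq> pt ` punctured F" "AE t in lebesgue. pt t \<in> A \<longleftrightarrow> t \<in> T"
    and G: "set_borel_measurable lebesgue T G" and T: "T \<in> sets lebesgue"
  shows "p_energy 1 p (pt ` punctured F) u A = energy_on p T G"
proof -
  have L2: "L2_set f {..<1} = \<bar>f 0\<bar>" for f :: "nat \<Rightarrow> real"
    by (simp add: L2_set_def lessThan_Suc One_nat_def)
  have "p_energy 1 p (pt ` punctured F) u A
    = (\<integral>\<^sup>+x. ennreal (\<bar>indicator T (x 0) *\<^sub>R G (x 0)\<bar> powr p) * indicator T (x 0) \<partial>leb1)"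
    unfolding p_energy_def L2
  proof (rule nn_integral_cong_AE, unfold AE_leb1_iff)
    show "AE t in lebesgue. ennreal (\<bar>weak_gradient 1 (pt ` punctured F) u (pt t) 0\<bar> powr p) * indicator A (pt t)
        = ennreal (\<bar>indicator T (pt t 0) *\<^sub>R G (pt t 0)\<bar> powr p) * indicator T (pt t 0)"
      using weak_gradient_AE[OF F wg] A(2)
    proof eventually_elim
      fix t
      assume 1: "t \<in> punctured F \<longrightarrow> weak_gradient 1 (pt ` punctured F) u (pt t) 0 = G (pt t 0)"
        and 2: "pt t \<in> A \<longleftrightarrow> t \<in> T"
      have "pt t \<in> A \<Longrightarrow> t \<in> punctured F" using A(1) pt_mem_image_iff by blast
      with 1 2 show "ennreal (\<bar>weak_gradient 1 (pt ` punctured F) u (pt t) 0\<bar> powr p) * indicator A (pt t)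
        = ennreal (\<bar>indicator T (pt t 0) *\<^sub>R G (pt t 0)\<bar> powr p) * indicator T (pt t 0)"
        by (cases "t \<in> T") auto
    qed
  qed
  also have "\<dots> = (\<integral>\<^sup>+t. ennreal (\<bar>indicator T t *\<^sub>R G t\<bar> powr p) * indicator T t \<partial>lebesgue)"
  proof (subst nn_integral_leb1)
    show "(\<lambda>t. ennreal (\<bar>indicator T (pt t 0) *\<^sub>R G (pt t 0)\<bar> powr p) * indicator T (pt t 0)) \<in> borel_measurable lebesgue"
      using G T unfolding set_borel_measurable_def pt_0 by measurable
  qed simp
  also have "\<dots> = energy_on p T G"
    by (intro nn_integral_cong) (auto split: split_indicator)
  finally show ?thesis .
qed

lemma bounded_imp_Lp:
  assumes F: "finite F" and U: "(\<lambda>t. indicator {0<..<1} t * U t) \<in> borel_measurable lebesgue"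
    and B: "\<And>t. t \<in> {0<..<1} \<Longrightarrow> \<bar>U t\<bar> \<le> B" and u: "\<And>t. t \<in> punctured F \<Longrightarrow> u (pt t) = (U t :: real)"
    and p: "0 < p"
  shows "u \<in> Lp 1 p (pt ` punctured F)"
  unfolding Lp_pt_iff[OF sets_punctured[OF F]] set_borel_measurable_def
proof
  have "(\<lambda>t. indicat_real (punctured F) t * (indicator {0<..<1} t * U t)) \<in> borel_measurable lebesgue"
    by (rule borel_measurable_times[OF borel_measurable_indicator[OF sets_punctured[OF F]] U])
  moreover have "(\<lambda>t. indicat_real (punctured F) t * (indicator {0<..<1} t * U t))
      = (\<lambda>t. indicat_real (punctured F) t *\<^sub>R u (pt t))"
    using u by (auto simp: fun_eq_iff split: split_indicator)
  ultimately show "(\<lambda>t. indicat_real (punctured F) t *\<^sub>R u (pt t)) \<in> borel_measurable lebesgue"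
    by simp
  have "energy_on p (punctured F) (\<lambda>t. u (pt t))
    \<le> (\<integral>\<^sup>+t. ennreal (B powr p) * indicator (punctured F) t \<partial>lebesgue)"
    using B u p by (intro nn_integral_mono) (auto split: split_indicator intro!: ennreal_leI powr_mono2)
  also have "\<dots> = ennreal (B powr p) * emeasure lebesgue (punctured F)"
    using sets_punctured[OF F] by (rule nn_integral_cmult_indicator)
  also have "\<dots> < \<infinity>"
    using lmeasurable_punctured[OF F] by (auto simp: fmeasurable_def ennreal_mult_less_top)
  finally show "energy_on p (punctured F) (\<lambda>t. u (pt t)) < \<infinity>" .
qed

lemma continuous_on_Icc_measurable:
  fixes U :: "real \<Rightarrow> real"
  assumes "continuous_on {0..1} U"
  shows "(\<lambda>t. indicator {0<..<1} t * U t) \<in> borel_measurable lebesgue"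
proof -
  have "continuous_on {0<..<1} U" by (rule continuous_on_subset[OF assms]) auto
  then have "(\<lambda>t. indicator {0<..<1} t *\<^sub>R U t) \<in> borel_measurable borel"
    by (intro borel_measurable_continuous_on_indicator) auto
  then show ?thesis by (intro measurable_completion) simp
qed

text \<open>
  Integration by parts: for a test function \<open>f\<close> the product \<open>U * f\<close> is continuous, vanishes at \<open>0\<close> and \<open>1\<close>,
  and has derivative \<open>G * f + U * f'\<close> off the finite set \<open>S\<close>, so this derivative has integral zero.
\<close>

lemma piecewise_C1_weak_gradient:
  assumes F: "finite F" and S: "finite S" and U: "continuous_on {0..1} U"
    and G: "\<And>t. t \<in> {0<..<1} - S \<Longrightarrow> (U has_real_derivative G t) (at t)"
    and Gm: "(\<lambda>t. indicator {0<..<1} t * G t) \<in> borel_measurable lebesgue"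
    and GB: "\<And>t. t \<in> {0<..<1} \<Longrightarrow> \<bar>G t\<bar> \<le> B"
    and u: "\<And>t. t \<in> punctured F \<Longrightarrow> u (pt t) = U t"
  shows "has_weak_gradient 1 (pt ` punctured F) u (\<lambda>x i. G (x 0))"
    and "1 < p \<Longrightarrow> u \<in> W1p 1 p (pt ` punctured F)"
    and "1 < p \<Longrightarrow> u \<in> W1p_loc 1 p (pt ` punctured F)"
    and "set_integrable lebesgue (punctured F) (\<lambda>t. u (pt t))"
    and "set_integrable lebesgue (punctured F) G"
proof -
  obtain C where C: "\<And>t. t \<in> {0..1} \<Longrightarrow> norm (U t) \<le> C"
    using compact_imp_bounded[OF compact_continuous_image[OF U]] by (auto simp: bounded_iff simp del: atLeastAtMost_iff)
  note m = bounded_imp_Lp[OF F continuous_on_Icc_measurable[OF U], of C u]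
    bounded_imp_Lp[OF F Gm GB, of "\<lambda>x. G (x 0)"]
  have uL: "u \<in> Lp 1 q (pt ` punctured F)" if "0 < q" for q
    by (rule m(1)) (use C u that in auto)
  have gL: "(\<lambda>x. G (x 0)) \<in> Lp 1 q (pt ` punctured F)" if "0 < q" for q
    by (rule m(2)) (use that in auto)
  show uI: "set_integrable lebesgue (punctured F) (\<lambda>t. u (pt t))"
    using uL[of 1] sets_punctured[OF F] by (simp add: Lp_1_pt_iff)
  show gI: "set_integrable lebesgue (punctured F) G"
    using gL[of 1] sets_punctured[OF F] by (simp add: Lp_1_pt_iff)
  have gI': "set_integrable lebesgue {0..1} G"
    using gI set_integral_punctured(2)[OF F] by blast
  have UI': "set_integrable lebesgue {0..1} U"
    using U by (rule absolutely_integrable_continuous_real)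
  show wg: "has_weak_gradient 1 (pt ` punctured F) u (\<lambda>x i. G (x 0))"
  proof (subst has_weak_gradient_iff[OF F uI])
    show "set_integrable lebesgue (punctured F) (\<lambda>t. G (pt t 0))" using gI by simp
    show "\<forall>\<phi>\<in>test_functions 1 (pt ` punctured F).
       (LINT t:punctured F|lebesgue. u (pt t) * partial_deriv 0 \<phi> (pt t)) =
       - (LINT t:punctured F|lebesgue. G (pt t 0) * \<phi> (pt t))"
    proof
      fix \<phi> assume \<phi>: "\<phi> \<in> test_functions 1 (pt ` punctured F)"
      obtain K where K: "compact K" "K \<subseteq> punctured F" "\<And>t. t \<notin> K \<Longrightarrow> \<phi> (pt t) = 0"
        "\<And>t. t \<notin> K \<Longrightarrow> partial_deriv 0 \<phi> (pt t) = 0"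
        "\<And>t. ((\<lambda>t. \<phi> (pt t)) has_real_derivative partial_deriv 0 \<phi> (pt t)) (at t)"
        "continuous_on UNIV (\<lambda>t. partial_deriv 0 \<phi> (pt t))"
        using test_functionE[OF \<phi>] by metis
      define f where "f = (\<lambda>t. \<phi> (pt t))"
      define f' where "f' = (\<lambda>t. partial_deriv 0 \<phi> (pt t))"
      have f: "\<And>t. (f has_real_derivative f' t) (at t)" and f': "continuous_on UNIV f'"
        using K(5,6) by (auto simp: f_def f'_def)
      have fc: "continuous_on A f" for A
        using f by (intro continuous_at_imp_continuous_on ballI) (blast intro: DERIV_isCont)
      have f01: "f 0 = 0" "f 1 = 0"
        using K(2,3) by (force simp: f_def)+
      have "((\<lambda>t. G t * f t + U t * f' t) has_integral (U 1 * f 1 - U 0 * f 0)) {0..1}"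
      proof (rule fundamental_theorem_of_calculus_interior_strong[OF S])
        show "((\<lambda>t. U t * f t) has_vector_derivative G t * f t + U t * f' t) (at t)"
          if "t \<in> {0<..<1} - S" for t
          using DERIV_mult[OF G[OF that] f[of t]]
          by (simp add: has_real_derivative_iff_has_vector_derivative[symmetric] mult.commute add.commute)
        show "continuous_on {0..1} (\<lambda>t. U t * f t)"
          by (intro continuous_on_mult U fc)
      qed simp
      moreover have i1: "set_integrable lebesgue {0..1} (\<lambda>t. G t * f t)"
        by (rule set_integrable_bounded_mult[OF gI' fc K(1)]) (simp add: f_def K)
      moreover have i2: "set_integrable lebesgue {0..1} (\<lambda>t. U t * f' t)"
        by (rule set_integrable_bounded_mult[OF UI' f' K(1)]) (simp add: f'_def K)
      ultimately have "(LINT t:{0..1}|lebesgue. G t * f t + U t * f' t) = 0"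
        using f01 set_lebesgue_integral_eq_integral(2)[OF set_integral_add(1)[OF i1 i2]]
        by (simp add: integral_unique)
      then have "(LINT t:{0..1}|lebesgue. U t * f' t) = - (LINT t:{0..1}|lebesgue. G t * f t)"
        using set_integral_add(2)[OF i1 i2] by simp
      moreover have "(LINT t:punctured F|lebesgue. u (pt t) * f' t) = (LINT t:punctured F|lebesgue. U t * f' t)"
        unfolding set_lebesgue_integral_def using u
        by (intro Bochner_Integration.integral_cong) (auto split: split_indicator)
      ultimately show "(LINT t:punctured F|lebesgue. u (pt t) * partial_deriv 0 \<phi> (pt t)) =
       - (LINT t:punctured F|lebesgue. G (pt t 0) * \<phi> (pt t))"
        unfolding f_def[symmetric] f'_def[symmetric]
        by (simp add: set_integral_punctured(1)[OF F] f_def f'_def)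
    qed
  qed
  show "u \<in> W1p 1 p (pt ` punctured F)" if "1 < p"
    unfolding W1p_def using wg uL[of p] gL[of p] that by auto
  show "u \<in> W1p_loc 1 p (pt ` punctured F)" if "1 < p"
    unfolding W1p_loc_def using wg Lp_imp_Lp_loc[OF uL[of p] sets_punctured[OF F]]
      Lp_imp_Lp_loc[OF gL[of p] sets_punctured[OF F]] that by auto
qed

lemma test_function_weak_gradient:
  assumes F: "finite F" and \<phi>: "\<phi> \<in> test_functions 1 (pt ` punctured F)"
  shows "has_weak_gradient 1 (pt ` punctured F) \<phi> (\<lambda>x i. partial_deriv 0 \<phi> (pt (x 0)))"
    and "1 < p \<Longrightarrow> \<phi> \<in> W1p 1 p (pt ` punctured F)"
    and "set_integrable lebesgue (punctured F) (\<lambda>t. \<phi> (pt t))"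
    and "set_integrable lebesgue (punctured F) (\<lambda>t. partial_deriv 0 \<phi> (pt t))"
proof -
  obtain K where K: "\<And>t. ((\<lambda>t. \<phi> (pt t)) has_real_derivative partial_deriv 0 \<phi> (pt t)) (at t)"
    "continuous_on UNIV (\<lambda>t. partial_deriv 0 \<phi> (pt t))"
    using test_functionE[OF \<phi>] by metis
  have c: "continuous_on {0..1} (\<lambda>t. \<phi> (pt t))"
    using K(1) by (intro continuous_at_imp_continuous_on ballI) (blast intro: DERIV_isCont)
  have c': "continuous_on {0..1} (\<lambda>t. partial_deriv 0 \<phi> (pt t))"
    using K(2) by (rule continuous_on_subset) simp
  obtain C where C: "\<And>t. t \<in> {0..1} \<Longrightarrow> norm (partial_deriv 0 \<phi> (pt t)) \<le> C"
    using compact_imp_bounded[OF compact_continuous_image[OF c']] by (auto simp: bounded_iff simp del: atLeastAtMost_iff)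
  note r = piecewise_C1_weak_gradient[where S = "{}" and G = "\<lambda>t. partial_deriv 0 \<phi> (pt t)" and u = \<phi>
      and B = C, OF F _ c _ continuous_on_Icc_measurable[OF c']]
  show "has_weak_gradient 1 (pt ` punctured F) \<phi> (\<lambda>x i. partial_deriv 0 \<phi> (pt (x 0)))"
    by (rule r(1)) (use K C in auto)
  show "\<phi> \<in> W1p 1 p (pt ` punctured F)" if "1 < p"
    by (rule r(2)) (use K C that in auto)
  show "set_integrable lebesgue (punctured F) (\<lambda>t. \<phi> (pt t))"
    by (rule r(4)) (use K C in auto)
  show "set_integrable lebesgue (punctured F) (\<lambda>t. partial_deriv 0 \<phi> (pt t))"
    by (rule r(5)) (use K C in auto)
qed

lemma test_function_in_W1p_0:
  assumes F: "finite F" and p: "1 < p" and \<phi>: "\<phi> \<in> test_functions 1 (pt ` punctured F)"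
  shows "\<phi> \<in> W1p_0 1 p (pt ` punctured F)"
  unfolding W1p_0_def
proof (intro CollectI conjI exI allI)
  show "\<phi> \<in> W1p 1 p (pt ` punctured F)"
    by (rule test_function_weak_gradient(2)[OF F \<phi> p])
  show "\<phi> \<in> test_functions 1 (pt ` punctured F)" by (rule \<phi>)
  have "has_weak_gradient 1 (pt ` punctured F) (\<lambda>x. \<phi> x - \<phi> x) (\<lambda>x i. 0)"
    by (rule piecewise_C1_weak_gradient(1)[where S = "{}" and U = "\<lambda>_. 0" and B = 0, OF F]) auto
  then have "p_energy 1 p (pt ` punctured F) (\<lambda>x. \<phi> x - \<phi> x) (pt ` punctured F)
      = energy_on p (punctured F) (\<lambda>t. 0)"
    by (intro p_energy_pt[OF F]) (use sets_punctured[OF F] in \<open>auto simp: set_borel_measurable_def\<close>)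
  then show "(\<lambda>k. (\<integral>\<^sup>+x\<in>pt ` punctured F. ennreal (\<bar>\<phi> x - \<phi> x\<bar> powr p) \<partial>leb1)
      + p_energy 1 p (pt ` punctured F) (\<lambda>x. \<phi> x - \<phi> x) (pt ` punctured F)) \<longlonglongrightarrow> 0"
    by simp
qed

section \<open>Continuous representatives with zero boundary values\<close>

lemma set_integral_Ioo_eq:
  fixes h :: "real \<Rightarrow> real"
  assumes "integrable lebesgue h"
  shows "set_integrable lebesgue {a<..<b} h"
    and "(LINT t:{a<..<b}|lebesgue. h t) = integral {a..b} h"
    and "h integrable_on {a..b}"
proof -
  have i: "set_integrable lebesgue A h" if "A \<in> sets lebesgue" for A
    unfolding set_integrable_def using assms that by (rule integrable_mult_indicator[rotated])
  show "set_integrable lebesgue {a<..<b} h" by (rule i) simp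
  then show "(LINT t:{a<..<b}|lebesgue. h t) = integral {a..b} h"
    by (simp add: set_lebesgue_integral_eq_integral integral_open_interval_real)
  show "h integrable_on {a..b}"
    using i[of "{a..b}"] by (simp add: set_lebesgue_integral_eq_integral)
qed

lemma tendsto_zero_powr_cancel:
  fixes a :: "nat \<Rightarrow> real"
  assumes p: "0 < p" and c: "0 < c" and lim: "(\<lambda>k. ennreal (c * \<bar>a k\<bar> powr p)) \<longlonglongrightarrow> 0"
  shows "a \<longlonglongrightarrow> 0"
proof (rule LIMSEQ_I)
  fix e :: real assume e: "0 < e"
  have "0 < ennreal (c * e powr p)" using c e by simp
  with lim have "\<forall>\<^sub>F k in sequentially. ennreal (c * \<bar>a k\<bar> powr p) < ennreal (c * e powr p)"
    by (rule order_tendstoD)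
  then obtain N where N: "\<And>k. N \<le> k \<Longrightarrow> ennreal (c * \<bar>a k\<bar> powr p) < ennreal (c * e powr p)"
    by (auto simp: eventually_sequentially)
  have "norm (a k - 0) < e" if "N \<le> k" for k
  proof (rule ccontr)
    assume "\<not> norm (a k - 0) < e"
    then have "e powr p \<le> \<bar>a k\<bar> powr p" using e p by (intro powr_mono2) auto
    then have "ennreal (c * e powr p) \<le> ennreal (c * \<bar>a k\<bar> powr p)"
      using c by (intro ennreal_leI mult_left_mono) auto
    with N[OF that] show False by simp
  qed
  then show "\<exists>N. \<forall>k\<ge>N. norm (a k - 0) < e" by blast
qed

text \<open>
  Elements of \<open>W1p_0\<close> have a continuous representative that vanishes at \<open>0\<close>, at \<open>1\<close> and at the removed
  points: the primitive of their weak gradient. The approximating test functions vanish at these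
  points, and Jensen's inequality on the interval from \<open>0\<close> to \<open>t\<close> turns convergence of the derivatives in
  \<open>L^p\<close> into convergence of the values at \<open>t\<close>. Fatou's lemma identifies this limit with the limit in
  \<open>L^p\<close>.
\<close>

lemma W1p_0_primitive:
  assumes F: "finite F" and p: "1 < p" and \<phi>: "\<phi> \<in> W1p_0 1 p (pt ` punctured F)"
  obtains h where "integrable lebesgue h"
    "has_weak_gradient 1 (pt ` punctured F) \<phi> (\<lambda>x i. h (x 0))"
    "set_integrable lebesgue (punctured F) (\<lambda>t. \<phi> (pt t))"
    "AE t in lebesgue. t \<in> punctured F \<longrightarrow> \<phi> (pt t) = integral {0..t} h"
    "\<And>s. \<lbrakk>0 \<le> s; s \<le> 1; s \<notin> punctured F\<rbrakk> \<Longrightarrow> integral {0..s} h = 0"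
proof -
  let ?I = "punctured F"
  note I = sets_punctured[OF F]
  obtain g where \<phi>L: "\<phi> \<in> Lp 1 p (pt ` ?I)" and g: "has_weak_gradient 1 (pt ` ?I) \<phi> g"
    and gL: "(\<lambda>x. g x 0) \<in> Lp 1 p (pt ` ?I)"
    using \<phi> unfolding W1p_0_def W1p_def by (auto simp: less_one)
  obtain \<psi> where \<psi>: "\<And>k::nat. \<psi> k \<in> test_functions 1 (pt ` ?I)"
    and lim: "(\<lambda>k. (\<integral>\<^sup>+x\<in>pt ` ?I. ennreal (\<bar>\<psi> k x - \<phi> x\<bar> powr p) \<partial>leb1) +
            p_energy 1 p (pt ` ?I) (\<lambda>x. \<psi> k x - \<phi> x) (pt ` ?I)) \<longlonglongrightarrow> 0"
    using \<phi> unfolding W1p_0_def by blast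
  have \<phi>I: "set_integrable lebesgue ?I (\<lambda>t. \<phi> (pt t))"
    by (rule Lp_imp_integrable[OF \<phi>L lmeasurable_punctured[OF F] p])
  have gI: "set_integrable lebesgue ?I (\<lambda>t. g (pt t) 0)"
    using Lp_imp_integrable[OF gL lmeasurable_punctured[OF F] p] .
  define h where "h = (\<lambda>t. indicat_real ?I t *\<^sub>R g (pt t) 0)"
  have hI: "integrable lebesgue h" using gI unfolding h_def set_integrable_def .
  have hI': "set_integrable lebesgue ?I (\<lambda>t. h (pt t 0))"
    using hI I unfolding set_integrable_def pt_0 by (rule integrable_mult_indicator[rotated])
  have hw: "has_weak_gradient 1 (pt ` ?I) \<phi> (\<lambda>x i. h (x 0))"
  proof (subst has_weak_gradient_iff[OF F \<phi>I])
    show "set_integrable lebesgue ?I (\<lambda>t. h (pt t 0))" by (rule hI')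
    have "(LINT t:?I|lebesgue. h (pt t 0) * \<theta> (pt t)) = (LINT t:?I|lebesgue. g (pt t) 0 * \<theta> (pt t))" for \<theta>
      unfolding set_lebesgue_integral_def
      by (intro Bochner_Integration.integral_cong) (auto simp: h_def split: split_indicator)
    then show "\<forall>\<phi>'\<in>test_functions 1 (pt ` ?I). (LINT t:?I|lebesgue. \<phi> (pt t) * partial_deriv 0 \<phi>' (pt t))
        = - (LINT t:?I|lebesgue. h (pt t 0) * \<phi>' (pt t))"
      using g unfolding has_weak_gradient_iff[where u = \<phi> and g = g, OF F \<phi>I gI] by simp
  qed
  define d where "d = (\<lambda>k t. partial_deriv 0 (\<psi> k) (pt t))"
  obtain K where K: "\<And>k. K k \<subseteq> ?I" "\<And>k t. t \<notin> K k \<Longrightarrow> \<psi> k (pt t) = 0"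
    "\<And>k t. ((\<lambda>t. \<psi> k (pt t)) has_real_derivative d k t) (at t)" "\<And>k. continuous_on UNIV (d k)"
  proof -
    have "\<forall>k. \<exists>K\<subseteq>?I. (\<forall>t. t \<notin> K \<longrightarrow> \<psi> k (pt t) = 0) \<and>
      (\<forall>t. ((\<lambda>t. \<psi> k (pt t)) has_real_derivative d k t) (at t)) \<and> continuous_on UNIV (d k)"
      unfolding d_def by (metis test_functionE[OF \<psi>])
    then show ?thesis using that by metis
  qed
  have dI: "set_integrable lebesgue ?I (d k)" for k
    unfolding d_def by (rule test_function_weak_gradient(4)[OF F \<psi>])
  have energy: "p_energy 1 p (pt ` ?I) (\<lambda>x. \<psi> k x - \<phi> x) (pt ` ?I)
    = energy_on p ?I (\<lambda>t. d k t - h t)" for k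
  proof -
    have "has_weak_gradient 1 (pt ` ?I) (\<lambda>x. \<psi> k x + (- 1) * \<phi> x)
        (\<lambda>x i. d k (x 0) + (- 1) * h (x 0))"
    proof (rule has_weak_gradient_lincomb[where g = "\<lambda>x i. d k (x 0)" and h = "\<lambda>x i. h (x 0)", OF F _ _ \<phi>I hI' _ hw])
      show "set_integrable lebesgue ?I (\<lambda>t. d k (pt t 0))" using dI by simp
      show "has_weak_gradient 1 (pt ` ?I) (\<psi> k) (\<lambda>x i. d k (x 0))"
        "set_integrable lebesgue ?I (\<lambda>t. \<psi> k (pt t))"
        using test_function_weak_gradient(1,3)[OF F \<psi>, of k] by (simp_all add: d_def)
    qed
    then have w: "has_weak_gradient 1 (pt ` ?I) (\<lambda>x. \<psi> k x - \<phi> x) (\<lambda>x i. (\<lambda>t. d k t - h t) (x 0))"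
      by simp
    show ?thesis
    proof (rule p_energy_pt[OF F w])
      have "set_integrable lebesgue ?I (\<lambda>t. d k t - h t)"
        using dI hI' by (intro set_integral_diff) simp_all
      then show "set_borel_measurable lebesgue ?I (\<lambda>t. d k t - h t)"
        unfolding set_integrable_def set_borel_measurable_def by (rule borel_measurable_integrable)
    qed (use I in auto)
  qed
  have lim1: "(\<lambda>k. \<integral>\<^sup>+x\<in>pt ` ?I. ennreal (\<bar>\<psi> k x - \<phi> x\<bar> powr p) \<partial>leb1) \<longlonglongrightarrow> 0"
    by (rule tendsto_sandwich[OF _ _ tendsto_const lim]) (auto intro!: always_eventually)
  have lim2: "(\<lambda>k. \<integral>\<^sup>+t\<in>?I. ennreal (\<bar>d k t - h t\<bar> powr p) \<partial>lebesgue) \<longlonglongrightarrow> 0"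
    unfolding energy[symmetric]
    by (rule tendsto_sandwich[OF _ _ tendsto_const lim]) (auto intro!: always_eventually)
  have conv: "(\<lambda>k. \<psi> k (pt t)) \<longlonglongrightarrow> integral {0..t} h" if t: "0 \<le> t" "t \<le> 1" for t
  proof (cases "t = 0")
    case True
    have "\<psi> k (pt t) = 0" for k using K(1)[of k] True by (intro K(2)) auto
    then show ?thesis using True by simp
  next
    case False
    with t have t0: "0 < t" by simp
    have i: "set_integrable lebesgue {0<..<t} (\<lambda>s. d k s - h s)" for k
    proof (rule set_integral_diff)
      have "set_integrable lebesgue {0..t} (d k)"
        by (intro absolutely_integrable_continuous_real continuous_on_subset[OF K(4)]) simp
      then show "set_integrable lebesgue {0<..<t} (d k)"
        by (rule set_integrable_subset) auto
    qed (rule set_integral_Ioo_eq[OF hI])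
    have L: "(LINT s:{0<..<t}|lebesgue. d k s - h s) = \<psi> k (pt t) - integral {0..t} h" for k
    proof -
      have "(d k has_integral \<psi> k (pt t) - \<psi> k (pt 0)) {0..t}"
        using t0 K(3) by (intro fundamental_theorem_of_calculus)
          (auto simp: has_real_derivative_iff_has_vector_derivative[symmetric] intro: has_field_derivative_at_within)
      moreover have "\<psi> k (pt 0) = 0" using K(1)[of k] by (intro K(2)) auto
      ultimately have 1: "(d k has_integral \<psi> k (pt t)) {0..t}" by simp
      have "(h has_integral integral {0..t} h) {0..t}"
        using set_integral_Ioo_eq(3)[OF hI] by (rule integrable_integral)
      from has_integral_diff[OF 1 this]
      have "integral {0..t} (\<lambda>s. d k s - h s) = \<psi> k (pt t) - integral {0..t} h"
        by (rule integral_unique)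
      then show ?thesis
        unfolding set_lebesgue_integral_eq_integral(2)[OF i] integral_open_interval_real .
    qed
    have "ennreal (t * \<bar>(\<psi> k (pt t) - integral {0..t} h) / t\<bar> powr p)
      \<le> energy_on p ?I (\<lambda>t. d k t - h t)" for k
    proof -
      have "ennreal (t * \<bar>(\<psi> k (pt t) - integral {0..t} h) / t\<bar> powr p)
        \<le> energy_on p {0<..<t} (\<lambda>s. d k s - h s)"
        using Jensen_powr_Ioo[OF p t0 i, of k] unfolding L by simp
      also have "\<dots> \<le> energy_on p ?I (\<lambda>s. d k s - h s)"
        by (rule nn_integral_mono_AE)
          (use AE_not_in_finite[OF F] t in \<open>auto split: split_indicator\<close>)
      finally show ?thesis .
    qed
    then have "(\<lambda>k. ennreal (t * \<bar>(\<psi> k (pt t) - integral {0..t} h) / t\<bar> powr p)) \<longlonglongrightarrow> 0"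
      by (intro tendsto_sandwich[OF _ _ tendsto_const lim2]) (auto intro!: always_eventually)
    then have "(\<lambda>k. (\<psi> k (pt t) - integral {0..t} h) / t) \<longlonglongrightarrow> 0"
      using p t0 by (intro tendsto_zero_powr_cancel[where p = p and c = t]) auto
    then have "(\<lambda>k. (\<psi> k (pt t) - integral {0..t} h) / t * t + integral {0..t} h) \<longlonglongrightarrow> 0 * t + integral {0..t} h"
      by (intro tendsto_intros)
    then show ?thesis using t0 by simp
  qed
  have z: "integral {0..s} h = 0" if "0 \<le> s" "s \<le> 1" "s \<notin> ?I" for s
  proof -
    have "\<psi> k (pt s) = 0" for k using K(1)[of k] that(3) by (intro K(2)) auto
    with conv[OF that(1,2)] show ?thesis by (simp add: LIMSEQ_const_iff)
  qed
  have ae: "AE t in lebesgue. t \<in> ?I \<longrightarrow> \<phi> (pt t) = integral {0..t} h"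
  proof -
    define M where "M = (\<lambda>k t. ennreal (\<bar>\<psi> k (pt t) - \<phi> (pt t)\<bar> powr p) * indicator ?I t)"
    define M' where "M' = (\<lambda>t. ennreal (\<bar>integral {0..t} h - \<phi> (pt t)\<bar> powr p) * indicator ?I t)"
    have m: "set_borel_measurable lebesgue ?I (\<lambda>t. \<psi> k (pt t) - \<phi> (pt t))" for k
    proof -
      have "set_integrable lebesgue ?I (\<lambda>t. \<psi> k (pt t) - \<phi> (pt t))"
        by (intro set_integral_diff test_function_weak_gradient(3)[OF F \<psi>] \<phi>I)
      then show ?thesis
        unfolding set_integrable_def set_borel_measurable_def by (rule borel_measurable_integrable)
    qed
    have Mm: "M k \<in> borel_measurable lebesgue" for k
    proof -
      have "(\<lambda>t. ennreal (\<bar>indicat_real ?I t *\<^sub>R (\<psi> k (pt t) - \<phi> (pt t))\<bar> powr p) * indicator ?I t) \<in> borel_measurable lebesgue"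
        using m[of k] I unfolding set_borel_measurable_def by measurable
      also have "(\<lambda>t. ennreal (\<bar>indicat_real ?I t *\<^sub>R (\<psi> k (pt t) - \<phi> (pt t))\<bar> powr p) * indicator ?I t) = M k"
        by (auto simp: M_def fun_eq_iff split: split_indicator)
      finally show ?thesis .
    qed
    have MM': "(\<lambda>k. M k t) \<longlonglongrightarrow> M' t" for t
    proof (cases "t \<in> ?I")
      case True
      then have "(\<lambda>k. \<psi> k (pt t)) \<longlonglongrightarrow> integral {0..t} h" by (intro conv) auto
      then have "(\<lambda>k. ennreal (\<bar>\<psi> k (pt t) - \<phi> (pt t)\<bar> powr p)) \<longlonglongrightarrow> ennreal (\<bar>integral {0..t} h - \<phi> (pt t)\<bar> powr p)"
        using p by (intro tendsto_intros tendsto_ennrealI) auto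
      then show ?thesis using True by (simp add: M_def M'_def)
    qed (simp add: M_def M'_def)
    have M'm: "M' \<in> borel_measurable lebesgue"
      by (rule borel_measurable_LIMSEQ_order[where u = M]) (auto intro: Mm MM')
    have "integral\<^sup>N lebesgue M' = (\<integral>\<^sup>+t. liminf (\<lambda>k. M k t) \<partial>lebesgue)"
      using lim_imp_Liminf[OF _ MM'] by (intro nn_integral_cong) simp
    also have "\<dots> \<le> liminf (\<lambda>k. integral\<^sup>N lebesgue (M k))"
      by (rule nn_integral_liminf) (rule Mm)
    also have "\<dots> = 0"
    proof (rule lim_imp_Liminf)
      have "integral\<^sup>N lebesgue (M k) = (\<integral>\<^sup>+x\<in>pt ` ?I. ennreal (\<bar>\<psi> k x - \<phi> x\<bar> powr p) \<partial>leb1)" for k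
        using set_nn_integral_pt[OF I m, of k p] by (simp add: M_def)
      then show "(\<lambda>k. integral\<^sup>N lebesgue (M k)) \<longlonglongrightarrow> 0" using lim1 by simp
    qed simp
    finally have "integral\<^sup>N lebesgue M' = 0" by simp
    then have "AE t in lebesgue. M' t = 0" by (simp add: nn_integral_0_iff_AE[OF M'm])
    then show ?thesis
      by eventually_elim (auto simp: M'_def split: if_splits)
  qed
  show ?thesis by (rule that[OF hI hw \<phi>I ae z])
qed

section \<open>Comparison of energies interval by interval\<close>

text \<open>
  The end points lie outside \<open>U\<close>, for otherwise they could be added to the component.
\<close>

lemma component_open_real:
  fixes U :: "real set"
  assumes U: "open U" "U \<subseteq> {a<..<b}" and C: "C \<in> components U"
  obtains l r where "C = {l<..<r}" "l < r" "l \<notin> U" "r \<notin> U"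
proof
  have ne: "C \<noteq> {}" and sub: "C \<subseteq> U" and conn: "connected C" and op: "open C"
    using C U(1) by (auto dest: in_components_nonempty in_components_subset in_components_connected open_components)
  have bd: "bdd_above C" "bdd_below C"
    using sub U(2) by (auto intro!: bdd_aboveI[of _ b] bdd_belowI[of _ a] dest!: subsetD less_imp_le)
  show eq: "C = {Inf C<..<Sup C}"
  proof (intro equalityI subsetI)
    fix x assume x: "x \<in> C"
    obtain e where e: "0 < e" "cball x e \<subseteq> C" using op x open_contains_cball by blast
    then have "x - e \<in> C" "x + e \<in> C" by (auto simp: dist_real_def)
    then have "Inf C \<le> x - e" "x + e \<le> Sup C"
      using bd by (auto intro: cInf_lower cSup_upper)
    then show "x \<in> {Inf C<..<Sup C}" using e(1) by simp
  next
    fix x assume "x \<in> {Inf C<..<Sup C}"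
    then obtain y z where "y \<in> C" "y < x" "z \<in> C" "x < z"
      using cInf_lessD[OF ne] less_cSupD[OF ne] by (metis greaterThanLessThan_iff)
    then show "x \<in> C" using connectedD_interval[OF conn, of y z x] by simp
  qed
  show lr: "Inf C < Sup C" using eq ne by (metis greaterThanLessThan_empty_iff not_le)
  have not: "x \<notin> U" if x: "x \<notin> C" and c: "connected (insert x C)" for x
  proof
    assume "x \<in> U"
    then have "insert x C \<subseteq> C"
      using components_maximal[OF C c] sub ne by auto
    with x show False by blast
  qed
  define l r where "l = Inf C" and "r = Sup C"
  have C_eq: "C = {l<..<r}" unfolding l_def r_def by (rule eq)
  have "l < r" using lr by (simp add: l_def r_def)
  then have "insert l C = {l..<r}" "insert r C = {l<..r}"
    unfolding C_eq by auto
  moreover have "l \<notin> C" "r \<notin> C" unfolding C_eq by auto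
  ultimately have "l \<notin> U" "r \<notin> U"
    using not[of l] not[of r] by simp_all
  then show "Inf C \<notin> U" "Sup C \<notin> U" by (simp_all add: l_def r_def)
qed

text \<open>
  An open set is the disjoint union of its countably many components, so integrals over it are sums of
  integrals over intervals.
\<close>

lemma nn_integral_le_on_components:
  fixes f g :: "real \<Rightarrow> ennreal"
  assumes U: "open U" "U \<subseteq> {a<..<b}"
    and f: "(\<lambda>t. f t * indicator U t) \<in> borel_measurable lebesgue"
    and g: "(\<lambda>t. g t * indicator U t) \<in> borel_measurable lebesgue"
    and le: "\<And>l r. \<lbrakk>l < r; {l<..<r} \<subseteq> U; l \<notin> U; r \<notin> U\<rbrakk>
      \<Longrightarrow> (\<integral>\<^sup>+t\<in>{l<..<r}. f t \<partial>lebesgue) \<le> c * (\<integral>\<^sup>+t\<in>{l<..<r}. g t \<partial>lebesgue)"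
  shows "(\<integral>\<^sup>+t\<in>U. f t \<partial>lebesgue) \<le> c * (\<integral>\<^sup>+t\<in>U. g t \<partial>lebesgue)"
proof -
  have cnt: "countable (components U)"
    by (rule countable_disjoint_open_subsets)
      (use U pairwise_disjoint_components[of U] in \<open>auto simp: pairwise_def disjnt_def intro: open_components\<close>)
  have sum: "(\<integral>\<^sup>+t\<in>U. k t \<partial>lebesgue) = (\<integral>\<^sup>+C. (\<integral>\<^sup>+t\<in>C. k t \<partial>lebesgue) \<partial>count_space (components U))"
    if k: "(\<lambda>t. k t * indicator U t) \<in> borel_measurable lebesgue" for k
  proof -
    let ?D = "density lebesgue (\<lambda>t. k t * indicator U t)"
    have e: "emeasure ?D S = (\<integral>\<^sup>+t\<in>S. k t \<partial>lebesgue)" if "open S" "S \<subseteq> U" for S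
    proof -
      have "emeasure ?D S = (\<integral>\<^sup>+t\<in>S. k t * indicator U t \<partial>lebesgue)"
        using k that(1) by (intro emeasure_density) auto
      also have "\<dots> = (\<integral>\<^sup>+t\<in>S. k t \<partial>lebesgue)"
        using that(2) by (intro nn_integral_cong) (auto split: split_indicator)
      finally show ?thesis .
    qed
    have op: "open C" "C \<subseteq> U" if "C \<in> components U" for C
      using that U(1) by (auto dest: in_components_subset open_components)
    have "emeasure ?D (\<Union>((\<lambda>C. C) ` components U)) = (\<integral>\<^sup>+C. emeasure ?D C \<partial>count_space (components U))"
      using op(1) pairwise_disjoint_components[of U]
      by (intro emeasure_UN_countable cnt) (auto simp: disjoint_family_on_def pairwise_def)
    also have "\<dots> = (\<integral>\<^sup>+C. (\<integral>\<^sup>+t\<in>C. k t \<partial>lebesgue) \<partial>count_space (components U))"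
      by (intro nn_integral_cong) (simp add: e op)
    finally show ?thesis using e[OF U(1)] by simp
  qed
  have "(\<integral>\<^sup>+C. (\<integral>\<^sup>+t\<in>C. f t \<partial>lebesgue) \<partial>count_space (components U))
    \<le> (\<integral>\<^sup>+C. c * (\<integral>\<^sup>+t\<in>C. g t \<partial>lebesgue) \<partial>count_space (components U))"
  proof (rule nn_integral_mono)
    fix C assume "C \<in> space (count_space (components U))"
    then have C: "C \<in> components U" by simp
    obtain l r where "C = {l<..<r}" "l < r" "l \<notin> U" "r \<notin> U"
      using component_open_real[OF U C] .
    then show "(\<integral>\<^sup>+t\<in>C. f t \<partial>lebesgue) \<le> c * (\<integral>\<^sup>+t\<in>C. g t \<partial>lebesgue)"
      using le[of l r] in_components_subset[OF C] by simp
  qed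
  also have "\<dots> = c * (\<integral>\<^sup>+C. (\<integral>\<^sup>+t\<in>C. g t \<partial>lebesgue) \<partial>count_space (components U))"
    by (rule nn_integral_cmult) simp
  finally show ?thesis unfolding sum[OF f] sum[OF g] .
qed

text \<open>
  The reduction to intervals on which all quasiminimizing properties rest. The set where the
  continuous representative of \<open>\<phi>\<close> is nonzero is open, and \<open>\<phi>\<close> vanishes at the end points of each of its
  components \<open>{l<..<r}\<close>. There the competitor has derivative \<open>G + h\<close> with \<open>integral {l..r} h = 0\<close>; if
  \<open>\<phi> \<ge> 0\<close>, which is expressed by the flag \<open>pos\<close>, the primitive \<open>integral {l..t} h\<close> of \<open>h\<close> is nonnegative as
  well.
\<close>

lemma p_energy_le_from_intervals:
  assumes F: "finite F" and p: "1 < p"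
    and wg: "has_weak_gradient 1 (pt ` punctured F) u (\<lambda>x i. G (x 0))"
    and uI: "set_integrable lebesgue (punctured F) (\<lambda>t. u (pt t))"
    and GI: "set_integrable lebesgue (punctured F) G"
    and \<phi>: "\<phi> \<in> W1p_0 1 p (pt ` punctured F)"
    and pos: "pos \<Longrightarrow> AE x in leb1. x \<in> pt ` punctured F \<longrightarrow> 0 \<le> \<phi> x"
    and step: "\<And>h l r. \<lbrakk>integrable lebesgue h; 0 \<le> l; l < r; r \<le> 1; {l<..<r} \<subseteq> punctured F;
       integral {l..r} h = 0; \<And>t. \<lbrakk>pos; l < t; t < r\<rbrakk> \<Longrightarrow> 0 \<le> integral {l..t} h\<rbrakk>
      \<Longrightarrow> energy_on p {l<..<r} G
        \<le> c * energy_on p {l<..<r} (\<lambda>t. G t + h t)"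
  shows "p_energy 1 p (pt ` punctured F) u {x \<in> pt ` punctured F. \<phi> x \<noteq> 0}
    \<le> c * p_energy 1 p (pt ` punctured F) (\<lambda>x. u x + \<phi> x) {x \<in> pt ` punctured F. \<phi> x \<noteq> 0}"
proof -
  let ?I = "punctured F"
  note I = sets_punctured[OF F]
  obtain h where h: "integrable lebesgue h"
    "has_weak_gradient 1 (pt ` ?I) \<phi> (\<lambda>x i. h (x 0))"
    "set_integrable lebesgue ?I (\<lambda>t. \<phi> (pt t))"
    "AE t in lebesgue. t \<in> ?I \<longrightarrow> \<phi> (pt t) = integral {0..t} h"
    and h0: "\<And>s. \<lbrakk>0 \<le> s; s \<le> 1; s \<notin> ?I\<rbrakk> \<Longrightarrow> integral {0..s} h = 0"
    by (rule W1p_0_primitive[OF F p \<phi>]) blast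
  define \<Phi> where "\<Phi> = (\<lambda>t. integral {0..t} h)"
  have hint: "h integrable_on {a..b}" for a b by (rule set_integral_Ioo_eq(3)[OF h(1)])
  have cont: "continuous_on {0..1} \<Phi>"
    unfolding \<Phi>_def by (rule indefinite_integral_continuous_1[OF hint])
  define T where "T = {0<..<1} \<inter> \<Phi> -` (- {0})"
  have opT: "open T"
    unfolding T_def by (rule continuous_open_preimage[OF continuous_on_subset[OF cont]]) auto
  have TI: "T \<subseteq> ?I" using h0 by (auto simp: T_def \<Phi>_def)
  have Tsets: "T \<in> sets lebesgue" using opT by auto
  let ?A = "{x \<in> pt ` ?I. \<phi> x \<noteq> 0}"
  have AT: "AE t in lebesgue. pt t \<in> ?A \<longleftrightarrow> t \<in> T"
    using h(4) TI by (auto simp: T_def \<Phi>_def elim!: eventually_mono)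
  have hI: "set_integrable lebesgue ?I h"
    unfolding set_integrable_def using h(1) I by (rule integrable_mult_indicator[rotated])
  have mT: "set_borel_measurable lebesgue T k" if "set_integrable lebesgue ?I k" for k :: "real \<Rightarrow> real"
    using set_integrable_subset[OF that Tsets TI]
    unfolding set_integrable_def set_borel_measurable_def by (rule borel_measurable_integrable)
  have GhI: "set_integrable lebesgue ?I (\<lambda>t. G t + h t)" using GI hI by (rule set_integral_add)
  have e1: "p_energy 1 p (pt ` ?I) u ?A = energy_on p T G"
    by (rule p_energy_pt[OF F wg _ AT mT[OF GI] Tsets]) auto
  have "has_weak_gradient 1 (pt ` ?I) (\<lambda>x. u x + 1 * \<phi> x) (\<lambda>x i. G (x 0) + 1 * h (x 0))"
    by (rule has_weak_gradient_lincomb[where g = "\<lambda>x i. G (x 0)" and h = "\<lambda>x i. h (x 0)", OF F uI _ h(3) _ wg h(2)])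
      (use GI hI in simp_all)
  then have wg': "has_weak_gradient 1 (pt ` ?I) (\<lambda>x. u x + \<phi> x) (\<lambda>x i. (\<lambda>t. G t + h t) (x 0))" by simp
  have e2: "p_energy 1 p (pt ` ?I) (\<lambda>x. u x + \<phi> x) ?A = energy_on p T (\<lambda>t. G t + h t)"
    by (rule p_energy_pt[OF F wg' _ AT mT[OF GhI] Tsets]) auto
  have pw: "(\<lambda>t. ennreal (\<bar>k t\<bar> powr p) * indicator T t) \<in> borel_measurable lebesgue"
    if "set_integrable lebesgue ?I k" for k :: "real \<Rightarrow> real"
  proof -
    have "(\<lambda>t. ennreal (\<bar>indicator T t *\<^sub>R k t\<bar> powr p) * indicator T t) \<in> borel_measurable lebesgue"
      using mT[OF that] Tsets unfolding set_borel_measurable_def by measurable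
    also have "(\<lambda>t. ennreal (\<bar>indicator T t *\<^sub>R k t\<bar> powr p) * indicator T t)
      = (\<lambda>t. ennreal (\<bar>k t\<bar> powr p) * indicator T t)"
      by (auto simp: fun_eq_iff split: split_indicator)
    finally show ?thesis .
  qed
  \<comment> \<open>A continuous function that is nonnegative almost everywhere is nonnegative, as a nonempty open
    set is not negligible.\<close>
  have nonneg: "0 \<le> \<Phi> t" if "pos" and t: "t \<in> {0<..<1}" for t
  proof (rule ccontr)
    assume neg: "\<not> 0 \<le> \<Phi> t"
    have "open ({0<..<1} \<inter> \<Phi> -` {..<0})"
      by (rule continuous_open_preimage[OF continuous_on_subset[OF cont]]) auto
    then obtain e where e: "0 < e" "ball t e \<subseteq> {0<..<1} \<inter> \<Phi> -` {..<0}"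
      using neg t by (auto elim!: openE)
    have "AE s in lebesgue. s \<in> ?I \<longrightarrow> 0 \<le> \<Phi> s"
      using pos[OF \<open>pos\<close>] h(4) unfolding AE_leb1_iff by eventually_elim (simp add: \<Phi>_def)
    then have "AE s in lebesgue. s \<notin> ball t e"
      using AE_not_in_finite[OF F]
    proof eventually_elim
      fix s assume "s \<in> ?I \<longrightarrow> 0 \<le> \<Phi> s" "s \<notin> F"
      then show "s \<notin> ball t e" using e(2) by (auto simp del: mem_ball dest: subsetD)
    qed
    then have "ball t e \<in> null_sets lebesgue"
      by (subst AE_iff_null_sets) auto
    then have "negligible (ball t e)" by (simp add: negligible_iff_null_sets)
    then show False using e(1) negligible_iff_measure0 open_not_negligible[of "ball t e"] by auto
  qed
  show ?thesis
    unfolding e1 e2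
  proof (rule nn_integral_le_on_components[OF opT _ pw[OF GI] pw[OF GhI]])
    show "T \<subseteq> {0<..<1}" by (auto simp: T_def)
    fix l r assume lr: "l < r" "{l<..<r} \<subseteq> T" "l \<notin> T" "r \<notin> T"
    have "{l<..<r} \<subseteq> {0<..<1}" using lr(2) by (auto simp: T_def)
    then have lr01: "0 \<le> l" "r \<le> 1" using lr(1) by (simp_all add: greaterThanLessThan_subseteq_greaterThanLessThan)
    have l0: "\<Phi> l = 0"
      using lr lr01 h0[of 0] by (cases "l = 0") (auto simp: T_def \<Phi>_def)
    have r0: "\<Phi> r = 0"
      using lr lr01 h0[of 1] by (cases "r = 1") (auto simp: T_def \<Phi>_def)
    have diff: "integral {l..t} h = \<Phi> t" if "l \<le> t" for t
      using Henstock_Kurzweil_Integration.integral_combine[OF lr01(1) that hint] l0 by (simp add: \<Phi>_def)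
    show "energy_on p {l<..<r} G
      \<le> c * energy_on p {l<..<r} (\<lambda>t. G t + h t)"
    proof (rule step[OF h(1) lr01(1) lr(1) lr01(2)])
      show "{l<..<r} \<subseteq> ?I" using lr(2) TI by blast
      show "integral {l..r} h = 0" using diff[of r] r0 lr(1) by simp
      show "0 \<le> integral {l..t} h" if "pos" "l < t" "t < r" for t
        using nonneg[OF that(1), of t] diff[of t] that lr01 by simp
    qed
  qed
qed

section \<open>Kinks and hats\<close>

text \<open>
  The broken line with slope \<open>\<tau>\<close> before \<open>s\<close> and slope \<open>1\<close> after, zero at \<open>s\<close>. For \<open>\<tau> \<le> 1\<close> it is convex, and
  writing it as a maximum makes its continuity evident.
\<close>

definition kink :: "real \<Rightarrow> real \<Rightarrow> real \<Rightarrow> real" where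
  "kink \<tau> s t = max (\<tau> * (t - s)) (t - s)"

definition kink_slope :: "real \<Rightarrow> real \<Rightarrow> real \<Rightarrow> real" where
  "kink_slope \<tau> s t = (if t < s then \<tau> else 1)"

lemma kink_eq: "\<tau> \<le> 1 \<Longrightarrow> kink \<tau> s t = (if t \<le> s then \<tau> * (t - s) else t - s)"
proof -
  assume \<tau>: "\<tau> \<le> 1"
  show ?thesis
  proof (cases "t \<le> s")
    case True
    then have "1 * (t - s) \<le> \<tau> * (t - s)" using \<tau> by (intro mult_right_mono_neg) auto
    then show ?thesis using True by (simp add: kink_def)
  next
    case False
    then have "\<tau> * (t - s) \<le> 1 * (t - s)" using \<tau> by (intro mult_right_mono) auto
    then show ?thesis using False by (simp add: kink_def)
  qed
qed

text \<open>
  Clipping the position of the kink to the interval treats intervals that contain it and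
  intervals on which the function is linear together.
\<close>

lemma kink_diff_clip:
  assumes "l \<le> r" "\<tau> \<le> 1"
  shows "kink \<tau> s r - kink \<tau> s l = \<tau> * (max l (min s r) - l) + (r - max l (min s r))"
  using assms(1) by (auto simp: kink_eq[OF assms(2)] max_def min_def algebra_simps)

lemma kink_slope_energy:
  assumes lr: "l \<le> r" and \<tau>: "0 \<le> \<tau>" "\<tau> \<le> 1" and k: "0 \<le> k"
  shows "energy_on p {l<..<r} (\<lambda>t. k * kink_slope \<tau> s t)
    = ennreal (k powr p * (\<tau> powr p * (max l (min s r) - l) + (r - max l (min s r))))"
proof -
  define s' where "s' = max l (min s r)"
  have s': "l \<le> s'" "s' \<le> r" using lr by (auto simp: s'_def)
  have "energy_on p {l<..<r} (\<lambda>t. k * kink_slope \<tau> s t)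
    = (\<integral>\<^sup>+t. ennreal ((k * \<tau>) powr p) * indicator {l<..<s'} t + ennreal (k powr p) * indicator {s'<..<r} t \<partial>lebesgue)"
    by (rule nn_integral_cong_AE)
      (use AE_not_in_finite[of "{s', s}"] s' \<tau> k in
        \<open>auto simp: kink_slope_def s'_def abs_mult split: split_indicator elim!: eventually_mono\<close>)
  also have "\<dots> = ennreal ((k * \<tau>) powr p) * emeasure lebesgue {l<..<s'} + ennreal (k powr p) * emeasure lebesgue {s'<..<r}"
  proof -
    have m: "{l<..<s'} \<in> sets lebesgue" "{s'<..<r} \<in> sets lebesgue" by simp_all
    show ?thesis
      unfolding nn_integral_cmult_indicator[OF m(1), symmetric] nn_integral_cmult_indicator[OF m(2), symmetric]
      by (intro nn_integral_add borel_measurable_times_ennreal borel_measurable_const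
          borel_measurable_indicator m)
  qed
  also have "\<dots> = ennreal ((k * \<tau>) powr p * (s' - l) + k powr p * (r - s'))"
    using s' by (simp add: ennreal_mult' ennreal_plus)
  also have "(k * \<tau>) powr p * (s' - l) + k powr p * (r - s') = k powr p * (\<tau> powr p * (s' - l) + (r - s'))"
    using k \<tau> by (simp add: powr_mult algebra_simps)
  finally show ?thesis unfolding s'_def .
qed

lemma kink_energy_le_chord:
  assumes lr: "l < r" and \<tau>: "0 \<le> \<tau>" "\<tau> \<le> 1" and k: "0 \<le> k"
    and hyp: "\<And>b. \<lbrakk>0 \<le> b; b \<le> 1\<rbrakk> \<Longrightarrow> \<tau> powr p * (1 - b) + b \<le> Q * (\<tau> * (1 - b) + b) powr p"
  shows "energy_on p {l<..<r} (\<lambda>t. k * kink_slope \<tau> s t)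
    \<le> ennreal (Q * ((r - l) * (k * (kink \<tau> s r - kink \<tau> s l) / (r - l)) powr p))"
proof -
  define s' where "s' = max l (min s r)"
  have s': "0 \<le> s' - l" "0 \<le> r - s'" using lr by (auto simp: s'_def)
  show ?thesis
    unfolding kink_slope_energy[OF less_imp_le[OF lr] \<tau> k] kink_diff_clip[OF less_imp_le[OF lr] \<tau>(2)] s'_def[symmetric]
    using kink_inequality[OF hyp s' _ k \<tau>(1)] lr by (intro ennreal_leI) simp
qed

text \<open>
  The quasiminimizing property of a kink on one interval: its energy is at most \<open>Q\<close> times that of
  the chord, and every competitor with the same boundary values has at least the energy of the chord.
\<close>

lemma kink_energy_minimizing:
  assumes p: "1 < p" and Q: "1 \<le> Q" and lr: "l < r" and \<tau>: "0 \<le> \<tau>" "\<tau> \<le> 1" and k: "0 \<le> k"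
    and hyp: "\<And>b. \<lbrakk>0 \<le> b; b \<le> 1\<rbrakk> \<Longrightarrow> \<tau> powr p * (1 - b) + b \<le> Q * (\<tau> * (1 - b) + b) powr p"
    and w: "set_integrable lebesgue {l<..<r} w"
    and eq: "(LINT t:{l<..<r}|lebesgue. w t) = k * (kink \<tau> s r - kink \<tau> s l)"
  shows "energy_on p {l<..<r} (\<lambda>t. k * kink_slope \<tau> s t)
    \<le> ennreal Q * energy_on p {l<..<r} w"
proof -
  have "kink \<tau> s l \<le> kink \<tau> s r"
    using lr \<tau> unfolding kink_def by (intro max.mono mult_left_mono) auto
  then have n: "0 \<le> k * (kink \<tau> s r - kink \<tau> s l) / (r - l)" using lr k by simp
  have "energy_on p {l<..<r} (\<lambda>t. k * kink_slope \<tau> s t)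
    \<le> ennreal (Q * ((r - l) * (k * (kink \<tau> s r - kink \<tau> s l) / (r - l)) powr p))"
    by (rule kink_energy_le_chord[OF lr \<tau> k hyp])
  also have "\<dots> = ennreal Q * ennreal ((r - l) * (k * (kink \<tau> s r - kink \<tau> s l) / (r - l)) powr p)"
    using Q by (simp add: ennreal_mult')
  also have "\<dots> \<le> ennreal Q * energy_on p {l<..<r} w"
    using Jensen_powr_Ioo[OF p lr w] unfolding eq abs_of_nonneg[OF n] by (intro mult_left_mono) auto
  finally show ?thesis .
qed

lemma kink_continuous [continuous_intros]: "continuous_on A (kink \<tau> s)"
  unfolding kink_def[abs_def] by (intro continuous_intros)

lemma kink_DERIV:
  assumes \<tau>: "\<tau> \<le> 1" and t: "t \<noteq> s"
  shows "(kink \<tau> s has_real_derivative kink_slope \<tau> s t) (at t)"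
proof (cases "t < s")
  case True
  have "((\<lambda>t. \<tau> * (t - s)) has_real_derivative \<tau>) (at t)" by (auto intro!: derivative_eq_intros)
  then have "(kink \<tau> s has_real_derivative \<tau>) (at t)"
    by (rule has_field_derivative_transform_within_open[where S = "{..<s}"])
      (use True \<tau> in \<open>auto simp: kink_eq\<close>)
  then show ?thesis using True by (simp add: kink_slope_def)
next
  case False
  have "((\<lambda>t. t - s) has_real_derivative 1) (at t)" by (auto intro!: derivative_eq_intros)
  then have "(kink \<tau> s has_real_derivative 1) (at t)"
    by (rule has_field_derivative_transform_within_open[where S = "{s<..}"])
      (use False t \<tau> in \<open>auto simp: kink_eq\<close>)
  then show ?thesis using False by (simp add: kink_slope_def)
qed

lemma kink_slope_measurable [measurable]: "kink_slope \<tau> s \<in> borel_measurable borel"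
  unfolding kink_slope_def[abs_def] by measurable

text \<open>
  Smooth approximations of the piecewise linear hat of height \<open>H\<close> with base from \<open>x\<close> to \<open>z\<close> and peak at \<open>y\<close>,
  as differences of two smooth steps. They are nonnegative because the first step is completed before
  the second one starts.
\<close>

lemma smooth_hats:
  fixes x y z H :: real
  assumes xyz: "x < y" "y < z" and H: "0 \<le> H"
  obtains f f' :: "nat \<Rightarrow> real \<Rightarrow> real" and \<delta> :: "nat \<Rightarrow> real" and B :: real where
    "\<And>n k. times_diff k (f n)"
    "\<And>n t. (f n has_real_derivative f' n t) (at t)"
    "\<And>n t. 0 \<le> f n t" "\<And>n t. \<bar>f' n t\<bar> \<le> B"
    "\<And>n. 0 < \<delta> n"
    "\<And>n t. t \<le> x + \<delta> n \<or> z - \<delta> n \<le> t \<Longrightarrow> f n t = 0"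
    "\<And>t. (\<lambda>n. f' n t) \<longlonglongrightarrow> H / (y - x) * indicator {x<..<y} t - H / (z - y) * indicator {y<..<z} t"
    "\<And>t. \<lbrakk>0 < H; x < t; t < z\<rbrakk> \<Longrightarrow> \<forall>\<^sub>F n in sequentially. 0 < f n t"
proof -
  obtain R r \<rho> A where R: "\<And>n k. times_diff k (R n)"
    "\<And>n t. (R n has_real_derivative r n t) (at t)"
    "\<And>n t. 0 \<le> r n t" "\<And>n t. r n t \<le> A" "\<And>n. 0 < \<rho> n"
    "\<And>n t. t \<le> x + \<rho> n \<Longrightarrow> R n t = 0" "\<And>n t. y - \<rho> n \<le> t \<Longrightarrow> R n t = 1"
    "\<And>t. (\<lambda>n. r n t) \<longlonglongrightarrow> indicator {x<..<y} t / (y - x)"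
    "\<And>t. \<lbrakk>x \<le> t; t \<le> y\<rbrakk> \<Longrightarrow> (\<lambda>n. R n t) \<longlonglongrightarrow> (t - x) / (y - x)"
    by (rule smooth_steps[OF xyz(1)]) blast
  obtain S s \<sigma> B where S: "\<And>n k. times_diff k (S n)"
    "\<And>n t. (S n has_real_derivative s n t) (at t)"
    "\<And>n t. 0 \<le> s n t" "\<And>n t. s n t \<le> B" "\<And>n. 0 < \<sigma> n"
    "\<And>n t. t \<le> y + \<sigma> n \<Longrightarrow> S n t = 0" "\<And>n t. z - \<sigma> n \<le> t \<Longrightarrow> S n t = 1"
    "\<And>t. (\<lambda>n. s n t) \<longlonglongrightarrow> indicator {y<..<z} t / (z - y)"
    "\<And>t. \<lbrakk>y \<le> t; t \<le> z\<rbrakk> \<Longrightarrow> (\<lambda>n. S n t) \<longlonglongrightarrow> (t - y) / (z - y)"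
    by (rule smooth_steps[OF xyz(2)]) blast
  have Ry: "R n t = 1" if "y \<le> t" for n t using R(5)[of n] that by (intro R(7)) linarith
  have Sy: "S n t = 0" if "t \<le> y" for n t using S(5)[of n] that by (intro S(6)) linarith
  have mono: "f a \<le> f b" if "a \<le> b" "\<And>t. (f has_real_derivative g t) (at t)" "\<And>t. 0 \<le> g t" for f g :: "real \<Rightarrow> real" and a b
  proof (rule DERIV_nonneg_imp_nondecreasing[OF that(1)])
    fix t
    show "\<exists>d. (f has_real_derivative d) (at t) \<and> 0 \<le> d"
      using that(2)[of t] that(3)[of t] by blast
  qed
  have R0: "0 \<le> R n t" for n t
  proof -
    have "R n (min t x) \<le> R n t" by (rule mono[OF _ R(2,3)]) simp
    moreover have "R n (min t x) = 0" using R(5)[of n] by (intro R(6)) linarith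
    ultimately show ?thesis by simp
  qed
  have S1: "S n t \<le> 1" for n t
  proof -
    have "S n t \<le> S n (max t z)" by (rule mono[OF _ S(2,3)]) simp
    moreover have "S n (max t z) = 1" using S(5)[of n] by (intro S(7)) linarith
    ultimately show ?thesis by simp
  qed
  define f where "f = (\<lambda>n t. H * (R n t + (- 1) * S n t))"
  define f' where "f' = (\<lambda>n t. H * (r n t - s n t))"
  show ?thesis
  proof
    show "times_diff k (f n)" for k n
      unfolding f_def by (intro times_diff_mult times_diff_add times_diff_const R S)
    show "(f n has_real_derivative f' n t) (at t)" for n t
      unfolding f_def f'_def by (auto intro!: derivative_eq_intros R(2) S(2))
    show "0 \<le> f n t" for n t
      using Ry[of t n] Sy[of t n] R0[of n t] S1[of n t] H
      by (cases "t \<le> y") (auto simp: f_def)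
    show "\<bar>f' n t\<bar> \<le> H * (A + B)" for n t
    proof -
      have "\<bar>r n t - s n t\<bar> \<le> A + B"
        using R(3,4)[of n t] S(3,4)[of n t] by (simp add: abs_le_iff)
      then show ?thesis using H by (simp add: f'_def abs_mult mult_left_mono)
    qed
    show "0 < min (min (\<rho> n) (\<sigma> n)) (min (y - x) (z - y))" for n using R(5) S(5) xyz by simp
    show "f n t = 0" if "t \<le> x + min (min (\<rho> n) (\<sigma> n)) (min (y - x) (z - y)) \<or> z - min (min (\<rho> n) (\<sigma> n)) (min (y - x) (z - y)) \<le> t" for n t
      using that
    proof
      assume "t \<le> x + min (min (\<rho> n) (\<sigma> n)) (min (y - x) (z - y))"
      then have "t \<le> x + \<rho> n" "t \<le> y" by linarith+
      then show ?thesis by (simp add: f_def R(6) Sy)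
    next
      assume "z - min (min (\<rho> n) (\<sigma> n)) (min (y - x) (z - y)) \<le> t"
      then have "z - \<sigma> n \<le> t" "y \<le> t" by linarith+
      then show ?thesis by (simp add: f_def S(7) Ry)
    qed
    show "(\<lambda>n. f' n t) \<longlonglongrightarrow> H / (y - x) * indicator {x<..<y} t - H / (z - y) * indicator {y<..<z} t" for t
      using tendsto_mult[OF tendsto_const[of H] tendsto_diff[OF R(8) S(8), of t t]]
      by (simp add: f'_def right_diff_distrib)
    show "\<forall>\<^sub>F n in sequentially. 0 < f n t" if "0 < H" "x < t" "t < z" for t
    proof (cases "t \<le> y")
      case True
      then have "\<forall>\<^sub>F n in sequentially. 0 < R n t"
        using order_tendstoD(1)[OF R(9)[of t], of 0] that True xyz by simp
      then show ?thesis
        by eventually_elim (use that True in \<open>simp add: f_def Sy\<close>)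
    next
      case False
      then have "\<forall>\<^sub>F n in sequentially. S n t < 1"
        using order_tendstoD(2)[OF S(9)[of t], of 1] that False xyz by simp
      then show ?thesis
        by eventually_elim (use that False in \<open>simp add: f_def Ry\<close>)
    qed
  qed
qed

section \<open>Kinks inside a kink\<close>

lemma bounded_borel_set_integrable:
  fixes G :: "real \<Rightarrow> real"
  assumes G: "G \<in> borel_measurable borel" and B: "\<And>t. \<bar>G t\<bar> \<le> B"
  shows "set_integrable lebesgue {l<..<r} G"
  unfolding set_integrable_def
proof (rule Bochner_Integration.integrable_bound)
  show "integrable lebesgue (\<lambda>t. B * indicat_real {l<..<r} t)"
    by (intro integrable_mult_right integrable_real_indicator) (cases "l \<le> r"; simp)+
  show "(\<lambda>t. indicat_real {l<..<r} t *\<^sub>R G t) \<in> borel_measurable lebesgue"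
    using G by (intro measurable_completion) measurable
  show "AE t in lebesgue. norm (indicat_real {l<..<r} t *\<^sub>R G t) \<le> norm (B * indicat_real {l<..<r} t)"
    using B by (intro AE_I2) (auto simp: abs_mult split: split_indicator intro: order_trans[OF B abs_ge_self])
qed

lemma set_integral_derivative_Ioo:
  fixes U G :: "real \<Rightarrow> real"
  assumes "finite S" "l \<le> r" "continuous_on {l..r} U"
    and "\<And>t. t \<in> {l<..<r} - S \<Longrightarrow> (U has_real_derivative G t) (at t)"
    and "set_integrable lebesgue {l<..<r} G"
  shows "(LINT t:{l<..<r}|lebesgue. G t) = U r - U l"
proof -
  have "(G has_integral U r - U l) {l..r}"
    by (rule fundamental_theorem_of_calculus_interior_strong[OF assms(1-2) _ assms(3)])
      (use assms(4) in \<open>simp add: has_real_derivative_iff_has_vector_derivative\<close>)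
  then have "integral {l..r} G = U r - U l" by (rule integral_unique)
  then show ?thesis
    unfolding set_lebesgue_integral_eq_integral(2)[OF assms(5)] integral_open_interval_real .
qed

text \<open>
  The common end point is a null set.
\<close>

lemma nn_integral_Ioo_split:
  fixes f :: "real \<Rightarrow> ennreal"
  assumes "l < m" "m < r" and f: "f \<in> borel_measurable lebesgue"
  shows "(\<integral>\<^sup>+t\<in>{l<..<r}. f t \<partial>lebesgue) = (\<integral>\<^sup>+t\<in>{l<..<m}. f t \<partial>lebesgue) + (\<integral>\<^sup>+t\<in>{m<..<r}. f t \<partial>lebesgue)"
proof -
  have "(\<integral>\<^sup>+t\<in>{l<..<r}. f t \<partial>lebesgue)
    = (\<integral>\<^sup>+t. f t * indicator {l<..<m} t + f t * indicator {m<..<r} t \<partial>lebesgue)"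
    by (rule nn_integral_cong_AE)
      (use AE_not_in_finite[of "{m}"] assms in \<open>auto split: split_indicator elim!: eventually_mono\<close>)
  also have "\<dots> = (\<integral>\<^sup>+t\<in>{l<..<m}. f t \<partial>lebesgue) + (\<integral>\<^sup>+t\<in>{m<..<r}. f t \<partial>lebesgue)"
    using f by (intro nn_integral_add borel_measurable_times_ennreal borel_measurable_indicator) auto
  finally show ?thesis .
qed

text \<open>
  The two kinks of the construction, one for each of the constants: \<open>attained1\<close> and \<open>attained2\<close> say that the
  proportions \<open>\<beta>1\<close> and \<open>\<beta>2\<close> realize the energy ratios \<open>Q1\<close> and \<open>Q2\<close>, \<open>bound1\<close> and \<open>bound2\<close> that no
  proportion exceeds them.
\<close>

locale nested_kinks =
  fixes p Q1 Q2 \<tau>1 \<beta>1 \<tau>2 \<beta>2 :: real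
  assumes p: "1 < p" and Q1: "1 \<le> Q1" and Q2: "1 \<le> Q2"
    and \<tau>1: "0 < \<tau>1" "\<tau>1 \<le> 1" and \<beta>1: "0 < \<beta>1" "\<beta>1 < 1"
    and \<tau>2: "0 < \<tau>2" "\<tau>2 \<le> 1" and \<beta>2: "0 < \<beta>2" "\<beta>2 < 1"
    and attained1: "\<tau>1 powr p * (1 - \<beta>1) + \<beta>1 = Q1 * (\<tau>1 * (1 - \<beta>1) + \<beta>1) powr p"
    and attained2: "\<tau>2 powr p * (1 - \<beta>2) + \<beta>2 = Q2 * (\<tau>2 * (1 - \<beta>2) + \<beta>2) powr p"
    and bound1: "\<And>b. \<lbrakk>0 \<le> b; b \<le> 1\<rbrakk> \<Longrightarrow> \<tau>1 powr p * (1 - b) + b \<le> Q1 * (\<tau>1 * (1 - b) + b) powr p"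
    and bound2: "\<And>\<sigma> b. \<lbrakk>\<tau>2 \<le> \<sigma>; \<sigma> \<le> 1; 0 \<le> b; b \<le> 1\<rbrakk>
      \<Longrightarrow> \<sigma> powr p * (1 - b) + b \<le> Q2 * (\<sigma> * (1 - b) + b) powr p"
begin

text \<open>
  The outer function is the kink with slope \<open>\<tau>2\<close> at \<open>m\<close>, a position for which its energy on the whole unit
  interval is \<open>Q2\<close> times that of its chord. The inner function \<open>U\<close> replaces each of its two linear
  pieces by a kinked one, with kinks at \<open>s1\<close> and \<open>s2\<close> that divide the pieces in the proportion \<open>\<beta>1\<close>. The
  factor \<open>c\<close> makes up for the smaller mean slope of the kinks, so that the values at \<open>0\<close>, \<open>m\<close> and \<open>1\<close> are
  kept. The minimum and maximum with \<open>m\<close> in \<open>U\<close> switch between the pieces and show continuity.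
\<close>

definition "m = 1 - \<beta>2"
definition "c = 1 / (\<tau>1 * (1 - \<beta>1) + \<beta>1)"
definition "s1 = m * (1 - \<beta>1)"
definition "s2 = m + (1 - m) * (1 - \<beta>1)"

definition "U t = \<tau>2 * c * (kink \<tau>1 s1 (min t m) - kink \<tau>1 s1 m) + c * (kink \<tau>1 s2 (max t m) - kink \<tau>1 s2 m)"
definition "G t = (if t < m then \<tau>2 * c * kink_slope \<tau>1 s1 t else c * kink_slope \<tau>1 s2 t)"

lemma m: "0 < m" "m < 1" and s1: "0 < s1" "s1 < m" and s2: "m < s2" "s2 < 1"
proof -
  show m: "0 < m" "m < 1" using \<beta>2 by (auto simp: m_def)
  show "0 < s1" using m \<beta>1 by (simp add: s1_def)
  have "m * (1 - \<beta>1) < m * 1" using m \<beta>1 by (intro mult_strict_left_mono) auto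
  then show "s1 < m" by (simp add: s1_def)
  show "m < s2" using m \<beta>1 by (simp add: s2_def)
  have "(1 - m) * (1 - \<beta>1) < (1 - m) * 1" using m \<beta>1 by (intro mult_strict_left_mono) auto
  then show "s2 < 1" by (simp add: s2_def)
qed

lemma c_normalizes: "c * (\<tau>1 * (1 - \<beta>1) + \<beta>1) = 1"
proof -
  have "0 < \<tau>1 * (1 - \<beta>1) + \<beta>1" using \<tau>1 \<beta>1 by (intro add_nonneg_pos) auto
  then show ?thesis by (simp add: c_def)
qed

lemma c: "1 \<le> c" "0 < c" "c * \<tau>1 \<le> 1" "\<tau>1 < 1 \<Longrightarrow> c * \<tau>1 < 1"
proof -
  have pos: "0 < \<tau>1 * (1 - \<beta>1) + \<beta>1" using \<tau>1 \<beta>1 by (intro add_nonneg_pos) auto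
  have "\<tau>1 * (1 - \<beta>1) \<le> 1 * (1 - \<beta>1)" using \<tau>1 \<beta>1 by (intro mult_right_mono) auto
  then show "1 \<le> c" using pos by (simp add: c_def)
  then show "0 < c" by simp
  have "\<tau>1 * \<beta>1 \<le> 1 * \<beta>1" using \<tau>1 \<beta>1 by (intro mult_right_mono) auto
  then show "c * \<tau>1 \<le> 1" using pos by (simp add: c_def algebra_simps)
  show "c * \<tau>1 < 1" if "\<tau>1 < 1"
  proof -
    have "\<tau>1 * \<beta>1 < 1 * \<beta>1" using that \<beta>1 by (intro mult_strict_right_mono) auto
    then show ?thesis using pos by (simp add: c_def algebra_simps)
  qed
qed

lemma kink_differences:
  "c * (kink \<tau>1 s1 m - kink \<tau>1 s1 t) = (if t \<le> s1 then m - c * \<tau>1 * t else c * (m - t))"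
  "c * (kink \<tau>1 s2 t - kink \<tau>1 s2 m) = (if t \<le> s2 then c * \<tau>1 * (t - m) else 1 - m - c * (1 - t))"
proof -
  have 1: "c * (\<tau>1 * s1 + (m - s1)) = m"
    using arg_cong[OF c_normalizes, of "\<lambda>z. m * z"] by (simp add: s1_def algebra_simps)
  have 2: "c * (\<tau>1 * (s2 - m) + (1 - s2)) = 1 - m"
    using arg_cong[OF c_normalizes, of "\<lambda>z. (1 - m) * z"] by (simp add: s2_def algebra_simps)
  show "c * (kink \<tau>1 s1 m - kink \<tau>1 s1 t) = (if t \<le> s1 then m - c * \<tau>1 * t else c * (m - t))"
    using 1 s1 by (auto simp: kink_eq[OF \<tau>1(2)] algebra_simps)
  show "c * (kink \<tau>1 s2 t - kink \<tau>1 s2 m) = (if t \<le> s2 then c * \<tau>1 * (t - m) else 1 - m - c * (1 - t))"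
    using 2 s2 by (auto simp: kink_eq[OF \<tau>1(2)] algebra_simps)
qed

lemma U_left: "t \<le> m \<Longrightarrow> U t = - \<tau>2 * (c * (kink \<tau>1 s1 m - kink \<tau>1 s1 t))"
  and U_right: "m \<le> t \<Longrightarrow> U t = c * (kink \<tau>1 s2 t - kink \<tau>1 s2 m)"
  by (auto simp: U_def min_def max_def algebra_simps)

lemma U_m: "U m = 0" by (simp add: U_def)

lemma U_le_left: "\<lbrakk>0 \<le> t; t \<le> m\<rbrakk> \<Longrightarrow> U t \<le> \<tau>2 * (t - m)"
proof -
  assume t: "0 \<le> t" "t \<le> m"
  have "m - t \<le> c * (kink \<tau>1 s1 m - kink \<tau>1 s1 t)"
  proof (cases "t \<le> s1")
    case True
    have "c * \<tau>1 * t \<le> 1 * t" using c t by (intro mult_right_mono) auto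
    then show ?thesis using True by (simp add: kink_differences)
  next
    case False
    have "1 * (m - t) \<le> c * (m - t)" using c t by (intro mult_right_mono) auto
    then show ?thesis using False by (simp add: kink_differences)
  qed
  then have "\<tau>2 * (m - t) \<le> \<tau>2 * (c * (kink \<tau>1 s1 m - kink \<tau>1 s1 t))"
    using \<tau>2 by (intro mult_left_mono) auto
  then show ?thesis using t by (simp add: U_left algebra_simps)
qed

lemma U_le_right: "\<lbrakk>m \<le> t; t \<le> 1\<rbrakk> \<Longrightarrow> U t \<le> t - m"
proof -
  assume t: "m \<le> t" "t \<le> 1"
  show ?thesis
  proof (cases "t \<le> s2")
    case True
    have "c * \<tau>1 * (t - m) \<le> 1 * (t - m)" using c t by (intro mult_right_mono) auto
    then show ?thesis using True t by (simp add: U_right kink_differences)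
  next
    case False
    have "1 * (1 - t) \<le> c * (1 - t)" using c t by (intro mult_right_mono) auto
    then show ?thesis using False t by (simp add: U_right kink_differences)
  qed
qed

text \<open>
  Each piece of \<open>U\<close> is convex and has the end values of a linear piece of the outer kink.
\<close>

lemma U_le: "\<lbrakk>0 \<le> t; t \<le> 1\<rbrakk> \<Longrightarrow> U t \<le> kink \<tau>2 m t"
  using U_le_left[of t] U_le_right[of t] by (auto simp: kink_eq[OF \<tau>2(2)])

lemma U_right_nonneg: "m \<le> t \<Longrightarrow> 0 \<le> U t"
proof -
  assume "m \<le> t"
  then have "kink \<tau>1 s2 m \<le> kink \<tau>1 s2 t"
    using \<tau>1 unfolding kink_def by (intro max.mono mult_left_mono) auto
  then show ?thesis using c \<open>m \<le> t\<close> by (simp add: U_right)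
qed

lemma continuous_U: "continuous_on A U"
proof -
  have k: "continuous_on A (\<lambda>t. kink \<tau> s (f t))" if "continuous_on A f" for \<tau> s and f :: "real \<Rightarrow> real"
    by (rule continuous_on_compose2[OF kink_continuous that]) auto
  show ?thesis
    unfolding U_def[abs_def] by (intro continuous_intros k)
qed

lemma DERIV_U: "t \<notin> {s1, m, s2} \<Longrightarrow> (U has_real_derivative G t) (at t)"
proof -
  assume t: "t \<notin> {s1, m, s2}"
  show ?thesis
  proof (cases "t < m")
    case True
    have "((\<lambda>t. \<tau>2 * c * (kink \<tau>1 s1 t - kink \<tau>1 s1 m)) has_real_derivative G t) (at t)"
      using True t \<tau>1 by (auto intro!: derivative_eq_intros kink_DERIV simp: G_def)
    then show ?thesis
      by (rule has_field_derivative_transform_within_open[where S = "{..<m}"])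
        (use True in \<open>auto simp: U_def min_def max_def\<close>)
  next
    case False
    have "((\<lambda>t. c * (kink \<tau>1 s2 t - kink \<tau>1 s2 m)) has_real_derivative G t) (at t)"
      using False t \<tau>1 by (auto intro!: derivative_eq_intros kink_DERIV simp: G_def)
    then show ?thesis
      by (rule has_field_derivative_transform_within_open[where S = "{m<..}"])
        (use False t in \<open>auto simp: U_def min_def max_def\<close>)
  qed
qed

lemma measurable_G: "G \<in> borel_measurable borel"
proof -
  have [measurable]: "kink_slope \<tau>1 s1 \<in> borel_measurable borel" "kink_slope \<tau>1 s2 \<in> borel_measurable borel"
    by (rule kink_slope_measurable)+
  show ?thesis unfolding G_def[abs_def] by measurable
qed

lemma G_bounds: "0 \<le> G t" "G t \<le> c"
proof -
  show "0 \<le> G t" using \<tau>1 \<tau>2 c by (auto simp: G_def kink_slope_def)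
  have "\<tau>2 * c * kink_slope \<tau>1 s1 t \<le> 1 * c * 1"
    using \<tau>1 \<tau>2 c by (intro mult_mono) (auto simp: kink_slope_def)
  moreover have "c * kink_slope \<tau>1 s2 t \<le> c * 1"
    using \<tau>1 c by (intro mult_left_mono) (auto simp: kink_slope_def)
  ultimately show "G t \<le> c" by (simp add: G_def)
qed

lemma G_integrable: "set_integrable lebesgue {l<..<r} G"
  using G_bounds by (intro bounded_borel_set_integrable[OF measurable_G, of c]) (simp add: abs_le_iff order_trans)

lemma integral_G_plus:
  assumes h: "integrable lebesgue h" and lr: "l \<le> r"
  shows "set_integrable lebesgue {l<..<r} (\<lambda>t. G t + h t)"
    and "(LINT t:{l<..<r}|lebesgue. G t + h t) = U r - U l + integral {l..r} h"
proof -
  show "set_integrable lebesgue {l<..<r} (\<lambda>t. G t + h t)"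
    by (rule set_integral_add(1)[OF G_integrable set_integral_Ioo_eq(1)[OF h]])
  have "(LINT t:{l<..<r}|lebesgue. G t) = U r - U l"
    by (rule set_integral_derivative_Ioo[of "{s1, m, s2}", OF _ lr continuous_U DERIV_U G_integrable]) auto
  then show "(LINT t:{l<..<r}|lebesgue. G t + h t) = U r - U l + integral {l..r} h"
    by (simp add: set_integral_add(2)[OF G_integrable set_integral_Ioo_eq(1)[OF h]] set_integral_Ioo_eq(2)[OF h])
qed

lemma energy_G_plus_measurable:
  assumes h: "integrable lebesgue h"
  shows "(\<lambda>t. ennreal (\<bar>G t + h t\<bar> powr p)) \<in> borel_measurable lebesgue"
proof -
  have [measurable]: "G \<in> borel_measurable lebesgue" "h \<in> borel_measurable lebesgue"
    using measurable_G h by (auto intro: measurable_completion)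
  show ?thesis by measurable
qed

lemma G_left: "r \<le> m \<Longrightarrow> energy_on p {l<..<r} G
    = energy_on p {l<..<r} (\<lambda>t. \<tau>2 * c * kink_slope \<tau>1 s1 t)"
  and G_right: "m \<le> l \<Longrightarrow> energy_on p {l<..<r} G
    = energy_on p {l<..<r} (\<lambda>t. c * kink_slope \<tau>1 s2 t)"
  by (intro nn_integral_cong; auto simp: G_def split: split_indicator)+

lemma energy_bound_off_m:
  assumes h: "integrable lebesgue h" and lr: "l < r" and h0: "integral {l..r} h = 0"
    and off: "m \<notin> {l<..<r}"
  shows "energy_on p {l<..<r} G
    \<le> ennreal Q1 * energy_on p {l<..<r} (\<lambda>t. G t + h t)"
proof -
  note w = integral_G_plus[OF h less_imp_le[OF lr]]
  consider "r \<le> m" | "m \<le> l" using off lr by fastforce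
  then show ?thesis
  proof cases
    case 1
    show ?thesis unfolding G_left[OF 1]
    proof (rule kink_energy_minimizing[OF p Q1 lr _ _ _ bound1 w(1)])
      show "(LINT t:{l<..<r}|lebesgue. G t + h t) = \<tau>2 * c * (kink \<tau>1 s1 r - kink \<tau>1 s1 l)"
        unfolding w(2) h0 using 1 lr by (simp add: U_left algebra_simps)
    qed (use \<tau>1 \<tau>2 c in auto)
  next
    case 2
    show ?thesis unfolding G_right[OF 2]
    proof (rule kink_energy_minimizing[OF p Q1 lr _ _ _ bound1 w(1)])
      show "(LINT t:{l<..<r}|lebesgue. G t + h t) = c * (kink \<tau>1 s2 r - kink \<tau>1 s2 l)"
        unfolding w(2) h0 using 2 lr by (simp add: U_right algebra_simps)
    qed (use \<tau>1 c in auto)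
  qed
qed

text \<open>
  On each half of the interval the energy is at most \<open>Q1\<close> times that of the chord; let \<open>A\<close> and \<open>B\<close> be the slopes of
  the chords. If \<open>B \<le> A\<close> then the two chords form a concave broken line, and the competitor, which lies
  above it at \<open>m\<close>, has at least its energy; here the sign of the perturbation enters. If \<open>A < B\<close> then
  the chords form a convex kink, with at most \<open>Q2\<close> times the energy of the chord over the whole
  interval. This kink is not sharper than the outer one, that is \<open>\<tau>2 \<le> A / B\<close>, since \<open>U\<close> lies below
  the outer kink and meets it at \<open>m\<close>.
\<close>

lemma energy_bound_across_m:
  assumes h: "integrable lebesgue h" and l: "0 \<le> l" "l < m" and r: "m < r" "r \<le> 1"
    and h0: "integral {l..r} h = 0" and pos: "0 \<le> integral {l..m} h"
  shows "energy_on p {l<..<r} G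
    \<le> ennreal (Q1 * Q2) * energy_on p {l<..<r} (\<lambda>t. G t + h t)"
    (is "_ \<le> _ * ?E")
proof -
  define x where "x = m - l"
  define y where "y = r - m"
  have xy: "0 < x" "0 < y" "r - l = x + y" using l r by (auto simp: x_def y_def)
  define A where "A = - U l / x"
  define B where "B = U r / y"
  have AB: "U l = - (A * x)" "U r = B * y" using xy by (auto simp: A_def B_def)
  have A: "\<tau>2 \<le> A"
    using U_le_left[of l] l xy by (simp add: A_def x_def field_simps)
  have B: "0 \<le> B" "B \<le> 1"
    using U_right_nonneg[of r] U_le_right[of r] r xy by (auto simp: B_def y_def)
  have Gm: "(\<lambda>t. ennreal (\<bar>G t\<bar> powr p)) \<in> borel_measurable lebesgue"
    using energy_G_plus_measurable[of "\<lambda>_. 0"] by simp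
  have "energy_on p {l<..<r} G
    = energy_on p {l<..<m} G + energy_on p {m<..<r} G"
    by (rule nn_integral_Ioo_split[OF l(2) r(1) Gm])
  also have "\<dots> \<le> ennreal (Q1 * (x * A powr p)) + ennreal (Q1 * (y * B powr p))"
  proof (rule add_mono)
    have "\<tau>2 * c * (kink \<tau>1 s1 m - kink \<tau>1 s1 l) / (m - l) = A"
      using l by (simp add: A_def x_def U_left)
    then show "energy_on p {l<..<m} G \<le> ennreal (Q1 * (x * A powr p))"
      unfolding G_left[OF order_refl] x_def
      using kink_energy_le_chord[OF l(2) less_imp_le[OF \<tau>1(1)] \<tau>1(2) _ bound1, of "\<tau>2 * c" s1] \<tau>2 c by simp
    have "c * (kink \<tau>1 s2 r - kink \<tau>1 s2 m) / (r - m) = B"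
      using r by (simp add: B_def y_def U_right)
    then show "energy_on p {m<..<r} G \<le> ennreal (Q1 * (y * B powr p))"
      unfolding G_right[OF order_refl] y_def
      using kink_energy_le_chord[OF r(1) less_imp_le[OF \<tau>1(1)] \<tau>1(2) _ bound1, of c s2] c by simp
  qed
  also have "\<dots> = ennreal Q1 * ennreal (x * A powr p + y * B powr p)"
    using Q1 xy by (simp add: ennreal_plus[symmetric] ennreal_mult'[symmetric] distrib_left del: ennreal_plus)
  also have "\<dots> \<le> ennreal Q1 * (ennreal Q2 * ?E)"
  proof (rule mult_left_mono)
    note wl = integral_G_plus[OF h, of l m] and wr = integral_G_plus[OF h, of m r] and w = integral_G_plus[OF h, of l r]
    have split: "integral {l..m} h + integral {m..r} h = 0"
      using Henstock_Kurzweil_Integration.integral_combine[of l m r h] set_integral_Ioo_eq(3)[OF h] l r h0 by simp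
    show "ennreal (x * A powr p + y * B powr p) \<le> ennreal Q2 * ?E"
    proof (cases "B \<le> A")
      case True
      define s where "s = integral {l..m} h"
      have L: "(LINT t:{l<..<m}|lebesgue. G t + h t) / (m - l) = A + s / x"
        using wl(2) l xy by (simp add: U_m AB s_def x_def[symmetric] add_divide_distrib)
      have R: "(LINT t:{m<..<r}|lebesgue. G t + h t) / (r - m) = B - s / y"
      proof -
        have "integral {m..r} h = - s" using split by (simp add: s_def)
        then have "(LINT t:{m<..<r}|lebesgue. G t + h t) = B * y - s"
          using wr(2) r by (simp add: U_m AB)
        then show ?thesis using xy by (simp add: y_def[symmetric] diff_divide_distrib)
      qed
      have "x * A powr p + y * B powr p \<le> x * \<bar>A + s / x\<bar> powr p + y * \<bar>B - s / y\<bar> powr p"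
        using pos by (intro concave_corner_powr[OF p B(1) True _ xy(1,2)]) (simp add: s_def)
      then have "ennreal (x * A powr p + y * B powr p)
        \<le> ennreal (x * \<bar>A + s / x\<bar> powr p + y * \<bar>B - s / y\<bar> powr p)"
        by (rule ennreal_leI)
      also have "\<dots> = ennreal (x * \<bar>A + s / x\<bar> powr p) + ennreal (y * \<bar>B - s / y\<bar> powr p)"
        using xy by (intro ennreal_plus) auto
      also have "\<dots> \<le> energy_on p {l<..<m} (\<lambda>t. G t + h t)
          + energy_on p {m<..<r} (\<lambda>t. G t + h t)"
        using Jensen_powr_Ioo[OF p l(2) wl(1)] Jensen_powr_Ioo[OF p r(1) wr(1)] l r
        unfolding L R by (intro add_mono) (simp_all add: x_def y_def)
      also have "\<dots> = ?E"
        by (rule nn_integral_Ioo_split[OF l(2) r(1) energy_G_plus_measurable[OF h], symmetric])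
      also have "\<dots> = 1 * ?E" by simp
      also have "\<dots> \<le> ennreal Q2 * ?E" using Q2 by (intro mult_right_mono) auto
      finally show ?thesis .
    next
      case False
      then have B0: "0 < B" "A < B" using A \<tau>2 by auto
      \<comment> \<open>The pair of chords is \<open>B\<close> times a kink with slope ratio \<open>\<sigma>\<close>.\<close>
      define \<sigma> where "\<sigma> = A / B"
      have A_eq: "A = B * \<sigma>" using B0 by (simp add: \<sigma>_def)
      have "\<tau>2 * B \<le> \<tau>2 * 1" using B \<tau>2 by (intro mult_left_mono) auto
      then have \<sigma>: "\<tau>2 \<le> \<sigma>" "\<sigma> \<le> 1" using A B0 by (auto simp: \<sigma>_def field_simps)
      have lr: "l < r" using l r by simp
      have W: "(LINT t:{l<..<r}|lebesgue. G t + h t) / (r - l) = B * (\<sigma> * x + y) / (x + y)"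
        using w(2) lr h0 by (simp add: AB xy(3) A_eq algebra_simps)
      have "0 \<le> B * (\<sigma> * x + y) / (x + y)"
        using B \<sigma> \<tau>2 xy by (intro divide_nonneg_nonneg mult_nonneg_nonneg add_nonneg_nonneg) auto
      then have n: "\<bar>B * (\<sigma> * x + y) / (x + y)\<bar> = B * (\<sigma> * x + y) / (x + y)" by (rule abs_of_nonneg)
      have "x * A powr p + y * B powr p = B powr p * (\<sigma> powr p * x + y)"
        unfolding A_eq using B \<sigma> \<tau>2 by (simp add: powr_mult algebra_simps)
      also have "\<dots> \<le> Q2 * ((x + y) * (B * (\<sigma> * x + y) / (x + y)) powr p)"
        using xy B \<sigma> \<tau>2 bound2[OF \<sigma>] by (intro kink_inequality) auto
      finally have "ennreal (x * A powr p + y * B powr p)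
        \<le> ennreal Q2 * ennreal ((x + y) * (B * (\<sigma> * x + y) / (x + y)) powr p)"
        using Q2 by (subst ennreal_mult'[symmetric]) (auto intro: ennreal_leI)
      also have "\<dots> \<le> ennreal Q2 * ?E"
        using Jensen_powr_Ioo[OF p lr w(1), unfolded W n, unfolded xy(3)] lr
        by (intro mult_left_mono) auto
      finally show ?thesis .
    qed
  qed simp
  also have "\<dots> = ennreal (Q1 * Q2) * ?E"
    using Q1 Q2 by (simp add: ennreal_mult mult.assoc)
  finally show ?thesis .
qed

text \<open>
  On each half the inner kink has \<open>Q1\<close> times the energy of the linear piece that it replaces, and the two
  linear pieces together have \<open>Q2\<close> times the energy of the chord, whose slope is \<open>\<tau>2 * m + (1 - m)\<close>.
\<close>

lemma energy_G:
  "energy_on p {0<..<1} G = ennreal (Q1 * Q2 * (\<tau>2 * m + (1 - m)) powr p)"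
proof -
  have cp: "c powr p * (\<tau>1 powr p * (1 - \<beta>1) + \<beta>1) = Q1"
  proof -
    have "c powr p * (\<tau>1 * (1 - \<beta>1) + \<beta>1) powr p = (c * (\<tau>1 * (1 - \<beta>1) + \<beta>1)) powr p"
      by (rule powr_mult[symmetric])
    also have "\<dots> = 1" by (simp add: c_normalizes)
    finally show ?thesis by (simp add: attained1 mult.left_commute)
  qed
  have Gm: "(\<lambda>t. ennreal (\<bar>G t\<bar> powr p)) \<in> borel_measurable lebesgue"
    using energy_G_plus_measurable[of "\<lambda>_. 0"] by simp
  have left: "energy_on p {0<..<m} G = ennreal (Q1 * (\<tau>2 powr p * m))"
  proof -
    have "energy_on p {0<..<m} G
      = ennreal ((\<tau>2 * c) powr p * (\<tau>1 powr p * s1 + (m - s1)))"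
      using m s1 \<tau>1 \<tau>2 c unfolding G_left[OF order_refl] by (subst kink_slope_energy) auto
    also have "\<tau>1 powr p * s1 + (m - s1) = m * (\<tau>1 powr p * (1 - \<beta>1) + \<beta>1)"
      by (simp add: s1_def algebra_simps)
    also have "(\<tau>2 * c) powr p * \<dots> = (c powr p * (\<tau>1 powr p * (1 - \<beta>1) + \<beta>1)) * (\<tau>2 powr p * m)"
      using \<tau>2 c by (simp add: powr_mult)
    finally show ?thesis unfolding cp .
  qed
  have right: "energy_on p {m<..<1} G = ennreal (Q1 * (1 - m))"
  proof -
    have "energy_on p {m<..<1} G
      = ennreal (c powr p * (\<tau>1 powr p * (s2 - m) + (1 - s2)))"
      using m s2 \<tau>1 c unfolding G_right[OF order_refl] by (subst kink_slope_energy) auto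
    also have "\<tau>1 powr p * (s2 - m) + (1 - s2) = (1 - m) * (\<tau>1 powr p * (1 - \<beta>1) + \<beta>1)"
      by (simp add: s2_def algebra_simps)
    also have "c powr p * \<dots> = (c powr p * (\<tau>1 powr p * (1 - \<beta>1) + \<beta>1)) * (1 - m)"
      by simp
    finally show ?thesis unfolding cp .
  qed
  have "energy_on p {0<..<1} G
    = ennreal (Q1 * (\<tau>2 powr p * m)) + ennreal (Q1 * (1 - m))"
    by (simp only: nn_integral_Ioo_split[OF m Gm] left right)
  also have "\<dots> = ennreal (Q1 * (\<tau>2 powr p * m + (1 - m)))"
    using Q1 m by (subst ennreal_plus[symmetric]) (auto simp: distrib_left)
  also have "\<tau>2 powr p * m + (1 - m) = Q2 * (\<tau>2 * m + (1 - m)) powr p"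
    using attained2 by (simp add: m_def)
  finally show ?thesis by (simp add: mult.assoc)
qed

lemma finite_punctures [simp]: "finite {m}" "finite ({} :: real set)"
  by simp_all

lemma U_weak_gradient:
  assumes F: "finite F" and u: "\<And>t. t \<in> punctured F \<Longrightarrow> u (pt t) = U t"
  shows "has_weak_gradient 1 (pt ` punctured F) u (\<lambda>x i. G (x 0))"
    and "u \<in> W1p_loc 1 p (pt ` punctured F)"
    and "set_integrable lebesgue (punctured F) (\<lambda>t. u (pt t))"
    and "set_integrable lebesgue (punctured F) G"
proof -
  have Gm: "(\<lambda>t. indicator {0<..<1} t * G t) \<in> borel_measurable lebesgue"
    using measurable_G by (intro measurable_completion) measurable
  have D: "(U has_real_derivative G t) (at t)" if "t \<in> {0<..<1} - {s1, m, s2}" for t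
    using that by (intro DERIV_U) auto
  have B: "\<bar>G t\<bar> \<le> c" for t using G_bounds[of t] by simp
  note r = piecewise_C1_weak_gradient[where u = u and S = "{s1, m, s2}", OF F _ continuous_U D Gm B u]
  show "has_weak_gradient 1 (pt ` punctured F) u (\<lambda>x i. G (x 0))" by (rule r(1)) auto
  show "u \<in> W1p_loc 1 p (pt ` punctured F)" by (rule r(3)) (use p in auto)
  show "set_integrable lebesgue (punctured F) (\<lambda>t. u (pt t))" by (rule r(4)) auto
  show "set_integrable lebesgue (punctured F) G" by (rule r(5)) auto
qed

text \<open>
  An interval may contain the kink anywhere or not at all, and the clipped kink estimate covers every
  case.
\<close>

lemma outer_quasiminimizer: "Q_quasiminimizer 1 p Q2 (pt ` punctured {}) (\<lambda>x. kink \<tau>2 m (x 0))"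
proof -
  let ?u = "\<lambda>x :: nat \<Rightarrow> real. kink \<tau>2 m (x 0)"
  have Sm: "(\<lambda>t. indicator {0<..<1} t * kink_slope \<tau>2 m t) \<in> borel_measurable lebesgue"
    by (intro measurable_completion) measurable
  have D: "(kink \<tau>2 m has_real_derivative kink_slope \<tau>2 m t) (at t)" if "t \<in> {0<..<1} - {m}" for t
    using that \<tau>2 by (intro kink_DERIV) auto
  have B: "\<bar>kink_slope \<tau>2 m t\<bar> \<le> 1" for t using \<tau>2 by (auto simp: kink_slope_def)
  note r = piecewise_C1_weak_gradient[where u = ?u and S = "{m}", OF finite.emptyI _ kink_continuous D Sm B]
  have wg: "has_weak_gradient 1 (pt ` punctured {}) ?u (\<lambda>x i. kink_slope \<tau>2 m (x 0))"
    by (rule r(1)) simp_all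
  have W: "?u \<in> W1p_loc 1 p (pt ` punctured {})"
    by (rule r(3)) (use p in simp_all)
  have uI: "set_integrable lebesgue (punctured {}) (\<lambda>t. ?u (pt t))"
    by (rule r(4)) simp_all
  have SI: "set_integrable lebesgue (punctured {}) (kink_slope \<tau>2 m)"
    by (rule r(5)) simp_all
  show ?thesis
    unfolding Q_quasiminimizer_def
  proof (intro conjI ballI W)
    fix \<phi> assume \<phi>: "\<phi> \<in> W1p_0 1 p (pt ` punctured {})"
    show "p_energy 1 p (pt ` punctured {}) ?u {x \<in> pt ` punctured {}. \<phi> x \<noteq> 0}
      \<le> ennreal Q2 * p_energy 1 p (pt ` punctured {}) (\<lambda>x. ?u x + \<phi> x) {x \<in> pt ` punctured {}. \<phi> x \<noteq> 0}"
    proof (rule p_energy_le_from_intervals[where pos = False, OF finite.emptyI p wg uI SI \<phi>])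
      fix h :: "real \<Rightarrow> real" and l r :: real
      assume h: "integrable lebesgue h" "integral {l..r} h = 0" and lr: "l < r"
      have i: "set_integrable lebesgue {l<..<r} (kink_slope \<tau>2 m)"
        using B by (intro bounded_borel_set_integrable[OF kink_slope_measurable])
      note hi = set_integral_Ioo_eq[OF h(1)]
      have "(LINT t:{l<..<r}|lebesgue. kink_slope \<tau>2 m t) = kink \<tau>2 m r - kink \<tau>2 m l"
        by (rule set_integral_derivative_Ioo[of "{m}", OF _ less_imp_le[OF lr] kink_continuous _ i])
          (use \<tau>2 in \<open>auto intro: kink_DERIV\<close>)
      then have "(LINT t:{l<..<r}|lebesgue. kink_slope \<tau>2 m t + h t) = 1 * (kink \<tau>2 m r - kink \<tau>2 m l)"
        by (simp add: set_integral_add(2)[OF i hi(1)] hi(2) h(2))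
      from kink_energy_minimizing[OF p Q2 lr _ \<tau>2(2) _ bound2[OF order_refl \<tau>2(2)] set_integral_add(1)[OF i hi(1)] this]
      show "energy_on p {l<..<r} (\<lambda>t. kink_slope \<tau>2 m t)
        \<le> ennreal Q2 * energy_on p {l<..<r} (\<lambda>t. kink_slope \<tau>2 m t + h t)"
        using \<tau>2 by simp
    qed simp
  qed
qed

text \<open>
  As the smaller domain omits \<open>m\<close>, only intervals on one side of \<open>m\<close> have to be compared, and there \<open>U\<close>
  has a single kink.
\<close>

lemma inner_quasiminimizer: "Q_quasiminimizer 1 p Q1 (pt ` punctured {m}) (\<lambda>x. U (x 0))"
  unfolding Q_quasiminimizer_def
proof (intro conjI ballI)
  note w = U_weak_gradient[of "{m}" "\<lambda>x. U (x 0)", OF finite_punctures(1)]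
  show "(\<lambda>x. U (x 0)) \<in> W1p_loc 1 p (pt ` punctured {m})" by (rule w(2)) simp
  fix \<phi> assume \<phi>: "\<phi> \<in> W1p_0 1 p (pt ` punctured {m})"
  have wg: "has_weak_gradient 1 (pt ` punctured {m}) (\<lambda>x. U (x 0)) (\<lambda>x i. G (x 0))"
    by (rule w(1)) simp
  have uI: "set_integrable lebesgue (punctured {m}) (\<lambda>t. U (pt t 0))"
    by (rule w(3)) simp
  have GI: "set_integrable lebesgue (punctured {m}) G"
    by (rule w(4)) simp
  show "p_energy 1 p (pt ` punctured {m}) (\<lambda>x. U (x 0)) {x \<in> pt ` punctured {m}. \<phi> x \<noteq> 0}
    \<le> ennreal Q1 * p_energy 1 p (pt ` punctured {m}) (\<lambda>x. U (x 0) + \<phi> x) {x \<in> pt ` punctured {m}. \<phi> x \<noteq> 0}"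
  proof (rule p_energy_le_from_intervals[where pos = False and u = "\<lambda>x. U (x 0)", OF finite_punctures(1) p wg uI GI \<phi>])
    fix h :: "real \<Rightarrow> real" and l r :: real
    assume "integrable lebesgue h" "integral {l..r} h = 0" "l < r" "{l<..<r} \<subseteq> punctured {m}"
    then show "energy_on p {l<..<r} G
      \<le> ennreal Q1 * energy_on p {l<..<r} (\<lambda>t. G t + h t)"
      by (intro energy_bound_off_m) auto
  qed simp
qed

lemma glued_quasisuperminimizer:
  assumes u: "\<And>t. t \<in> {0<..<1} \<Longrightarrow> u (pt t) = U t"
  shows "Q_quasisuperminimizer 1 p (Q1 * Q2) (pt ` punctured {}) u"
  unfolding Q_quasisuperminimizer_def
proof (intro conjI ballI impI)
  have u': "\<And>t. t \<in> punctured {} \<Longrightarrow> u (pt t) = U t" using u by simp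
  note w = U_weak_gradient[of "{}" u, OF finite_punctures(2) u']
  show "u \<in> W1p_loc 1 p (pt ` punctured {})" by (rule w(2))
  fix \<phi> assume \<phi>: "\<phi> \<in> W1p_0 1 p (pt ` punctured {})"
    and nonneg: "AE x in leb1. x \<in> pt ` punctured {} \<longrightarrow> 0 \<le> \<phi> x"
  show "p_energy 1 p (pt ` punctured {}) u {x \<in> pt ` punctured {}. \<phi> x \<noteq> 0}
    \<le> ennreal (Q1 * Q2) * p_energy 1 p (pt ` punctured {}) (\<lambda>x. u x + \<phi> x) {x \<in> pt ` punctured {}. \<phi> x \<noteq> 0}"
  proof (rule p_energy_le_from_intervals[where pos = True, OF finite_punctures(2) p w(1,3,4) \<phi> nonneg])
    fix h :: "real \<Rightarrow> real" and l r :: real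
    assume *: "integrable lebesgue h" "0 \<le> l" "l < r" "r \<le> 1" "integral {l..r} h = 0"
      "\<And>t. \<lbrakk>True; l < t; t < r\<rbrakk> \<Longrightarrow> 0 \<le> integral {l..t} h"
    show "energy_on p {l<..<r} G
      \<le> ennreal (Q1 * Q2) * energy_on p {l<..<r} (\<lambda>t. G t + h t)"
    proof (cases "m \<in> {l<..<r}")
      case True
      with * show ?thesis by (intro energy_bound_across_m) auto
    next
      case False
      have "Q1 * 1 \<le> Q1 * Q2" using Q1 Q2 by (intro mult_left_mono) auto
      then have "ennreal Q1 \<le> ennreal (Q1 * Q2)" by (intro ennreal_leI) simp
      then show ?thesis
        using energy_bound_off_m[OF *(1,3,5) False] by (meson mult_right_mono order_trans zero_le)
    qed
  qed
qed

text \<open>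
  The chord over the unit interval exceeds \<open>U\<close> by a sum of three hats: one over each half, between \<open>U\<close>
  and the outer kink, and one over the whole interval, between the outer kink and the chord. The
  bracketed terms are the slopes of these hats, each being the height divided by the length of the part.
\<close>

lemma chord_slopes:
  assumes "t \<in> {0<..<1}" "t \<notin> {s1, m, s2}"
  shows "G t + ((\<tau>2 * (1 - c * \<tau>1) * s1 / (s1 - 0) * indicator {0<..<s1} t
        - \<tau>2 * (1 - c * \<tau>1) * s1 / (m - s1) * indicator {s1<..<m} t)
      + ((1 - c * \<tau>1) * (s2 - m) / (s2 - m) * indicator {m<..<s2} t
        - (1 - c * \<tau>1) * (s2 - m) / (1 - s2) * indicator {s2<..<1} t)
      + (m * (1 - m) * (1 - \<tau>2) / (m - 0) * indicator {0<..<m} t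
        - m * (1 - m) * (1 - \<tau>2) / (1 - m) * indicator {m<..<1} t))
    = \<tau>2 * m + (1 - m)"
proof -
  have k: "(1 - c * \<tau>1) * (1 - \<beta>1) = (c - 1) * \<beta>1"
    using c_normalizes by (simp add: algebra_simps)
  have k1: "(1 - c * \<tau>1) * s1 / (m - s1) = c - 1"
  proof -
    have "(1 - c * \<tau>1) * s1 = (c - 1) * (m - s1)"
      using arg_cong[OF k, of "\<lambda>z. m * z"] by (simp add: s1_def algebra_simps)
    then show ?thesis using s1 by simp
  qed
  have k2: "(1 - c * \<tau>1) * (s2 - m) / (1 - s2) = c - 1"
  proof -
    have "(1 - c * \<tau>1) * (s2 - m) = (c - 1) * (1 - s2)"
      using arg_cong[OF k, of "\<lambda>z. (1 - m) * z"] by (simp add: s2_def algebra_simps)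
    then show ?thesis using s2 by simp
  qed
  have e: "\<tau>2 * (1 - c * \<tau>1) * s1 / (s1 - 0) = \<tau>2 * (1 - c * \<tau>1)"
    "\<tau>2 * (1 - c * \<tau>1) * s1 / (m - s1) = \<tau>2 * (c - 1)"
    "(1 - c * \<tau>1) * (s2 - m) / (s2 - m) = 1 - c * \<tau>1"
    "m * (1 - m) * (1 - \<tau>2) / (m - 0) = (1 - m) * (1 - \<tau>2)"
    "m * (1 - m) * (1 - \<tau>2) / (1 - m) = m * (1 - \<tau>2)"
    unfolding k1[symmetric] using m s1 s2 by (simp_all add: mult.assoc)
  consider "t < s1" | "s1 < t" "t < m" | "m < t" "t < s2" | "s2 < t"
    using assms by fastforce
  then show ?thesis
    unfolding e k2 using assms(1) m s1 s2
    by cases (simp_all add: G_def kink_slope_def algebra_simps)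
qed

text \<open>
  The chord is a competitor above \<open>U\<close> with the same boundary values, and its energy is smaller by exactly
  the factor \<open>Q1 * Q2\<close>. The perturbation leading to the chord is approximated by sums of smooth hats,
  which are nonnegative test functions; dominated convergence passes to the limit in both energies.
  On the left side one uses that the hats are eventually nonzero at almost every point, which needs
  at least one proper kink. Without any kink both constants are \<open>1\<close>.
\<close>

lemma optimal:
  assumes u: "\<And>t. t \<in> {0<..<1} \<Longrightarrow> u (pt t) = U t"
    and Q': "1 \<le> Q'" and qs: "Q_quasisuperminimizer 1 p Q' (pt ` punctured {}) u"
  shows "Q1 * Q2 \<le> Q'"
proof (cases "\<tau>1 = 1 \<and> \<tau>2 = 1")
  case True
  then have "Q1 = 1" "Q2 = 1" using attained1 attained2 by simp_all
  then show ?thesis using Q' by simp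
next
  case False
  \<comment> \<open>The heights of the hats: the gaps at the three kinks \<open>s1\<close>, \<open>s2\<close> and \<open>m\<close>.\<close>
  define H1 where "H1 = \<tau>2 * (1 - c * \<tau>1) * s1"
  define H2 where "H2 = (1 - c * \<tau>1) * (s2 - m)"
  define H3 where "H3 = m * (1 - m) * (1 - \<tau>2)"
  have H: "0 \<le> H1" "0 \<le> H2" "0 \<le> H3"
    using c \<tau>2 m s1 s2 by (auto simp: H1_def H2_def H3_def)
  obtain f1 f1' \<delta>1 B1 where f1: "\<And>n k. times_diff k (f1 n)"
    "\<And>n t. (f1 n has_real_derivative f1' n t) (at t)" "\<And>n t. 0 \<le> f1 n t" "\<And>n t. \<bar>f1' n t\<bar> \<le> B1"
    "\<And>n. 0 < \<delta>1 n" "\<And>n t. t \<le> 0 + \<delta>1 n \<or> m - \<delta>1 n \<le> t \<Longrightarrow> f1 n t = 0"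
    "\<And>t. (\<lambda>n. f1' n t) \<longlonglongrightarrow> H1 / (s1 - 0) * indicator {0<..<s1} t - H1 / (m - s1) * indicator {s1<..<m} t"
    "\<And>t. \<lbrakk>0 < H1; 0 < t; t < m\<rbrakk> \<Longrightarrow> \<forall>\<^sub>F n in sequentially. 0 < f1 n t"
    by (rule smooth_hats[OF s1 H(1)]) blast
  obtain f2 f2' \<delta>2 B2 where f2: "\<And>n k. times_diff k (f2 n)"
    "\<And>n t. (f2 n has_real_derivative f2' n t) (at t)" "\<And>n t. 0 \<le> f2 n t" "\<And>n t. \<bar>f2' n t\<bar> \<le> B2"
    "\<And>n. 0 < \<delta>2 n" "\<And>n t. t \<le> m + \<delta>2 n \<or> 1 - \<delta>2 n \<le> t \<Longrightarrow> f2 n t = 0"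
    "\<And>t. (\<lambda>n. f2' n t) \<longlonglongrightarrow> H2 / (s2 - m) * indicator {m<..<s2} t - H2 / (1 - s2) * indicator {s2<..<1} t"
    "\<And>t. \<lbrakk>0 < H2; m < t; t < 1\<rbrakk> \<Longrightarrow> \<forall>\<^sub>F n in sequentially. 0 < f2 n t"
    by (rule smooth_hats[OF s2 H(2)]) blast
  obtain f3 f3' \<delta>3 B3 where f3: "\<And>n k. times_diff k (f3 n)"
    "\<And>n t. (f3 n has_real_derivative f3' n t) (at t)" "\<And>n t. 0 \<le> f3 n t" "\<And>n t. \<bar>f3' n t\<bar> \<le> B3"
    "\<And>n. 0 < \<delta>3 n" "\<And>n t. t \<le> 0 + \<delta>3 n \<or> 1 - \<delta>3 n \<le> t \<Longrightarrow> f3 n t = 0"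
    "\<And>t. (\<lambda>n. f3' n t) \<longlonglongrightarrow> H3 / (m - 0) * indicator {0<..<m} t - H3 / (1 - m) * indicator {m<..<1} t"
    "\<And>t. \<lbrakk>0 < H3; 0 < t; t < 1\<rbrakk> \<Longrightarrow> \<forall>\<^sub>F n in sequentially. 0 < f3 n t"
    by (rule smooth_hats[OF m H(3)]) blast
  define f where "f = (\<lambda>n t. f1 n t + f2 n t + f3 n t)"
  define f' where "f' = (\<lambda>n t. f1' n t + f2' n t + f3' n t)"
  define B where "B = c + (B1 + B2 + B3)"
  define L where "L = \<tau>2 * m + (1 - m)"
  have L: "0 < L" unfolding L_def using \<tau>2 m by (intro add_nonneg_pos) auto
  have df: "(f n has_real_derivative f' n t) (at t)" for n t
    unfolding f_def f'_def by (intro DERIV_add f1 f2 f3)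
  have smooth: "times_diff k (f n)" for n k
    unfolding f_def by (intro times_diff_add f1 f2 f3)
  have f0: "0 \<le> f n t" for n t
    using f1(3)[of n t] f2(3)[of n t] f3(3)[of n t] by (simp add: f_def)
  have GB: "\<bar>G t + f' n t\<bar> \<le> B" for n t
    using G_bounds[of t] f1(4)[of n t] f2(4)[of n t] f3(4)[of n t] unfolding B_def f'_def by linarith
  have test: "(\<lambda>x. f n (x 0)) \<in> test_functions 1 (pt ` punctured {})" for n
  proof (rule test_function_coord[OF smooth])
    define d where "d = min (\<delta>1 n) (min (\<delta>2 n) (\<delta>3 n))"
    have d: "0 < d" "d \<le> \<delta>1 n" "d \<le> \<delta>2 n" "d \<le> \<delta>3 n"
      using f1(5)[of n] f2(5)[of n] f3(5)[of n] by (auto simp: d_def)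
    show "{d..1 - d} \<subseteq> punctured {}" using d by auto
    fix t assume "t \<notin> {d..1 - d}"
    then have "t < d \<or> 1 - d < t" by auto
    then have "f1 n t = 0" "f2 n t = 0" "f3 n t = 0"
      using d m by (intro f1(6) f2(6) f3(6); linarith)+
    then show "f n t = 0" by (simp add: f_def)
  qed
  have f'_cont: "continuous_on UNIV (f' n)" for n
  proof -
    have "f' n = deriv (f n)" using df by (auto intro!: DERIV_imp_deriv[symmetric])
    moreover have "times_diff (Suc 0) (deriv (f n))" by (rule times_diff_deriv(2)) (rule smooth)
    ultimately show ?thesis using times_diff_imp_continuous_on by metis
  qed
  have f'_meas: "f' n \<in> borel_measurable lebesgue" for n
    by (rule continuous_imp_lebesgue_measurable[OF f'_cont])
  have G_meas: "G \<in> borel_measurable lebesgue"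
    using measurable_G by (intro measurable_completion) simp
  have Gf_meas: "(\<lambda>t. G t + f' n t) \<in> borel_measurable lebesgue" for n
    using G_meas f'_meas by (rule borel_measurable_add)
  have f_cont: "continuous_on A (f n)" for A n
    using df by (intro continuous_at_imp_continuous_on ballI) (blast intro: DERIV_isCont)
  \<comment> \<open>The part of the unit interval on which the perturbed function differs from \<open>U\<close>.\<close>
  define T where "T = (\<lambda>n. {0<..<1} \<inter> f n -` (- {0}))"
  have T_sets: "T n \<in> sets lebesgue" for n
  proof -
    have "open (T n)" unfolding T_def by (rule continuous_open_preimage[OF f_cont]) auto
    then show ?thesis by auto
  qed
  have u': "\<And>t. t \<in> punctured {} \<Longrightarrow> u (pt t) = U t" using u by simp
  have energy: "energy_on p (T n) G
    \<le> ennreal Q' * energy_on p {0<..<1} (\<lambda>t. G t + f' n t)" for n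
  proof -
    let ?A = "{x \<in> pt ` punctured {}. f n (x 0) \<noteq> 0}"
    have AT: "AE t in lebesgue. pt t \<in> ?A \<longleftrightarrow> t \<in> T n" by (auto simp: T_def)
    have mT: "set_borel_measurable lebesgue (T n) k" if "k \<in> borel_measurable lebesgue" for k :: "real \<Rightarrow> real"
      unfolding set_borel_measurable_def using that T_sets
      by (intro borel_measurable_scaleR borel_measurable_indicator) auto
    have e1: "p_energy 1 p (pt ` punctured {}) u ?A = energy_on p (T n) G"
      by (rule p_energy_pt[OF _ U_weak_gradient(1)[OF _ u'] _ AT mT[OF G_meas] T_sets]) auto
    have wg: "has_weak_gradient 1 (pt ` punctured {}) (\<lambda>x. u x + f n (x 0)) (\<lambda>x i. (\<lambda>t. G t + f' n t) (x 0))"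
    proof (rule piecewise_C1_weak_gradient(1)[where S = "{s1, m, s2}" and U = "\<lambda>t. U t + f n t" and B = B])
      show "continuous_on {0..1} (\<lambda>t. U t + f n t)" by (intro continuous_on_add continuous_U f_cont)
      show "((\<lambda>t. U t + f n t) has_real_derivative G t + f' n t) (at t)" if "t \<in> {0<..<1} - {s1, m, s2}" for t
        using that by (intro DERIV_add DERIV_U df) auto
      show "(\<lambda>t. indicator {0<..<1} t * (G t + f' n t)) \<in> borel_measurable lebesgue"
        using Gf_meas by (intro borel_measurable_times borel_measurable_indicator) auto
    qed (use GB u in auto)
    have e2: "p_energy 1 p (pt ` punctured {}) (\<lambda>x. u x + f n (x 0)) ?A
      = energy_on p (T n) (\<lambda>t. G t + f' n t)"
      by (rule p_energy_pt[OF _ wg _ AT mT[OF Gf_meas] T_sets]) auto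
    have "p_energy 1 p (pt ` punctured {}) u ?A \<le> ennreal Q' * p_energy 1 p (pt ` punctured {}) (\<lambda>x. u x + f n (x 0)) ?A"
      using qs test_function_in_W1p_0[OF _ p test[of n]] f0[of n]
      unfolding Q_quasisuperminimizer_def by simp
    also have "\<dots> \<le> ennreal Q' * energy_on p {0<..<1} (\<lambda>t. G t + f' n t)"
      unfolding e2 by (intro mult_left_mono nn_integral_mono) (auto simp: T_def split: split_indicator)
    finally show ?thesis unfolding e1 .
  qed
  have fin: "(\<integral>\<^sup>+t. ennreal (B powr p) * indicator {0<..<1::real} t \<partial>lebesgue) < \<infinity>"
    by (subst nn_integral_cmult_indicator) (auto simp: ennreal_mult_less_top)
  have pw_meas: "(\<lambda>t. ennreal (\<bar>k t\<bar> powr p) * indicator S t) \<in> borel_measurable lebesgue"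
    if "k \<in> borel_measurable lebesgue" "S \<in> sets lebesgue" for k :: "real \<Rightarrow> real" and S
    using that by measurable
  have AEt: "AE t in lebesgue. (t :: real) \<notin> {s1, m, s2}" by (rule AE_not_in_finite) simp
  have lim_right: "(\<lambda>n. \<integral>\<^sup>+t\<in>{0<..<1}. ennreal (\<bar>G t + f' n t\<bar> powr p) \<partial>lebesgue)
    \<longlonglongrightarrow> energy_on p {0<..<1::real} (\<lambda>t. L)"
  proof (rule nn_integral_dominated_convergence[OF _ _ _ _ fin])
    show "AE t in lebesgue. ennreal (\<bar>G t + f' n t\<bar> powr p) * indicator {0<..<1} t
        \<le> ennreal (B powr p) * indicator {0<..<1} t" for n
      using GB p by (intro AE_I2) (auto intro!: ennreal_leI powr_mono2 split: split_indicator)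
    show "AE t in lebesgue. (\<lambda>n. ennreal (\<bar>G t + f' n t\<bar> powr p) * indicator {0<..<1} t)
        \<longlonglongrightarrow> ennreal (\<bar>L\<bar> powr p) * indicator {0<..<1} t"
      using AEt
    proof eventually_elim
      fix t assume t: "t \<notin> {s1, m, s2}"
      show "(\<lambda>n. ennreal (\<bar>G t + f' n t\<bar> powr p) * indicator {0<..<1} t) \<longlonglongrightarrow> ennreal (\<bar>L\<bar> powr p) * indicator {0<..<1} t"
      proof (cases "t \<in> {0<..<1}")
        case True
        have "(\<lambda>n. G t + (f1' n t + f2' n t + f3' n t)) \<longlonglongrightarrow> L"
          unfolding L_def chord_slopes[OF True t, symmetric]
          unfolding H1_def[symmetric] H2_def[symmetric] H3_def[symmetric]
          by (intro tendsto_add tendsto_const f1 f2 f3)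
        then have "(\<lambda>n. ennreal (\<bar>G t + f' n t\<bar> powr p)) \<longlonglongrightarrow> ennreal (\<bar>L\<bar> powr p)"
          using L p unfolding f'_def by (intro tendsto_intros tendsto_ennrealI) auto
        then show ?thesis using True by simp
      qed simp
    qed
    show "(\<lambda>t. ennreal (\<bar>G t + f' n t\<bar> powr p) * indicator {0<..<1} t) \<in> borel_measurable lebesgue" for n
      by (rule pw_meas[OF Gf_meas]) simp
    show "(\<lambda>t::real. ennreal (\<bar>L\<bar> powr p) * indicator {0<..<1} t) \<in> borel_measurable lebesgue"
      by (rule pw_meas[OF borel_measurable_const]) simp
    show "(\<lambda>t::real. ennreal (B powr p) * indicator {0<..<1} t) \<in> borel_measurable lebesgue"
      by (intro borel_measurable_times_ennreal borel_measurable_const borel_measurable_indicator) simp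
  qed
  have lim_left: "(\<lambda>n. \<integral>\<^sup>+t\<in>T n. ennreal (\<bar>G t\<bar> powr p) \<partial>lebesgue)
    \<longlonglongrightarrow> energy_on p {0<..<1} G"
  proof (rule nn_integral_dominated_convergence[OF _ _ _ _ fin])
    have cB: "c \<le> B"
      unfolding B_def using f1(4)[of 0 0] f2(4)[of 0 0] f3(4)[of 0 0] by linarith
    have GB': "\<bar>G t\<bar> \<le> B" for t using G_bounds[of t] cB by simp
    show "AE t in lebesgue. ennreal (\<bar>G t\<bar> powr p) * indicator (T n) t
        \<le> ennreal (B powr p) * indicator {0<..<1} t" for n
      using GB' p by (intro AE_I2) (auto intro!: ennreal_leI powr_mono2 simp: T_def split: split_indicator)
    show "AE t in lebesgue. (\<lambda>n. ennreal (\<bar>G t\<bar> powr p) * indicator (T n) t)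
        \<longlonglongrightarrow> ennreal (\<bar>G t\<bar> powr p) * indicator {0<..<1} t"
      using AEt
    proof eventually_elim
      fix t assume t: "t \<notin> {s1, m, s2}"
      show "(\<lambda>n. ennreal (\<bar>G t\<bar> powr p) * indicator (T n) t) \<longlonglongrightarrow> ennreal (\<bar>G t\<bar> powr p) * indicator {0<..<1} t"
      proof (cases "t \<in> {0<..<1}")
        case True
        have "\<forall>\<^sub>F n in sequentially. 0 < f1 n t \<or> 0 < f2 n t \<or> 0 < f3 n t"
        proof (cases "\<tau>2 = 1")
          case False
          then have "0 < H3" using \<tau>2 m by (simp add: H3_def)
          from f3(8)[OF this, of t] True show ?thesis by (auto elim: eventually_mono)
        next
          case \<tau>2_1: True
          then have "\<tau>1 < 1" using \<open>\<not> (\<tau>1 = 1 \<and> \<tau>2 = 1)\<close> \<tau>1 by auto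
          then have H': "0 < H1" "0 < H2" using c(4) \<tau>2 s1 s2 by (auto simp: H1_def H2_def)
          show ?thesis
          proof (cases "t < m")
            case t_m: True
            from f1(8)[OF H'(1), of t] t_m True show ?thesis by (auto elim: eventually_mono)
          next
            case False
            from f2(8)[OF H'(2), of t] False t True show ?thesis by (auto elim: eventually_mono)
          qed
        qed
        then have "\<forall>\<^sub>F n in sequentially. t \<in> T n"
        proof eventually_elim
          fix n assume "0 < f1 n t \<or> 0 < f2 n t \<or> 0 < f3 n t"
          then have "0 < f n t"
            unfolding f_def using f1(3)[of n t] f2(3)[of n t] f3(3)[of n t] by linarith
          then show "t \<in> T n" using True by (simp add: T_def)
        qed
        then show ?thesis
          by (intro tendsto_eventually) (use True in \<open>auto elim: eventually_mono\<close>)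
      next
        case False
        then have "t \<notin> T n" for n by (auto simp: T_def)
        with False show ?thesis by simp
      qed
    qed
    show "(\<lambda>t. ennreal (\<bar>G t\<bar> powr p) * indicator (T n) t) \<in> borel_measurable lebesgue" for n
      by (rule pw_meas[OF G_meas T_sets])
    show "(\<lambda>t. ennreal (\<bar>G t\<bar> powr p) * indicator {0<..<1} t) \<in> borel_measurable lebesgue"
      by (rule pw_meas[OF G_meas]) simp
    show "(\<lambda>t::real. ennreal (B powr p) * indicator {0<..<1} t) \<in> borel_measurable lebesgue"
      by (intro borel_measurable_times_ennreal borel_measurable_const borel_measurable_indicator) simp
  qed
  have "energy_on p {0<..<1} G
    \<le> ennreal Q' * energy_on p {0<..<1::real} (\<lambda>t. L)"
    by (rule LIMSEQ_le[OF lim_left ennreal_tendsto_cmult[OF _ lim_right]]) (use energy in auto)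
  then have "ennreal (Q1 * Q2 * L powr p) \<le> ennreal Q' * ennreal (L powr p)"
    unfolding energy_G L_def[symmetric] using L by (simp add: nn_integral_cmult_indicator)
  then have "Q1 * Q2 * L powr p \<le> Q' * L powr p"
    using Q' by (simp add: ennreal_mult'[symmetric] ennreal_le_iff)
  then show ?thesis using L by simp
qed

end

theorem theorem5p1:
  fixes p Q\<^sub>1 Q\<^sub>2 :: real
  assumes "1 < p" and "1 \<le> Q\<^sub>1" and "1 \<le> Q\<^sub>2"
  shows "\<exists>(n::nat) \<Omega>\<^sub>1 \<Omega>\<^sub>2 u\<^sub>1 u\<^sub>2.
    0 < n \<and>
    openin (Rn n) \<Omega>\<^sub>1 \<and> openin (Rn n) \<Omega>\<^sub>2 \<and> \<Omega>\<^sub>1 \<noteq> {} \<and> \<Omega>\<^sub>2 \<noteq> {} \<and> \<Omega>\<^sub>1 \<subseteq> \<Omega>\<^sub>2 \<and>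
    Q_quasiminimizer n p Q\<^sub>1 \<Omega>\<^sub>1 u\<^sub>1 \<and>
    Q_quasiminimizer n p Q\<^sub>2 \<Omega>\<^sub>2 u\<^sub>2 \<and>
    (let u = (\<lambda>x. if x \<in> \<Omega>\<^sub>1 then min (u\<^sub>1 x) (u\<^sub>2 x) else u\<^sub>2 x)
     in quasisuperminimizer n p \<Omega>\<^sub>2 u \<and>
        optimal_quasisuperminimizer_constant n p \<Omega>\<^sub>2 u (Q\<^sub>1 * Q\<^sub>2))"
proof -
  obtain \<tau>1 \<beta>1 where 1: "0 < \<tau>1" "\<tau>1 \<le> 1" "0 < \<beta>1" "\<beta>1 < 1"
    "\<tau>1 powr p * (1 - \<beta>1) + \<beta>1 = Q\<^sub>1 * (\<tau>1 * (1 - \<beta>1) + \<beta>1) powr p"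
    "\<And>\<sigma> b. \<lbrakk>\<tau>1 \<le> \<sigma>; \<sigma> \<le> 1; 0 \<le> b; b \<le> 1\<rbrakk>
      \<Longrightarrow> \<sigma> powr p * (1 - b) + b \<le> Q\<^sub>1 * (\<sigma> * (1 - b) + b) powr p"
    by (rule kink_parameters[OF assms(1,2)]) blast
  obtain \<tau>2 \<beta>2 where 2: "0 < \<tau>2" "\<tau>2 \<le> 1" "0 < \<beta>2" "\<beta>2 < 1"
    "\<tau>2 powr p * (1 - \<beta>2) + \<beta>2 = Q\<^sub>2 * (\<tau>2 * (1 - \<beta>2) + \<beta>2) powr p"
    "\<And>\<sigma> b. \<lbrakk>\<tau>2 \<le> \<sigma>; \<sigma> \<le> 1; 0 \<le> b; b \<le> 1\<rbrakk>
      \<Longrightarrow> \<sigma> powr p * (1 - b) + b \<le> Q\<^sub>2 * (\<sigma> * (1 - b) + b) powr p"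
    by (rule kink_parameters[OF assms(1,3)]) blast
  interpret nested_kinks p Q\<^sub>1 Q\<^sub>2 \<tau>1 \<beta>1 \<tau>2 \<beta>2
    by unfold_locales (use assms 1 2 in auto)
  let ?\<Omega>1 = "pt ` punctured {m}" and ?\<Omega>2 = "pt ` punctured {}"
  let ?u1 = "\<lambda>x :: nat \<Rightarrow> real. U (x 0)" and ?u2 = "\<lambda>x :: nat \<Rightarrow> real. kink \<tau>2 m (x 0)"
  define u where "u = (\<lambda>x. if x \<in> ?\<Omega>1 then min (?u1 x) (?u2 x) else ?u2 x)"
  have u: "u (pt t) = U t" if "t \<in> {0<..<1}" for t
    using U_le[of t] that by (auto simp: u_def kink_def U_m)
  have Q12: "1 \<le> Q\<^sub>1 * Q\<^sub>2"
    using assms mult_mono[of 1 "Q\<^sub>1" 1 "Q\<^sub>2"] by simp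
  have ne: "m / 2 \<in> punctured {m}" using m by simp
  have "openin (Rn 1) ?\<Omega>1" "openin (Rn 1) ?\<Omega>2"
    by (intro openin_pt_image open_punctured; simp)+
  moreover have "?\<Omega>1 \<subseteq> ?\<Omega>2" by auto
  moreover have "?\<Omega>1 \<noteq> {}" using ne by blast
  moreover from calculation have "?\<Omega>2 \<noteq> {}" by blast
  moreover have "quasisuperminimizer 1 p ?\<Omega>2 u"
    unfolding quasisuperminimizer_def using glued_quasisuperminimizer[OF u] Q12 by blast
  moreover have "optimal_quasisuperminimizer_constant 1 p ?\<Omega>2 u (Q\<^sub>1 * Q\<^sub>2)"
    unfolding optimal_quasisuperminimizer_constant_def
    using glued_quasisuperminimizer[OF u] optimal[OF u] Q12 by blast
  ultimately show ?thesis
    using inner_quasiminimizer outer_quasiminimizer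
    unfolding Let_def u_def
    by (intro exI[of _ 1] exI[of _ ?\<Omega>1] exI[of _ ?\<Omega>2] exI[of _ ?u1] exI[of _ ?u2]) simp
qed

end
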